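(* Let $X$ be a compact Hausdorff space and $\Gamma$ a countable discrete group with an amenable action on $X$ by homeomorphisms. Then the reduced crossed product $C(X)\rtimes_r\Gamma$ is $C^*$-isomorphic to the $C^*$-subalgebra of $\prod_{x\in X}\mathcal{B}(\ell^2(\Gamma))$ consisting of those families $(T_x)_{x\in X}$ which are uniformly quasi-local, satisfy $(T_{\gamma x})_{\alpha,\beta}=(T_x)_{\alpha\gamma,\beta\gamma}$ for all $x\in X$ and $\alpha,\beta,\gamma\in\Gamma$, and are such that the map $X\to\mathcal{B}(\ell^2(\Gamma))$, $x\mapsto T_x$, is continuous for the weak operator topology (WOT).
   Context: For $T\in\mathcal{B}(\ell^2(\Gamma))$, $T_{\alpha,\beta}=\langle\delta_\alpha,T\delta_\beta\rangle$. $\prod_{x\in X}\mathcal{B}(\ell^2(\Gamma))$ is the $C^*$-algebra of uniformly norm-bounded families. $\Gamma$ is equipped with a metric $d(\alpha,\beta)=\ell(\alpha\beta^{-1})$ where $\ell$ is a proper length function on $\Gamma$ (proper: balls are finite). A family $(T_x)_{x\in X}$ is uniformly quasi-local if for any $\varepsilon>0$ there is $R>0$ such that for all $x\in X$ and all $f,g\in\ell^\infty(\Gamma)$ with $d(\mathrm{supp}(f),\mathrm{supp}(g))>R$ we have $\|fT_xg\|<\varepsilon\|f\|_\infty\|g\|_\infty$ (read as $\le$ when $f=0$ or $g=0$), functions acting by pointwise multiplication. The action is amenable in the topological sense (equivalently, the transformation groupoid $X\rtimes\Gamma$ is amenable): for every $\varepsilon>0$ and finite $F\subseteq\Gamma$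 there is a continuous map $m$ from $X$ to the probability measures on $\Gamma$ (with $\ell^1$-pointwise/weak-* continuity) with $\sup_{x\in X}\|m(\gamma x)-\gamma\cdot m(x)\|_1<\varepsilon$ for all $\gamma\in F$. *)

theory Defs
  imports "HOL-Analysis.Analysis" "HOL-Probability.Probability"
begin

section \<open>The Hilbert space of square summable functions\<close>

typedef 'i ell2 = "{f :: 'i \<Rightarrow> complex. (\<lambda>i. (cmod (f i))\<^sup>2) summable_on UNIV}"
  morphisms ell2_coeff Abs_ell2
  by (rule exI[of _ "\<lambda>_. 0"]) simp

setup_lifting type_definition_ell2

lemma square_summable_add:
  fixes f g :: "'i \<Rightarrow> complex"
  assumes "(\<lambda>i. (cmod (f i))\<^sup>2) summable_on A" "(\<lambda>i. (cmod (g i))\<^sup>2) summable_on A"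
  shows "(\<lambda>i. (cmod (f i + g i))\<^sup>2) summable_on A"
proof (rule summable_on_comparison_test)
  show "(\<lambda>i. 2 * (cmod (f i))\<^sup>2 + 2 * (cmod (g i))\<^sup>2) summable_on A"
    by (intro summable_on_add summable_on_cmult_right assms)
  fix i
  have "(cmod (f i + g i))\<^sup>2 \<le> (cmod (f i) + cmod (g i))\<^sup>2"
    by (intro power_mono norm_triangle_ineq) auto
  also have "\<dots> \<le> 2 * (cmod (f i))\<^sup>2 + 2 * (cmod (g i))\<^sup>2"
    using sum_squares_bound[of "cmod (f i)" "cmod (g i)"] by (simp add: power2_sum)
  finally show "(cmod (f i + g i))\<^sup>2 \<le> 2 * (cmod (f i))\<^sup>2 + 2 * (cmod (g i))\<^sup>2" .
qed auto

lemma square_summable_bounded_mult: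
  fixes f g :: "'i \<Rightarrow> complex"
  assumes "(\<lambda>i. (cmod (f i))\<^sup>2) summable_on A" "\<And>i. cmod (g i) \<le> K"
  shows "(\<lambda>i. (cmod (g i * f i))\<^sup>2) summable_on A"
proof (rule summable_on_comparison_test)
  show "(\<lambda>i. K\<^sup>2 * (cmod (f i))\<^sup>2) summable_on A"
    by (intro summable_on_cmult_right assms)
  fix i
  show "(cmod (g i * f i))\<^sup>2 \<le> K\<^sup>2 * (cmod (f i))\<^sup>2"
    unfolding norm_mult power_mult_distrib
    by (intro mult_right_mono power_mono assms) auto
qed auto

lemma square_summable_inner:
  fixes f g :: "'i \<Rightarrow> complex"
  assumes "(\<lambda>i. (cmod (f i))\<^sup>2) summable_on A" "(\<lambda>i. (cmod (g i))\<^sup>2) summable_on A"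
  shows "(\<lambda>i. f i \<bullet> g i) summable_on A"
proof -
  have "(\<lambda>i. f i \<bullet> g i) =
    (\<lambda>i. ((cmod (f i + g i))\<^sup>2 + (-1) * (cmod (f i))\<^sup>2 + (-1) * (cmod (g i))\<^sup>2) * (1/2))"
    by (simp add: dot_norm)
  moreover have "(\<lambda>i. ((cmod (f i + g i))\<^sup>2 + (-1) * (cmod (f i))\<^sup>2 + (-1) * (cmod (g i))\<^sup>2) * (1/2)) summable_on A"
    by (intro summable_on_cmult_left summable_on_add summable_on_cmult_right square_summable_add assms)
  ultimately show ?thesis by (simp only:)
qed

instantiation ell2 :: (type) real_inner
begin

lift_definition zero_ell2 :: "'a ell2" is "\<lambda>_. 0" by simp

lift_definition plus_ell2 :: "'a ell2 \<Rightarrow> 'a ell2 \<Rightarrow> 'a ell2" is "\<lambda>f g i. f i + g i"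
  by (rule square_summable_add)

lift_definition uminus_ell2 :: "'a ell2 \<Rightarrow> 'a ell2" is "\<lambda>f i. - f i" by simp

lift_definition minus_ell2 :: "'a ell2 \<Rightarrow> 'a ell2 \<Rightarrow> 'a ell2" is "\<lambda>f g i. f i - g i"
  subgoal for f g using square_summable_add[of f UNIV "\<lambda>i. - g i"] by simp
  done

lift_definition scaleR_ell2 :: "real \<Rightarrow> 'a ell2 \<Rightarrow> 'a ell2" is "\<lambda>r f i. r *\<^sub>R f i"
  by (simp add: power_mult_distrib summable_on_cmult_right)

definition inner_ell2 :: "'a ell2 \<Rightarrow> 'a ell2 \<Rightarrow> real" where
  "inner_ell2 \<xi> \<eta> = (\<Sum>\<^sub>\<infinity>i. ell2_coeff \<xi> i \<bullet> ell2_coeff \<eta> i)"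

definition norm_ell2 :: "'a ell2 \<Rightarrow> real" where
  "norm_ell2 \<xi> = sqrt (inner \<xi> \<xi>)"

definition sgn_ell2 :: "'a ell2 \<Rightarrow> 'a ell2" where
  "sgn_ell2 \<xi> = inverse (norm \<xi>) *\<^sub>R \<xi>"

definition dist_ell2 :: "'a ell2 \<Rightarrow> 'a ell2 \<Rightarrow> real" where
  "dist_ell2 \<xi> \<eta> = norm (\<xi> - \<eta>)"

definition uniformity_ell2 :: "('a ell2 \<times> 'a ell2) filter" where
  "uniformity_ell2 = (INF e\<in>{0 <..}. principal {(\<xi>, \<eta>). dist \<xi> \<eta> < e})"

definition open_ell2 :: "'a ell2 set \<Rightarrow> bool" where
  "open_ell2 U \<longleftrightarrow> (\<forall>\<xi>\<in>U. \<forall>\<^sub>F (\<xi>', \<eta>) in uniformity. \<xi>' = \<xi> \<longrightarrow> \<eta> \<in> U)"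

instance
proof
  fix x y z :: "'a ell2" and a b :: real
  have summable: "(\<lambda>i. ell2_coeff u i \<bullet> ell2_coeff v i) summable_on UNIV" for u v :: "'a ell2"
    using ell2_coeff[of u] ell2_coeff[of v] by (intro square_summable_inner) auto
  show "x + y + z = x + (y + z)" by transfer (simp add: add.assoc)
  show "x + y = y + x" by transfer (simp add: add.commute)
  show "0 + x = x" by transfer simp
  show "- x + x = 0" by transfer simp
  show "x - y = x + - y" by transfer simp
  show "a *\<^sub>R (x + y) = a *\<^sub>R x + a *\<^sub>R y" by transfer (simp add: algebra_simps)
  show "(a + b) *\<^sub>R x = a *\<^sub>R x + b *\<^sub>R x" by transfer (simp add: algebra_simps)
  show "a *\<^sub>R b *\<^sub>R x = (a * b) *\<^sub>R x" by transfer simp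
  show "1 *\<^sub>R x = x" by transfer simp
  show "sgn x = inverse (norm x) *\<^sub>R x" by (rule sgn_ell2_def)
  show "dist x y = norm (x - y)" by (rule dist_ell2_def)
  show "(uniformity :: ('a ell2 \<times> 'a ell2) filter) = (INF e\<in>{0 <..}. principal {(x, y). dist x y < e})"
    by (rule uniformity_ell2_def)
  show "open U \<longleftrightarrow> (\<forall>x\<in>U. \<forall>\<^sub>F (x', y) in uniformity. x' = x \<longrightarrow> y \<in> U)" for U :: "'a ell2 set"
    by (rule open_ell2_def)
  show "x \<bullet> y = y \<bullet> x" unfolding inner_ell2_def by (simp add: inner_commute)
  show "(x + y) \<bullet> z = x \<bullet> z + y \<bullet> z"
    unfolding inner_ell2_def plus_ell2.rep_eq inner_add_left
    by (rule infsum_add[OF summable summable])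
  show "(a *\<^sub>R x) \<bullet> y = a * (x \<bullet> y)"
    unfolding inner_ell2_def scaleR_ell2.rep_eq inner_scaleR_left by (rule infsum_cmult_right')
  show "0 \<le> x \<bullet> x" unfolding inner_ell2_def by (rule infsum_nonneg) simp
  show "x \<bullet> x = 0 \<longleftrightarrow> x = 0"
  proof
    assume "x \<bullet> x = 0"
    then have "ell2_coeff x i \<bullet> ell2_coeff x i = 0" for i
      using nonneg_infsum_le_0D[OF _ summable, of x x i] unfolding inner_ell2_def by simp
    then show "x = 0" by transfer auto
  qed (simp add: inner_ell2_def zero_ell2.rep_eq)
  show "norm x = sqrt (x \<bullet> x)" by (rule norm_ell2_def)
qed

end

lift_definition scaleC_ell2 :: "complex \<Rightarrow> 'i ell2 \<Rightarrow> 'i ell2" is "\<lambda>c f i. c * f i"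
  by (simp add: norm_mult power_mult_distrib summable_on_cmult_right)

text \<open>The inner product is conjugate linear in the first argument.\<close>

definition cinner :: "'i ell2 \<Rightarrow> 'i ell2 \<Rightarrow> complex" where
  "cinner \<xi> \<eta> = (\<Sum>\<^sub>\<infinity>i. cnj (ell2_coeff \<xi> i) * ell2_coeff \<eta> i)"

lift_definition delta :: "'i \<Rightarrow> 'i ell2" is "\<lambda>a i. if i = a then 1 else 0"
proof -
  fix a :: 'i
  have "(\<lambda>i. (cmod (if i = a then 1 else 0))\<^sup>2) summable_on {a}" by simp
  then show "(\<lambda>i. (cmod (if i = a then 1 else 0))\<^sup>2) summable_on UNIV"
    by (subst summable_on_cong_neutral[where T = "{a}"]) auto
qed

lemma norm_ell2_sq: "(norm \<xi>)\<^sup>2 = (\<Sum>\<^sub>\<infinity>i. (cmod (ell2_coeff \<xi> i))\<^sup>2)"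
  by (simp add: power2_norm_eq_inner inner_ell2_def)

section \<open>Bounded operators\<close>

type_synonym 'i op = "'i ell2 \<Rightarrow>\<^sub>L 'i ell2"

text \<open>The library type of bounded operators consists of real linear maps, so complex linearity
  is imposed separately.\<close>

definition clinear_op :: "'i op \<Rightarrow> bool" where
  "clinear_op T \<longleftrightarrow> (\<forall>c \<xi>. T (scaleC_ell2 c \<xi>) = scaleC_ell2 c (T \<xi>))"

definition matrix_coeff :: "'i op \<Rightarrow> 'i \<Rightarrow> 'i \<Rightarrow> complex" where
  "matrix_coeff T \<alpha> \<beta> = cinner (delta \<alpha>) (T (delta \<beta>))"

definition adjoint_op :: "'i op \<Rightarrow> 'i op" where
  "adjoint_op T = (THE S. clinear_op S \<and> (\<forall>\<xi> \<eta>. cinner (S \<xi>) \<eta> = cinner \<xi> (T \<eta>)))"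

text \<open>Pointwise multiplication by a bounded function; the value for an unbounded function is a
  dummy.\<close>

lift_definition mult_ell2 :: "('i \<Rightarrow> complex) \<Rightarrow> 'i ell2 \<Rightarrow> 'i ell2"
  is "\<lambda>f \<xi> i. if bounded (range f) then f i * \<xi> i else 0"
  subgoal premises prems for f \<xi>
  proof (cases "bounded (range f)")
    case True
    then obtain K where "\<And>i. cmod (f i) \<le> K" unfolding bounded_iff by auto
    with square_summable_bounded_mult[of \<xi> UNIV f K] show ?thesis
      using prems True by simp
  qed simp
  done

lift_definition mult_op :: "('i \<Rightarrow> complex) \<Rightarrow> 'i op" is mult_ell2
proof -
  fix f :: "'i \<Rightarrow> complex"
  obtain K where K: "bounded (range f) \<Longrightarrow> cmod (f i) \<le> K" for i
    unfolding bounded_iff by (cases "\<exists>K. \<forall>i. cmod (f i) \<le> K") auto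
  have le: "cmod (ell2_coeff (mult_ell2 f \<xi>) i) \<le> \<bar>K\<bar> * cmod (ell2_coeff \<xi> i)" for \<xi> i
  proof (cases "bounded (range f)")
    case True
    have "cmod (f i) \<le> \<bar>K\<bar>" using K[OF True, of i] by linarith
    with True show ?thesis
      by (simp add: mult_ell2.rep_eq norm_mult mult_right_mono)
  qed (simp add: mult_ell2.rep_eq)
  show "bounded_linear (mult_ell2 f)"
  proof (rule bounded_linear_intro[where K = "\<bar>K\<bar>"])
    show "mult_ell2 f (\<xi> + \<eta>) = mult_ell2 f \<xi> + mult_ell2 f \<eta>" for \<xi> \<eta>
      by transfer (auto simp: distrib_left)
    show "mult_ell2 f (r *\<^sub>R \<xi>) = r *\<^sub>R mult_ell2 f \<xi>" for r \<xi>
      by transfer auto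
    fix \<xi> :: "'i ell2"
    have "(norm (mult_ell2 f \<xi>))\<^sup>2 \<le> (\<Sum>\<^sub>\<infinity>i. \<bar>K\<bar>\<^sup>2 * (cmod (ell2_coeff \<xi> i))\<^sup>2)"
      unfolding norm_ell2_sq
    proof (rule infsum_mono)
      show "(\<lambda>i. (cmod (ell2_coeff (mult_ell2 f \<xi>) i))\<^sup>2) summable_on UNIV"
        using ell2_coeff[of "mult_ell2 f \<xi>"] by simp
      show "(\<lambda>i. \<bar>K\<bar>\<^sup>2 * (cmod (ell2_coeff \<xi> i))\<^sup>2) summable_on UNIV"
        using ell2_coeff[of \<xi>] by (intro summable_on_cmult_right) simp
      show "(cmod (ell2_coeff (mult_ell2 f \<xi>) i))\<^sup>2 \<le> \<bar>K\<bar>\<^sup>2 * (cmod (ell2_coeff \<xi> i))\<^sup>2" for i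
        using power_mono[OF le[of \<xi> i], of 2] by (simp only: norm_ge_zero power_mult_distrib)
    qed
    also have "\<dots> = (norm \<xi> * \<bar>K\<bar>)\<^sup>2"
      by (simp only: infsum_cmult_right' norm_ell2_sq power_mult_distrib mult.commute)
    finally show "norm (mult_ell2 f \<xi>) \<le> norm \<xi> * \<bar>K\<bar>"
      by (rule power2_le_imp_le) simp
  qed
qed

text \<open>The weak operator topology is the initial topology of the maps
  \<open>T \<mapsto> \<langle>\<xi>, T \<eta>\<rangle>\<close>.\<close>

definition weak_operator_topology :: "'i op topology" where
  "weak_operator_topology =
     pullback_topology UNIV (\<lambda>T (\<xi>, \<eta>). cinner \<xi> (blinfun_apply T \<eta>)) euclidean"

lemma continuous_map_weak_operator_topology_iff:
  "continuous_map Z weak_operator_topology T \<longleftrightarrow>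
     (\<forall>\<xi> \<eta>. continuous_map Z euclidean (\<lambda>z. cinner \<xi> (blinfun_apply (T z) \<eta>)))"
  (is "?L \<longleftrightarrow> ?R")
proof -
  let ?c = "\<lambda>T (\<xi>, \<eta>). cinner \<xi> (blinfun_apply T \<eta>)"
  have "continuous_map Z euclidean (?c \<circ> T) \<longleftrightarrow> ?R"
    unfolding euclidean_product_topology[symmetric] continuous_map_componentwise_UNIV
    by (auto simp: o_def)
  moreover have "?L \<longleftrightarrow> continuous_map Z euclidean (?c \<circ> T)"
  proof
    assume ?L
    moreover have "continuous_map weak_operator_topology euclidean (id \<circ> ?c)"
      unfolding weak_operator_topology_def by (rule continuous_map_pullback) simp
    ultimately have "continuous_map Z euclidean ((id \<circ> ?c) \<circ> T)"
      by (rule continuous_map_compose)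
    then show "continuous_map Z euclidean (?c \<circ> T)" by (simp only: id_comp)
  next
    assume "continuous_map Z euclidean (?c \<circ> T)"
    then show ?L unfolding weak_operator_topology_def by (intro continuous_map_pullback') auto
  qed
  ultimately show ?thesis by blast
qed

section \<open>C*-algebras of operators and of families of operators\<close>

record 'a cstar_struct =
  carrier :: "'a set"
  plus_c :: "'a \<Rightarrow> 'a \<Rightarrow> 'a"
  scale_c :: "complex \<Rightarrow> 'a \<Rightarrow> 'a"
  mult_c :: "'a \<Rightarrow> 'a \<Rightarrow> 'a"
  star_c :: "'a \<Rightarrow> 'a"
  norm_c :: "'a \<Rightarrow> real"

definition bounded_ops :: "'i op cstar_struct" where
  "bounded_ops =
     \<lparr>carrier = {T. clinear_op T},
      plus_c = (+),
      scale_c = (\<lambda>c T. mult_op (\<lambda>_. c) o\<^sub>L T),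
      mult_c = (o\<^sub>L),
      star_c = adjoint_op,
      norm_c = norm\<rparr>"

text \<open>The C*-algebra of uniformly norm bounded families indexed by the type \<open>'x\<close>.\<close>

definition product_algebra :: "'a cstar_struct \<Rightarrow> ('x \<Rightarrow> 'a) cstar_struct" where
  "product_algebra A =
     \<lparr>carrier = {T. (\<forall>x. T x \<in> carrier A) \<and> bdd_above (range (\<lambda>x. norm_c A (T x)))},
      plus_c = (\<lambda>S T x. plus_c A (S x) (T x)),
      scale_c = (\<lambda>c T x. scale_c A c (T x)),
      mult_c = (\<lambda>S T x. mult_c A (S x) (T x)),
      star_c = (\<lambda>T x. star_c A (T x)),
      norm_c = (\<lambda>T. SUP x. norm_c A (T x))\<rparr>"

definition cstar_subalgebra :: "'a set \<Rightarrow> 'a cstar_struct \<Rightarrow> bool" where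
  "cstar_subalgebra S A \<longleftrightarrow>
     S \<subseteq> carrier A \<and> S \<noteq> {} \<and>
     (\<forall>a\<in>S. \<forall>b\<in>S. plus_c A a b \<in> S \<and> mult_c A a b \<in> S) \<and>
     (\<forall>c. \<forall>a\<in>S. scale_c A c a \<in> S) \<and>
     (\<forall>a\<in>S. star_c A a \<in> S) \<and>
     (\<forall>s a. (\<forall>n::nat. s n \<in> S) \<and> a \<in> carrier A \<and>
        (\<lambda>n. norm_c A (plus_c A (s n) (scale_c A (-1) a))) \<longlonglongrightarrow> 0 \<longrightarrow> a \<in> S)"

text \<open>Injective *-homomorphisms of C*-algebras are automatically isometric, so an isomorphism of
  C*-algebras is just a *-isomorphism.\<close>

definition cstar_isomorphism :: "('a \<Rightarrow> 'b) \<Rightarrow> 'a cstar_struct \<Rightarrow> 'b cstar_struct \<Rightarrow> bool" where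
  "cstar_isomorphism \<Phi> A B \<longleftrightarrow>
     bij_betw \<Phi> (carrier A) (carrier B) \<and>
     (\<forall>a\<in>carrier A. \<forall>b\<in>carrier A.
        \<Phi> (plus_c A a b) = plus_c B (\<Phi> a) (\<Phi> b) \<and>
        \<Phi> (mult_c A a b) = mult_c B (\<Phi> a) (\<Phi> b)) \<and>
     (\<forall>c. \<forall>a\<in>carrier A. \<Phi> (scale_c A c a) = scale_c B c (\<Phi> a)) \<and>
     (\<forall>a\<in>carrier A. \<Phi> (star_c A a) = star_c B (\<Phi> a))"

definition cstar_isomorphic :: "'a cstar_struct \<Rightarrow> 'b cstar_struct \<Rightarrow> bool" where
  "cstar_isomorphic A B \<longleftrightarrow> (\<exists>\<Phi>. cstar_isomorphism \<Phi> A B)"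

section \<open>Group actions\<close>

text \<open>Groups are written additively, as elements of the class of not necessarily commutative groups:
  \<open>\<alpha> + \<beta>\<close> is the product \<open>\<alpha>\<beta>\<close>, \<open>0\<close> is the unit, and
  \<open>\<alpha> - \<beta>\<close> is \<open>\<alpha>\<beta>\<^sup>-\<^sup>1\<close>.\<close>

definition action_by_homeos :: "('g::group_add \<Rightarrow> 'x::topological_space \<Rightarrow> 'x) \<Rightarrow> bool" where
  "action_by_homeos act \<longleftrightarrow>
     (\<forall>x. act 0 x = x) \<and>
     (\<forall>\<gamma> \<gamma>' x. act (\<gamma> + \<gamma>') x = act \<gamma> (act \<gamma>' x)) \<and>
     (\<forall>\<gamma>. homeomorphism UNIV UNIV (act \<gamma>) (act (- \<gamma>)))"

definition l1_dist :: "'g pmf \<Rightarrow> 'g pmf \<Rightarrow> real" where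
  "l1_dist \<mu> \<nu> = (\<Sum>\<^sub>\<infinity>\<alpha>. \<bar>pmf \<mu> \<alpha> - pmf \<nu> \<alpha>\<bar>)"

definition amenable_action :: "('g::group_add \<Rightarrow> 'x::topological_space \<Rightarrow> 'x) \<Rightarrow> bool" where
  "amenable_action act \<longleftrightarrow>
     (\<forall>\<epsilon>>0. \<forall>F. finite F \<longrightarrow>
        (\<exists>m :: 'x \<Rightarrow> 'g pmf.
           (\<forall>\<alpha>. continuous_on UNIV (\<lambda>x. pmf (m x) \<alpha>)) \<and>
           (\<forall>\<gamma>\<in>F. (SUP x. l1_dist (m (act \<gamma> x)) (map_pmf ((+) \<gamma>) (m x))) < \<epsilon>)))"

definition proper_length_function :: "('g::group_add \<Rightarrow> real) \<Rightarrow> bool" where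
  "proper_length_function len \<longleftrightarrow>
     (\<forall>\<gamma>. len \<gamma> \<ge> 0) \<and>
     (\<forall>\<gamma>. len \<gamma> = 0 \<longleftrightarrow> \<gamma> = 0) \<and>
     (\<forall>\<gamma>. len (- \<gamma>) = len \<gamma>) \<and>
     (\<forall>\<alpha> \<beta>. len (\<alpha> + \<beta>) \<le> len \<alpha> + len \<beta>) \<and>
     (\<forall>r. finite {\<gamma>. len \<gamma> \<le> r})"

section \<open>The reduced crossed product\<close>

text \<open>The regular representation is induced from the faithful representation of \<open>C(X)\<close> on
  \<open>\<ell>\<^sup>2(X)\<close> by multiplication. It acts on \<open>\<ell>\<^sup>2(\<Gamma>, \<ell>\<^sup>2(X)) = \<ell>\<^sup>2(\<Gamma> \<times> X)\<close> by
  \<open>(\<pi>(f)\<xi>)(\<gamma>, x) = (\<gamma>\<^sup>-\<^sup>1.f)(x) \<xi>(\<gamma>, x) = f(\<gamma>x) \<xi>(\<gamma>, x)\<close> and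
  \<open>(\<lambda>\<^sub>s\<xi>)(\<gamma>, x) = \<xi>(s\<^sup>-\<^sup>1\<gamma>, x)\<close>.\<close>

definition fun_rep :: "('g::group_add \<Rightarrow> 'x \<Rightarrow> 'x) \<Rightarrow> ('x \<Rightarrow> complex) \<Rightarrow> ('g \<times> 'x) op" where
  "fun_rep act f = mult_op (\<lambda>(\<gamma>, x). f (act \<gamma> x))"

lift_definition translate_ell2 :: "'g::group_add \<Rightarrow> ('g \<times> 'x) ell2 \<Rightarrow> ('g \<times> 'x) ell2"
  is "\<lambda>s \<xi> (\<gamma>, x). \<xi> (- s + \<gamma>, x)"
  subgoal premises prems for s \<xi>
  proof -
    have "bij (\<lambda>(\<gamma>, x). (- s + \<gamma>, x) :: 'g \<times> 'x)"
      by (rule bij_betw_byWitness[where f' = "\<lambda>(\<gamma>, x). (s + \<gamma>, x)"])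
        (auto simp: add.assoc[symmetric])
    from summable_on_reindex_bij_betw[OF this, of "\<lambda>i. (cmod (\<xi> i))\<^sup>2"]
    show ?thesis
      using prems by (simp add: case_prod_unfold)
  qed
  done

lift_definition left_translation :: "'g::group_add \<Rightarrow> ('g \<times> 'x) op" is translate_ell2
proof -
  fix s :: 'g
  show "bounded_linear (translate_ell2 s :: ('g \<times> 'x) ell2 \<Rightarrow> _)"
  proof (rule bounded_linear_intro[where K = 1])
    show "translate_ell2 s (\<xi> + \<eta>) = translate_ell2 s \<xi> + translate_ell2 s \<eta>"
      for \<xi> \<eta> :: "('g \<times> 'x) ell2"
      by transfer auto
    show "translate_ell2 s (r *\<^sub>R \<xi>) = r *\<^sub>R translate_ell2 s \<xi>" for r and \<xi> :: "('g \<times> 'x) ell2"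
      by transfer auto
    fix \<xi> :: "('g \<times> 'x) ell2"
    have bij: "bij (\<lambda>(\<gamma>, x). (- s + \<gamma>, x) :: 'g \<times> 'x)"
      by (rule bij_betw_byWitness[where f' = "\<lambda>(\<gamma>, x). (s + \<gamma>, x)"])
        (auto simp: add.assoc[symmetric])
    have "(norm (translate_ell2 s \<xi>))\<^sup>2 = (norm \<xi>)\<^sup>2"
      unfolding norm_ell2_sq translate_ell2.rep_eq
      using infsum_reindex_bij_betw[OF bij, of "\<lambda>i. (cmod (ell2_coeff \<xi> i))\<^sup>2"]
      by (simp add: case_prod_unfold)
    then show "norm (translate_ell2 s \<xi>) \<le> norm \<xi> * 1" by simp
  qed
qed

text \<open>The image of \<open>C\<^sub>c(\<Gamma>, C(X))\<close> under the regular representation.\<close>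

definition algebraic_crossed_product ::
  "('g::group_add \<Rightarrow> 'x::topological_space \<Rightarrow> 'x) \<Rightarrow> ('g \<times> 'x) op set" where
  "algebraic_crossed_product act =
     {(\<Sum>s\<in>F. fun_rep act (f s) o\<^sub>L left_translation s) | F f.
        finite F \<and> (\<forall>s. continuous_on UNIV (f s))}"

definition reduced_crossed_product ::
  "('g::group_add \<Rightarrow> 'x::topological_space \<Rightarrow> 'x) \<Rightarrow> ('g \<times> 'x) op cstar_struct" where
  "reduced_crossed_product act = bounded_ops\<lparr>carrier := closure (algebraic_crossed_product act)\<rparr>"

section \<open>Quasi-local families\<close>

definition support :: "('g \<Rightarrow> complex) \<Rightarrow> 'g set" where
  "support f = {\<gamma>. f \<gamma> \<noteq> 0}"

definition sup_norm :: "('g \<Rightarrow> complex) \<Rightarrow> real" where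
  "sup_norm f = (SUP \<gamma>. cmod (f \<gamma>))"

text \<open>The distance of sets for the metric \<open>d(\<alpha>, \<beta>) = \<ell>(\<alpha>\<beta>\<^sup>-\<^sup>1)\<close>; it is infinite
  if one of them is empty.\<close>

definition length_setdist :: "('g::group_add \<Rightarrow> real) \<Rightarrow> 'g set \<Rightarrow> 'g set \<Rightarrow> ereal" where
  "length_setdist len A B = (INF \<alpha>\<in>A. INF \<beta>\<in>B. ereal (len (\<alpha> - \<beta>)))"

definition uniformly_quasi_local :: "('g::group_add \<Rightarrow> real) \<Rightarrow> ('x \<Rightarrow> 'g op) \<Rightarrow> bool" where
  "uniformly_quasi_local len T \<longleftrightarrow>
     (\<forall>\<epsilon>>0. \<exists>R>0. \<forall>x f g.
        bounded (range f) \<and> bounded (range g) \<and>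
        length_setdist len (support f) (support g) > ereal R \<longrightarrow>
        (let a = norm (mult_op f o\<^sub>L T x o\<^sub>L mult_op g); b = \<epsilon> * sup_norm f * sup_norm g
         in if f = (\<lambda>_. 0) \<or> g = (\<lambda>_. 0) then a \<le> b else a < b))"

definition equivariant_quasi_local_families ::
  "('g::group_add \<Rightarrow> 'x::topological_space \<Rightarrow> 'x) \<Rightarrow> ('g \<Rightarrow> real) \<Rightarrow> ('x \<Rightarrow> 'g op) set" where
  "equivariant_quasi_local_families act len =
     {T \<in> carrier (product_algebra bounded_ops).
        uniformly_quasi_local len T \<and>
        (\<forall>x \<alpha> \<beta> \<gamma>. matrix_coeff (T (act \<gamma> x)) \<alpha> \<beta> = matrix_coeff (T x) (\<alpha> + \<gamma>) (\<beta> + \<gamma>)) \<and>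
        continuous_map euclidean weak_operator_topology T}"

end

(*
  The regular representation acts fibrewise over X: an element of the crossed product is a
  direct sum over x of operators T_x, and f * lambda_s has fibres of propagation l(s) with matrix
  entries f(alpha x) on the s-th diagonal. Passing to fibres is thus an injective *-homomorphism
  into the equivariant quasi-local families, and the point is that such a family T is a uniform limit
  of fibre families of finite sums.

  Truncated almost invariant maps q : X -> Prob(Gamma) give p_alpha(g) = q(alpha x)(alpha g) on
  every orbit. Their kernels phi(alpha, beta) = sum_g sqrt(p_alpha(g) p_beta(g)) have finite
  propagation, so the Schur products phi T_x are the fibres of an algebraic element, and
  T' = (phi - 1) T_x is again quasi-local with constants independent of phi. It remains to see that
  T' is small. For vectors u, v take the mass |u|^2 + |v|^2; a first choice of p, through its
  superlevel sets, produces greedily a family of bounded sets W, pairwise far apart, that carries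
  almost all of this mass. By quasi-locality the blocks of T' between different W are negligible, and
  on W x W the kernel phi is uniformly close to 1, once phi is chosen after the size of the sets W.
*)
theory Submission
  imports Defs
begin

section \<open>Coordinates, the complex inner product, finite vectors and adjoints on the Hilbert
  space\<close>

section \<open>Square summable functions\<close>

text \<open>Quasi-locality makes far blocks small without any rate, so cutting T_x off to a band
  gives no control of the error, and entrywise convergence of kernels to 1 does not control norms
  either. What is available is contractivity: a kernel sum_g h_g(\<alpha>) h_g(\<beta>) with sum_g
  h_g^2 = 1 does not increase the norm of any block. This is why square roots of probability vectors
  are used, and why each block of T' has at most twice the norm of that block of T_x. The norm of T'
  is tested on one pair of finite vectors at a time. The sets W depend on u, v and x, but the bound
  on their size depends only on the first choice of p, which is made before the second; so one
  kernel serves all vectors and all points of X. Adding |u|^2 and |v|^2 lets a single family serve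
  both sides of the form. The number of sets W is not bounded, so the blocks between them cannot be
  estimated one by one. A bipartition of the family yields a single far block, and averaging over
  all bipartitions costs only a factor 4.\<close>

lemma ell2_eqI: "(\<And>i. ell2_coeff \<xi> i = ell2_coeff \<eta> i) \<Longrightarrow> \<xi> = \<eta>"
  using ell2_coeff_inject[of \<xi> \<eta>] by auto

lemma ell2_coeff_zero [simp]: "ell2_coeff 0 i = 0"
  by (simp add: zero_ell2.rep_eq)

lemma ell2_coeff_add [simp]: "ell2_coeff (\<xi> + \<eta>) i = ell2_coeff \<xi> i + ell2_coeff \<eta> i"
  by (simp add: plus_ell2.rep_eq)

lemma ell2_coeff_diff [simp]: "ell2_coeff (\<xi> - \<eta>) i = ell2_coeff \<xi> i - ell2_coeff \<eta> i"
  by (simp add: minus_ell2.rep_eq)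

lemma ell2_coeff_uminus [simp]: "ell2_coeff (- \<xi>) i = - ell2_coeff \<xi> i"
  by (simp add: uminus_ell2.rep_eq)

lemma ell2_coeff_scaleR [simp]: "ell2_coeff (r *\<^sub>R \<xi>) i = r *\<^sub>R ell2_coeff \<xi> i"
  by (simp add: scaleR_ell2.rep_eq)

lemma ell2_coeff_scaleC [simp]: "ell2_coeff (scaleC_ell2 c \<xi>) i = c * ell2_coeff \<xi> i"
  by (simp add: scaleC_ell2.rep_eq)

lemma ell2_coeff_delta: "ell2_coeff (delta a) i = (if i = a then 1 else 0)"
  by (simp add: delta.rep_eq)

lemma ell2_coeff_sum [simp]: "ell2_coeff (\<Sum>k\<in>K. \<xi> k) i = (\<Sum>k\<in>K. ell2_coeff (\<xi> k) i)"
  by (induction K rule: infinite_finite_induct) auto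

lemma summable_ell2_coeff: "(\<lambda>i. (cmod (ell2_coeff \<xi> i))\<^sup>2) summable_on A"
  using ell2_coeff[of \<xi>] by (auto intro: summable_on_subset_banach)

lemma sum_ell2_coeff_le: "finite F \<Longrightarrow> (\<Sum>i\<in>F. (cmod (ell2_coeff \<xi> i))\<^sup>2) \<le> (norm \<xi>)\<^sup>2"
  unfolding norm_ell2_sq by (rule finite_sum_le_infsum) (auto intro: summable_ell2_coeff)

lemma norm_ell2_coeff_le: "cmod (ell2_coeff \<xi> i) \<le> norm \<xi>"
  using sum_ell2_coeff_le[of "{i}" \<xi>] by (auto intro: power2_le_imp_le)

lemma norm_ell2_le:
  assumes "0 \<le> C" "\<And>F. finite F \<Longrightarrow> (\<Sum>i\<in>F. (cmod (ell2_coeff \<xi> i))\<^sup>2) \<le> C\<^sup>2"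
  shows "norm \<xi> \<le> C"
proof (rule power2_le_imp_le)
  show "(norm \<xi>)\<^sup>2 \<le> C\<^sup>2"
    unfolding norm_ell2_sq by (rule infsum_le_finite_sums) (auto intro: summable_ell2_coeff assms)
qed fact

lemma square_summableI:
  assumes "\<And>F. finite F \<Longrightarrow> (\<Sum>i\<in>F. (cmod (f i))\<^sup>2) \<le> C"
  shows "(\<lambda>i. (cmod (f i))\<^sup>2) summable_on UNIV"
  by (rule nonneg_bdd_above_summable_on) (auto intro!: bdd_aboveI[of _ C] assms)

lemma norm_delta [simp]: "norm (delta a) = 1"
proof -
  have "(norm (delta a))\<^sup>2 = (\<Sum>\<^sub>\<infinity>i\<in>{a}. (1::real))"
    unfolding norm_ell2_sq ell2_coeff_delta by (rule infsum_cong_neutral) auto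
  then show ?thesis by (simp add: power2_eq_1_iff) (smt (verit) norm_ge_zero)
qed

lemma norm_scaleC_ell2 [simp]: "norm (scaleC_ell2 c \<xi>) = cmod c * norm \<xi>"
proof (rule power2_eq_imp_eq)
  show "(norm (scaleC_ell2 c \<xi>))\<^sup>2 = (cmod c * norm \<xi>)\<^sup>2"
    by (simp add: norm_ell2_sq norm_mult power_mult_distrib infsum_cmult_right')
qed auto

lemma scaleC_ell2_of_real: "scaleC_ell2 (of_real r) \<xi> = r *\<^sub>R \<xi>"
  by (rule ell2_eqI) (simp add: scaleR_conv_of_real)

subsection \<open>The complex inner product\<close>

text \<open>Summability is reduced to the real inner products of coordinates: the real part of a
  term is the real inner product of the coordinates of \<xi> and \<eta>, and the imaginary part is
  minus the one of \<xi> and i \<eta>. The algebraic rules for \<open>cinner\<close> then follow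
  from uniqueness of sums.\<close>

lemma has_sum_cinner:
  "((\<lambda>i. cnj (ell2_coeff \<xi> i) * ell2_coeff \<eta> i) has_sum cinner \<xi> \<eta>) UNIV"
proof -
  have *: "(\<lambda>i. ell2_coeff \<xi> i \<bullet> ell2_coeff \<zeta> i) summable_on UNIV" for \<zeta>
    by (intro square_summable_inner summable_ell2_coeff)
  have "(\<lambda>i. complex_of_real (ell2_coeff \<xi> i \<bullet> ell2_coeff \<eta> i) +
      - \<i> * complex_of_real (ell2_coeff \<xi> i \<bullet> ell2_coeff (scaleC_ell2 \<i> \<eta>) i)) summable_on UNIV"
    by (intro summable_on_add summable_on_cmult_right summable_on_of_real *)
  moreover have "complex_of_real (ell2_coeff \<xi> i \<bullet> ell2_coeff \<eta> i) +
      - \<i> * complex_of_real (ell2_coeff \<xi> i \<bullet> ell2_coeff (scaleC_ell2 \<i> \<eta>) i) =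
      cnj (ell2_coeff \<xi> i) * ell2_coeff \<eta> i" for i
    by (simp add: complex_eq_iff inner_complex_def)
  ultimately show ?thesis
    unfolding cinner_def by (simp add: has_sum_infsum)
qed

lemma cinner_add_left: "cinner (\<xi> + \<xi>') \<eta> = cinner \<xi> \<eta> + cinner \<xi>' \<eta>"
  by (rule has_sum_unique[OF has_sum_cinner])
    (use has_sum_add[OF has_sum_cinner[of \<xi> \<eta>] has_sum_cinner[of \<xi>' \<eta>]] in \<open>simp add: algebra_simps\<close>)

lemma cinner_add_right: "cinner \<xi> (\<eta> + \<eta>') = cinner \<xi> \<eta> + cinner \<xi> \<eta>'"
  by (rule has_sum_unique[OF has_sum_cinner])
    (use has_sum_add[OF has_sum_cinner[of \<xi> \<eta>] has_sum_cinner[of \<xi> \<eta>']] in \<open>simp add: algebra_simps\<close>)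

lemma cinner_scaleC_left [simp]: "cinner (scaleC_ell2 c \<xi>) \<eta> = cnj c * cinner \<xi> \<eta>"
  by (rule has_sum_unique[OF has_sum_cinner])
    (use has_sum_cmult_right[OF has_sum_cinner[of \<xi> \<eta>], of "cnj c"] in \<open>simp add: algebra_simps\<close>)

lemma cinner_scaleC_right [simp]: "cinner \<xi> (scaleC_ell2 c \<eta>) = c * cinner \<xi> \<eta>"
  by (rule has_sum_unique[OF has_sum_cinner])
    (use has_sum_cmult_right[OF has_sum_cinner[of \<xi> \<eta>], of c] in \<open>simp add: algebra_simps\<close>)

lemma cnj_cinner: "cnj (cinner \<xi> \<eta>) = cinner \<eta> \<xi>"
  unfolding cinner_def infsum_cnj[symmetric] by (simp add: mult.commute)

lemma Re_cinner: "Re (cinner \<xi> \<eta>) = \<xi> \<bullet> \<eta>"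
proof -
  have "Re (cinner \<xi> \<eta>) = (\<Sum>\<^sub>\<infinity>i. Re (cnj (ell2_coeff \<xi> i) * ell2_coeff \<eta> i))"
    unfolding cinner_def
    by (rule infsum_Re[symmetric]) (rule has_sum_imp_summable[OF has_sum_cinner])
  then show ?thesis by (simp add: inner_ell2_def inner_complex_def)
qed

lemma cinner_same: "cinner \<xi> \<xi> = of_real ((norm \<xi>)\<^sup>2)"
  by (rule complex_eqI) (use cnj_cinner[of \<xi> \<xi>] in \<open>auto simp: Re_cinner power2_norm_eq_inner complex_eq_iff\<close>)

lemma norm_cinner_le: "cmod (cinner \<xi> \<eta>) \<le> norm \<xi> * norm \<eta>"
proof (cases "cinner \<xi> \<eta> = 0")
  case False
  \<comment> \<open>Rotating \<eta> by this unimodular scalar makes the inner product real and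
    nonnegative, so the Cauchy-Schwarz inequality of the real inner product applies.\<close>
  let ?c = "cnj (sgn (cinner \<xi> \<eta>))"
  have c: "cmod ?c = 1" using False by (simp add: norm_sgn)
  have "?c * cinner \<xi> \<eta> = of_real (cmod (cinner \<xi> \<eta>))"
    using False by (simp add: sgn_eq complex_norm_square[symmetric] power2_eq_square field_simps)
  then have "cmod (cinner \<xi> \<eta>) = Re (cinner \<xi> (scaleC_ell2 ?c \<eta>))" by simp
  also have "\<dots> \<le> norm \<xi> * norm (scaleC_ell2 ?c \<eta>)"
    unfolding Re_cinner by (rule norm_cauchy_schwarz)
  finally show ?thesis using c by simp
qed simp

interpretation cinner: bounded_bilinear cinner
proof
  show "cinner (a *\<^sub>R \<xi>) \<eta> = a *\<^sub>R cinner \<xi> \<eta>" for a \<xi> and \<eta> :: "'a ell2"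
    by (simp add: scaleC_ell2_of_real[symmetric] scaleR_conv_of_real)
  show "cinner \<xi> (a *\<^sub>R \<eta>) = a *\<^sub>R cinner \<xi> \<eta>" for a \<xi> and \<eta> :: "'a ell2"
    by (simp add: scaleC_ell2_of_real[symmetric] scaleR_conv_of_real)
  show "\<exists>K. \<forall>\<xi> \<eta>::'a ell2. cmod (cinner \<xi> \<eta>) \<le> norm \<xi> * norm \<eta> * K"
    by (intro exI[of _ 1]) (simp add: norm_cinner_le)
qed (auto simp: cinner_add_left cinner_add_right)

lemma cinner_delta_left [simp]: "cinner (delta a) \<xi> = ell2_coeff \<xi> a"
proof (rule has_sum_unique[OF has_sum_cinner])
  show "((\<lambda>i. cnj (ell2_coeff (delta a) i) * ell2_coeff \<xi> i) has_sum ell2_coeff \<xi> a) UNIV"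
    by (rule has_sum_finite_neutralI[of "{a}"]) (auto simp: ell2_coeff_delta)
qed

lemma cinner_delta_right [simp]: "cinner \<xi> (delta a) = cnj (ell2_coeff \<xi> a)"
  using cnj_cinner[of "delta a" \<xi>] by simp

lemma cinner_eqI: "(\<And>\<zeta>. cinner \<zeta> \<xi> = cinner \<zeta> \<eta>) \<Longrightarrow> \<xi> = \<eta>"
  by (rule ell2_eqI) (metis cinner_delta_left)

subsection \<open>Finitely supported vectors\<close>

definition fin_vec :: "'i set \<Rightarrow> ('i \<Rightarrow> complex) \<Rightarrow> 'i ell2" where
  "fin_vec A u = (\<Sum>i\<in>A. scaleC_ell2 (u i) (delta i))"

lemma ell2_coeff_fin_vec:
  "finite A \<Longrightarrow> ell2_coeff (fin_vec A u) i = (if i \<in> A then u i else 0)"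
  by (simp add: fin_vec_def ell2_coeff_delta if_distrib cong: if_cong)

lemma norm_fin_vec:
  assumes "finite A" shows "norm (fin_vec A u) = L2_set (\<lambda>i. cmod (u i)) A"
proof -
  have "(norm (fin_vec A u))\<^sup>2 = (\<Sum>\<^sub>\<infinity>i\<in>A. (cmod (u i))\<^sup>2)"
    unfolding norm_ell2_sq by (rule infsum_cong_neutral) (auto simp: ell2_coeff_fin_vec assms)
  then show ?thesis
    using assms by (simp add: L2_set_def real_sqrt_unique)
qed

lemma L2_set_ell2_coeff_le: "L2_set (\<lambda>i. cmod (ell2_coeff \<xi> i)) A \<le> norm \<xi>"
  by (cases "finite A") (auto simp: L2_set_def intro!: real_le_lsqrt sum_nonneg sum_ell2_coeff_le)

text \<open>By Pythagoras the squared error of the restriction to A is the full square sum minus its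
  partial sum over A, and this tends to 0.\<close>

lemma tendsto_fin_vec:
  "((\<lambda>A. fin_vec A (ell2_coeff \<xi>)) \<longlongrightarrow> \<xi>) (finite_subsets_at_top UNIV)"
proof -
  have fin: "\<forall>\<^sub>F A in finite_subsets_at_top UNIV. finite (A :: 'a set)"
    by (simp add: eventually_finite_subsets_at_top_weakI)
  have "((\<lambda>A. \<Sum>i\<in>A. (cmod (ell2_coeff \<xi> i))\<^sup>2) \<longlongrightarrow> (norm \<xi>)\<^sup>2) (finite_subsets_at_top UNIV)"
    unfolding norm_ell2_sq using has_sum_infsum[OF summable_ell2_coeff] by (simp add: has_sum_def)
  then have "((\<lambda>A. (norm \<xi>)\<^sup>2 - (\<Sum>i\<in>A. (cmod (ell2_coeff \<xi> i))\<^sup>2)) \<longlongrightarrow> 0) (finite_subsets_at_top UNIV)"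
    by (auto intro: tendsto_eq_intros)
  moreover have "(norm \<xi>)\<^sup>2 - (\<Sum>i\<in>A. (cmod (ell2_coeff \<xi> i))\<^sup>2) =
      (norm (fin_vec A (ell2_coeff \<xi>) - \<xi>))\<^sup>2" if "finite A" for A
  proof -
    have "(\<Sum>i\<in>A. (cmod (ell2_coeff \<xi> i))\<^sup>2) = (\<Sum>\<^sub>\<infinity>i\<in>A. (cmod (ell2_coeff \<xi> i))\<^sup>2)"
      using that by simp
    moreover have "(norm (fin_vec A (ell2_coeff \<xi>) - \<xi>))\<^sup>2 = (\<Sum>\<^sub>\<infinity>i\<in>-A. (cmod (ell2_coeff \<xi> i))\<^sup>2)"
      unfolding norm_ell2_sq by (rule infsum_cong_neutral) (auto simp: ell2_coeff_fin_vec that)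
    moreover have "(norm \<xi>)\<^sup>2 = (\<Sum>\<^sub>\<infinity>i\<in>A \<union> -A. (cmod (ell2_coeff \<xi> i))\<^sup>2)"
      by (simp add: norm_ell2_sq)
    moreover have "\<dots> = (\<Sum>\<^sub>\<infinity>i\<in>A. (cmod (ell2_coeff \<xi> i))\<^sup>2) + (\<Sum>\<^sub>\<infinity>i\<in>-A. (cmod (ell2_coeff \<xi> i))\<^sup>2)"
      by (rule infsum_Un_disjoint) (auto intro: summable_ell2_coeff)
    ultimately show ?thesis by linarith
  qed
  ultimately have "((\<lambda>A. (norm (fin_vec A (ell2_coeff \<xi>) - \<xi>))\<^sup>2) \<longlongrightarrow> 0) (finite_subsets_at_top UNIV)"
    by (rule Lim_transform_eventually[OF _ eventually_mono[OF fin]])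
  then have "((\<lambda>A. sqrt ((norm (fin_vec A (ell2_coeff \<xi>) - \<xi>))\<^sup>2)) \<longlongrightarrow> sqrt 0) (finite_subsets_at_top UNIV)"
    by (rule tendsto_real_sqrt)
  then show ?thesis
    by (subst Lim_null, subst tendsto_norm_zero_iff[symmetric]) simp
qed

lemma norm_fin_vec_coeff_le: "norm (fin_vec A (ell2_coeff \<xi>)) \<le> norm \<xi>"
  by (cases "finite A") (simp_all add: norm_fin_vec L2_set_ell2_coeff_le, simp add: fin_vec_def)

subsection \<open>Operators\<close>

lemma clinear_op_scaleC: "clinear_op T \<Longrightarrow> T (scaleC_ell2 c \<xi>) = scaleC_ell2 c (T \<xi>)"
  by (simp add: clinear_op_def)

lemma ell2_coeff_op_delta [simp]: "ell2_coeff (blinfun_apply T (delta \<beta>)) \<alpha> = matrix_coeff T \<alpha> \<beta>"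
  by (simp add: matrix_coeff_def)

lemma op_fin_vec:
  "clinear_op T \<Longrightarrow> T (fin_vec A u) = (\<Sum>i\<in>A. scaleC_ell2 (u i) (T (delta i)))"
  by (simp add: fin_vec_def blinfun.sum_right clinear_op_scaleC)

lemma clinear_op_zero: "clinear_op 0" by (auto simp: clinear_op_def intro: ell2_eqI)

lemma clinear_op_add: "clinear_op S \<Longrightarrow> clinear_op T \<Longrightarrow> clinear_op (S + T)"
  by (auto simp: clinear_op_def blinfun.add_left algebra_simps intro: ell2_eqI)

lemma clinear_op_sum: "(\<And>k. k \<in> K \<Longrightarrow> clinear_op (T k)) \<Longrightarrow> clinear_op (\<Sum>k\<in>K. T k)"
  by (induction K rule: infinite_finite_induct) (auto intro: clinear_op_zero clinear_op_add)

lemma clinear_op_compose: "clinear_op S \<Longrightarrow> clinear_op T \<Longrightarrow> clinear_op (S o\<^sub>L T)"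
  by (auto simp: clinear_op_def)

lemma ell2_coeff_mult_op:
  "bounded (range f) \<Longrightarrow> ell2_coeff (mult_op f \<xi>) i = f i * ell2_coeff \<xi> i"
  by (simp add: mult_op.rep_eq mult_ell2.rep_eq)

lemma clinear_op_mult_op: "clinear_op (mult_op f)"
  by (auto simp: clinear_op_def mult_op.rep_eq mult_ell2.rep_eq intro!: ell2_eqI)

lemma mult_op_const_apply [simp]: "mult_op (\<lambda>_. c) \<xi> = scaleC_ell2 c \<xi>"
  by (rule ell2_eqI) (simp add: ell2_coeff_mult_op)

lemma mult_op_minus_one_compose [simp]: "mult_op (\<lambda>_. - 1) o\<^sub>L T = - T"
  by (rule blinfun_eqI, rule ell2_eqI) (simp add: blinfun.minus_left)

lemma norm_mult_op_const_compose [simp]: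
  fixes T :: "'i op"
  shows "norm (mult_op (\<lambda>_. c) o\<^sub>L T) = cmod c * norm T"
proof (cases "c = 0")
  case True
  have "mult_op (\<lambda>_. 0) o\<^sub>L T = 0"
    by (rule blinfun_eqI, rule ell2_eqI) simp
  then show ?thesis using True by simp
next
  case False
  have le: "norm (mult_op (\<lambda>_. c) o\<^sub>L T) \<le> cmod c * norm T" for c and T :: "'i op"
    by (rule norm_blinfun_bound)
      (auto simp: mult.assoc intro!: mult_left_mono norm_blinfun)
  \<comment> \<open>The reverse inequality is the inequality \<open>le\<close> for the inverse
    scalar.\<close>
  have "T = mult_op (\<lambda>_. inverse c) o\<^sub>L (mult_op (\<lambda>_. c) o\<^sub>L T)"
    using False by (intro blinfun_eqI ell2_eqI) simp
  then have "norm T \<le> cmod (inverse c) * norm (mult_op (\<lambda>_. c) o\<^sub>L T)"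
    using le[of "inverse c" "mult_op (\<lambda>_. c) o\<^sub>L T"] by simp
  then have "cmod c * norm T \<le> norm (mult_op (\<lambda>_. c) o\<^sub>L T)"
    using False by (simp add: norm_divide inverse_eq_divide[symmetric] norm_inverse)
      (simp add: field_simps)
  with le[of c T] show ?thesis by simp
qed

lemma norm_mult_op_le:
  assumes "\<And>i. cmod (f i) \<le> K" shows "norm (mult_op f) \<le> K"
proof (rule norm_blinfun_bound)
  have b: "bounded (range f)" using assms by (auto simp: bounded_iff)
  show K: "0 \<le> K" using assms norm_ge_zero order_trans by blast
  fix \<xi>
  show "norm (mult_op f \<xi>) \<le> K * norm \<xi>"
  proof (rule norm_ell2_le)
    fix F :: "'a set" assume "finite F"
    have "(\<Sum>i\<in>F. (cmod (ell2_coeff (mult_op f \<xi>) i))\<^sup>2) \<le> (\<Sum>i\<in>F. K\<^sup>2 * (cmod (ell2_coeff \<xi> i))\<^sup>2)"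
      unfolding ell2_coeff_mult_op[OF b] norm_mult power_mult_distrib
      by (intro sum_mono mult_right_mono power_mono assms) auto
    also have "\<dots> \<le> K\<^sup>2 * (norm \<xi>)\<^sup>2"
      unfolding sum_distrib_left[symmetric]
      by (intro mult_left_mono sum_ell2_coeff_le \<open>finite F\<close>) auto
    finally show "(\<Sum>i\<in>F. (cmod (ell2_coeff (mult_op f \<xi>) i))\<^sup>2) \<le> (K * norm \<xi>)\<^sup>2"
      by (simp add: power_mult_distrib)
  qed (use K in simp)
qed

lemma norm_matrix_coeff_le: "cmod (matrix_coeff T \<alpha> \<beta>) \<le> norm T"
  using norm_ell2_coeff_le[of "T (delta \<beta>)" \<alpha>] norm_blinfun[of T "delta \<beta>"] by simp

lemma cinner_op_fin_vec:
  assumes "clinear_op T" "finite A" "finite B"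
  shows "cinner (fin_vec A u) (T (fin_vec B v)) =
    (\<Sum>\<alpha>\<in>A. \<Sum>\<beta>\<in>B. cnj (u \<alpha>) * matrix_coeff T \<alpha> \<beta> * v \<beta>)"
proof -
  have "cinner (fin_vec A u) (T (fin_vec B v)) =
    (\<Sum>\<alpha>\<in>A. cnj (u \<alpha>) * (\<Sum>\<beta>\<in>B. v \<beta> * matrix_coeff T \<alpha> \<beta>))"
    unfolding op_fin_vec[OF assms(1)] by (simp add: fin_vec_def cinner.sum_left)
  then show ?thesis
    by (simp add: sum_distrib_left mult_ac)
qed

lemma tendsto_cinner_op_fin_vec:
  "((\<lambda>A. cinner (fin_vec A (ell2_coeff \<xi>)) (T (fin_vec A (ell2_coeff \<eta>)))) \<longlongrightarrow> cinner \<xi> (T \<eta>))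
     (finite_subsets_at_top UNIV)"
  for T :: "'i op"
  by (intro cinner.tendsto tendsto_fin_vec blinfun.tendsto tendsto_const)

lemma norm_op_leI:
  fixes T :: "'i op"
  assumes "0 \<le> C"
    and "\<And>\<xi> \<eta>. norm \<xi> \<le> 1 \<Longrightarrow> norm \<eta> \<le> 1 \<Longrightarrow> cmod (cinner \<xi> (T \<eta>)) \<le> C"
  shows "norm T \<le> C"
proof (rule norm_blinfun_bound[OF assms(1)])
  fix \<eta>
  show "norm (T \<eta>) \<le> C * norm \<eta>"
  proof (cases "\<eta> = 0 \<or> T \<eta> = 0")
    case False
    \<comment> \<open>Here \<open>sgn\<close> is normalisation; on these unit vectors the form
      equals norm (T \<eta>) / norm \<eta>.\<close>
    have "C \<ge> cmod (cinner (sgn (T \<eta>)) (T (sgn \<eta>)))"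
      by (rule assms(2)) (auto simp: norm_sgn)
    also have "cinner (sgn (T \<eta>)) (T (sgn \<eta>)) = of_real (norm (T \<eta>) / norm \<eta>)"
      using False by (simp add: sgn_div_norm blinfun.scaleR_right cinner.scaleR_left
          cinner.scaleR_right cinner_same scaleR_conv_of_real power2_eq_square field_simps)
    finally show ?thesis using False by (simp add: norm_divide field_simps)
  qed (use assms(1) in auto)
qed

text \<open>By density of the finite vectors, both vectors can be cut to the same finite set A, so
  that an operator norm is bounded through finite sums of matrix entries. The approximation error is
  estimated in this form.\<close>

lemma norm_clinear_op_leI:
  assumes "0 \<le> C" "clinear_op T"
    and le: "\<And>A u v. finite A \<Longrightarrow> L2_set (\<lambda>i. cmod (u i)) A \<le> 1 \<Longrightarrow> L2_set (\<lambda>i. cmod (v i)) A \<le> 1 \<Longrightarrow>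
      cmod (\<Sum>\<alpha>\<in>A. \<Sum>\<beta>\<in>A. cnj (u \<alpha>) * matrix_coeff T \<alpha> \<beta> * v \<beta>) \<le> C"
  shows "norm T \<le> C"
proof (rule norm_op_leI[OF assms(1)])
  fix \<xi> \<eta> :: "'a ell2" assume n: "norm \<xi> \<le> 1" "norm \<eta> \<le> 1"
  have fin: "\<forall>\<^sub>F A in finite_subsets_at_top UNIV. finite (A :: 'a set)"
    by (simp add: eventually_finite_subsets_at_top_weakI)
  show "cmod (cinner \<xi> (T \<eta>)) \<le> C"
  proof (rule tendsto_upperbound[OF tendsto_norm[OF tendsto_cinner_op_fin_vec]])
    show "\<forall>\<^sub>F A in finite_subsets_at_top UNIV.
        cmod (cinner (fin_vec A (ell2_coeff \<xi>)) (T (fin_vec A (ell2_coeff \<eta>)))) \<le> C"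
      using fin by eventually_elim
        (auto simp: cinner_op_fin_vec assms(2) intro!: le order_trans[OF L2_set_ell2_coeff_le] n)
  qed simp
qed

subsection \<open>Adjoints\<close>

lemma adjoint_exists:
  fixes T :: "'i op"
  assumes "clinear_op T"
  shows "\<exists>S. clinear_op S \<and> (\<forall>\<xi> \<eta>. cinner (S \<xi>) \<eta> = cinner \<xi> (T \<eta>))"
proof -
  \<comment> \<open>These are the coordinates that the adjoint must give to \<xi>. Testing T on the
    finite vector with the coefficients c itself bounds the square of their \<open>L2_set\<close>
    norm by that norm times norm T * norm \<xi>; cancelling one factor shows square
    summability.\<close>
  define c where "c \<xi> i = cinner (T (delta i)) \<xi>" for \<xi> i
  have bound: "(\<Sum>i\<in>F. (cmod (c \<xi> i))\<^sup>2) \<le> (norm T * norm \<xi>)\<^sup>2" if "finite F" for F \<xi>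
  proof -
    let ?L = "L2_set (\<lambda>i. cmod (c \<xi> i)) F"
    have sq: "?L\<^sup>2 = (\<Sum>i\<in>F. (cmod (c \<xi> i))\<^sup>2)"
      by (simp add: L2_set_def sum_nonneg)
    have "of_real (?L\<^sup>2) = cinner (T (fin_vec F (c \<xi>))) \<xi>"
      unfolding op_fin_vec[OF assms] sq
      by (simp add: cinner.sum_left c_def[symmetric] complex_norm_square mult.commute del: of_real_power)
    then have "?L\<^sup>2 \<le> norm (T (fin_vec F (c \<xi>))) * norm \<xi>"
      using norm_cinner_le[of "T (fin_vec F (c \<xi>))" \<xi>] by (metis norm_of_real abs_power2)
    also have "\<dots> \<le> (norm T * ?L) * norm \<xi>"
      using norm_blinfun[of T "fin_vec F (c \<xi>)"] norm_fin_vec[OF that, of "c \<xi>"]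
      by (intro mult_right_mono) auto
    finally have "?L * ?L \<le> (norm T * norm \<xi>) * ?L" by (simp add: power2_eq_square mult_ac)
    then have "?L \<le> norm T * norm \<xi>"
      using L2_set_nonneg[of "\<lambda>i. cmod (c \<xi> i)" F]
      by (cases "?L = 0") (auto simp: mult_le_cancel_right simp del: L2_set_nonneg)
    then show ?thesis unfolding sq[symmetric] by (intro power_mono) auto
  qed
  define S0 where "S0 \<xi> = Abs_ell2 (c \<xi>)" for \<xi>
  have S0: "ell2_coeff (S0 \<xi>) i = c \<xi> i" for \<xi> i
    unfolding S0_def by (subst Abs_ell2_inverse) (auto intro: square_summableI[OF bound])
  have "bounded_linear S0"
  proof (rule bounded_linear_intro[where K = "norm T"])
    show "S0 (\<xi> + \<eta>) = S0 \<xi> + S0 \<eta>" for \<xi> \<eta>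
      by (rule ell2_eqI) (simp add: S0 c_def cinner.add_right)
    show "S0 (r *\<^sub>R \<xi>) = r *\<^sub>R S0 \<xi>" for r \<xi>
      by (rule ell2_eqI) (simp add: S0 c_def cinner.scaleR_right)
    show "norm (S0 \<xi>) \<le> norm \<xi> * norm T" for \<xi>
      by (rule norm_ell2_le) (auto simp: S0 mult.commute[of "norm \<xi>"] bound)
  qed
  then have S: "blinfun_apply (Blinfun S0) = S0" by (rule bounded_linear_Blinfun_apply)
  have "cinner (S0 \<xi>) \<eta> = cinner \<xi> (T \<eta>)" for \<xi> \<eta>
  proof (rule tendsto_unique[OF finite_subsets_at_top_neq_bot])
    show "((\<lambda>A. cinner (S0 \<xi>) (fin_vec A (ell2_coeff \<eta>))) \<longlongrightarrow> cinner (S0 \<xi>) \<eta>) (finite_subsets_at_top UNIV)"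
      by (intro cinner.tendsto tendsto_fin_vec tendsto_const)
    have "cinner (S0 \<xi>) (fin_vec A (ell2_coeff \<eta>)) = cinner \<xi> (T (fin_vec A (ell2_coeff \<eta>)))" for A
      unfolding op_fin_vec[OF assms]
      by (simp add: fin_vec_def cinner.sum_right S0 c_def cnj_cinner)
    then show "((\<lambda>A. cinner (S0 \<xi>) (fin_vec A (ell2_coeff \<eta>))) \<longlongrightarrow> cinner \<xi> (T \<eta>)) (finite_subsets_at_top UNIV)"
      by (auto intro!: cinner.tendsto tendsto_fin_vec blinfun.tendsto tendsto_const)
  qed
  moreover have "clinear_op (Blinfun S0)"
    by (auto simp: clinear_op_def S S0 c_def intro: ell2_eqI)
  ultimately show ?thesis using S by auto
qed

lemma adjoint_unique:
  fixes S S' :: "'i op"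
  assumes "\<And>\<xi> \<eta>. cinner (S \<xi>) \<eta> = cinner \<xi> (T \<eta>)" "\<And>\<xi> \<eta>. cinner (S' \<xi>) \<eta> = cinner \<xi> (T \<eta>)"
  shows "S = S'"
  by (intro blinfun_eqI cinner_eqI) (metis assms cnj_cinner)

lemma
  fixes T :: "'i op"
  assumes "clinear_op T"
  shows clinear_op_adjoint: "clinear_op (adjoint_op T)"
    and cinner_adjoint_left: "cinner (adjoint_op T \<xi>) \<eta> = cinner \<xi> (T \<eta>)"
proof -
  have "\<exists>!S. clinear_op S \<and> (\<forall>\<xi> \<eta>. cinner (S \<xi>) \<eta> = cinner \<xi> (T \<eta>))"
    using adjoint_exists[OF assms] adjoint_unique[of _ T] by blast
  from theI'[OF this, folded adjoint_op_def]
  show "clinear_op (adjoint_op T)" "cinner (adjoint_op T \<xi>) \<eta> = cinner \<xi> (T \<eta>)" by auto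
qed

lemma adjoint_op_eqI:
  fixes S T :: "'i op"
  assumes "clinear_op S" "\<And>\<xi> \<eta>. cinner (S \<xi>) \<eta> = cinner \<xi> (T \<eta>)"
  shows "adjoint_op T = S"
  unfolding adjoint_op_def using assms adjoint_unique[of _ T] by (intro the_equality) blast+

lemma matrix_coeff_adjoint:
  "clinear_op T \<Longrightarrow> matrix_coeff (adjoint_op T) \<alpha> \<beta> = cnj (matrix_coeff T \<beta> \<alpha>)"
  using cinner_adjoint_left[of T "delta \<beta>" "delta \<alpha>"] by (metis cinner_delta_left cinner_delta_right
      complex_cnj_cnj ell2_coeff_op_delta)

lemma norm_adjoint_le:
  assumes "clinear_op T" shows "norm (adjoint_op T) \<le> norm T"
proof (rule norm_op_leI)
  fix \<xi> \<eta> :: "'a ell2" assume n: "norm \<xi> \<le> 1" "norm \<eta> \<le> 1"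
  have "cmod (cinner \<xi> (adjoint_op T \<eta>)) = cmod (cinner \<eta> (T \<xi>))"
    using cinner_adjoint_left[OF assms, of \<eta> \<xi>] by (metis cnj_cinner complex_mod_cnj)
  also have "\<dots> \<le> norm \<eta> * (norm T * norm \<xi>)"
    by (intro order_trans[OF norm_cinner_le] mult_left_mono norm_blinfun) auto
  also have "\<dots> \<le> 1 * (norm T * 1)" using n by (intro mult_mono) auto
  finally show "cmod (cinner \<xi> (adjoint_op T \<eta>)) \<le> norm T" by simp
qed simp

text \<open>Moving S to the other side writes the coefficient of the product as the inner product of
  two square summable vectors, one from a row of S and one a column of T; hence the matrix product
  converges.\<close>

lemma has_sum_matrix_coeff_compose:
  assumes "clinear_op S"
  shows "((\<lambda>\<gamma>. matrix_coeff S \<alpha> \<gamma> * matrix_coeff T \<gamma> \<beta>) has_sum matrix_coeff (S o\<^sub>L T) \<alpha> \<beta>) UNIV"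
proof -
  have "matrix_coeff (S o\<^sub>L T) \<alpha> \<beta> = cinner (adjoint_op S (delta \<alpha>)) (T (delta \<beta>))"
    unfolding cinner_adjoint_left[OF assms] by (simp add: matrix_coeff_def)
  with has_sum_cinner[of "adjoint_op S (delta \<alpha>)" "T (delta \<beta>)"] show ?thesis
    by (simp add: matrix_coeff_adjoint assms)
qed

section \<open>A coarea inequality and the greedy choice of mutually far sets carrying most of a
  mass\<close>

section \<open>Sparsification\<close>

lemma measure_lborel_Ioc': "measure lborel {a<..b::real} = max 0 (b - a)"
  by (cases "a \<le> b") (auto simp: max_def)

text \<open>A coarea argument: on average over \<open>g\<close> and \<open>t\<close>, the boundary of the superlevel set
  \<open>{p(-, g) \<ge> t}\<close> has small mass compared with the set itself.\<close>

lemma exists_superlevel_set_small_boundary: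
  fixes \<mu> :: "'a \<Rightarrow> real" and p :: "'a \<Rightarrow> 'b \<Rightarrow> real"
  assumes fin: "finite A" "finite G"
    and \<mu>: "\<And>\<alpha>. \<alpha> \<in> A \<Longrightarrow> 0 \<le> \<mu> \<alpha>" "0 < sum \<mu> A"
    and p: "\<And>\<alpha> g. 0 \<le> p \<alpha> g" "\<And>\<alpha>. \<alpha> \<in> A \<Longrightarrow> (\<Sum>g\<in>G. p \<alpha> g) = 1"
    and N: "\<And>\<alpha>. \<alpha> \<in> A \<Longrightarrow> card {\<beta>\<in>A. near \<alpha> \<beta>} \<le> N"
    and \<delta>: "\<And>\<alpha> \<beta>. \<alpha> \<in> A \<Longrightarrow> \<beta> \<in> A \<Longrightarrow> near \<alpha> \<beta> \<Longrightarrow> (\<Sum>g\<in>G. \<bar>p \<beta> g - p \<alpha> g\<bar>) \<le> \<delta>"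
    and "0 \<le> \<delta>" "real N * \<delta> < \<eta>"
  shows "\<exists>g\<in>G. \<exists>t>0. sum \<mu> {\<alpha>\<in>A. p \<alpha> g < t \<and> (\<exists>\<beta>\<in>A. t \<le> p \<beta> g \<and> near \<alpha> \<beta>)} <
    \<eta> * sum \<mu> {\<alpha>\<in>A. t \<le> p \<alpha> g}"
proof (rule ccontr)
  \<comment> \<open>If the boundary were large for all g and all levels t > 0, integrating over t
    and summing over g would contradict the small variation of p between near points.\<close>
  assume "\<not> ?thesis"
  then have large: "\<eta> * sum \<mu> {\<alpha>\<in>A. t \<le> p \<alpha> g} \<le>
      sum \<mu> {\<alpha>\<in>A. p \<alpha> g < t \<and> (\<exists>\<beta>\<in>A. t \<le> p \<beta> g \<and> near \<alpha> \<beta>)}" if "g \<in> G" "t > 0" for g t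
    using that by (meson not_less)
  let ?B = "\<lambda>\<alpha>. {\<beta>\<in>A. near \<alpha> \<beta>}"
  \<comment> \<open>Layer-cake form: integrating \<open>?l\<close> over t gives the sum of \<eta>
    \<mu>(\<alpha>) p(\<alpha>, g), while \<open>?r\<close> charges \<alpha> with the length of the
    interval of levels separating it from each near \<beta>. A boundary point is counted by
    \<open>?r\<close> at least once.\<close>
  let ?l = "\<lambda>g t. \<Sum>\<alpha>\<in>A. \<eta> * \<mu> \<alpha> * indicator {0<..p \<alpha> g} t :: real"
  let ?r = "\<lambda>g t. \<Sum>\<alpha>\<in>A. \<Sum>\<beta>\<in>?B \<alpha>. \<mu> \<alpha> * indicator {p \<alpha> g<..p \<beta> g} t :: real"
  have le: "?l g t \<le> ?r g t" if g: "g \<in> G" for g t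
  proof (cases "t > 0")
    case True
    have "?l g t = \<eta> * sum \<mu> {\<alpha>\<in>A. t \<le> p \<alpha> g}"
      unfolding sum_distrib_left using True fin
      by (intro sum.mono_neutral_cong_right) (auto simp: indicator_def)
    also have "\<dots> \<le> sum \<mu> {\<alpha>\<in>A. p \<alpha> g < t \<and> (\<exists>\<beta>\<in>A. t \<le> p \<beta> g \<and> near \<alpha> \<beta>)}"
      by (rule large[OF g True])
    also have "\<dots> \<le> (\<Sum>\<alpha>\<in>{\<alpha>\<in>A. p \<alpha> g < t \<and> (\<exists>\<beta>\<in>A. t \<le> p \<beta> g \<and> near \<alpha> \<beta>)}.
        \<Sum>\<beta>\<in>?B \<alpha>. \<mu> \<alpha> * indicator {p \<alpha> g<..p \<beta> g} t)"
    proof (rule sum_mono)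
      fix \<alpha> assume "\<alpha> \<in> {\<alpha>\<in>A. p \<alpha> g < t \<and> (\<exists>\<beta>\<in>A. t \<le> p \<beta> g \<and> near \<alpha> \<beta>)}"
      then obtain \<beta> where \<beta>: "\<alpha> \<in> A" "p \<alpha> g < t" "\<beta> \<in> ?B \<alpha>" "t \<le> p \<beta> g" by auto
      then have "\<mu> \<alpha> = \<mu> \<alpha> * indicator {p \<alpha> g<..p \<beta> g} t" by simp
      also have "\<dots> \<le> (\<Sum>\<beta>\<in>?B \<alpha>. \<mu> \<alpha> * indicator {p \<alpha> g<..p \<beta> g} t)"
        using \<beta> fin \<mu> by (intro member_le_sum[where f = "\<lambda>\<beta>. \<mu> \<alpha> * indicator {p \<alpha> g<..p \<beta> g} t"])
          (auto intro!: mult_nonneg_nonneg)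
      finally show "\<mu> \<alpha> \<le> (\<Sum>\<beta>\<in>?B \<alpha>. \<mu> \<alpha> * indicator {p \<alpha> g<..p \<beta> g} t)" .
    qed
    also have "\<dots> \<le> ?r g t"
      using fin \<mu> by (intro sum_mono2) (auto intro!: sum_nonneg mult_nonneg_nonneg)
    finally show ?thesis .
  next
    case False
    then have "?l g t = 0" by (intro sum.neutral) auto
    moreover have "0 \<le> ?r g t" using \<mu> by (auto intro!: sum_nonneg mult_nonneg_nonneg)
    ultimately show ?thesis by simp
  qed
  have int: "integrable lborel (\<lambda>t. c * indicator {a<..b} t)" for a b c :: real
  proof (intro integrable_mult_right integrable_real_indicator)
    show "emeasure lborel {a<..b} < \<infinity>" by (cases "a \<le> b") auto
  qed simp
  have val: "(LINT t|lborel. c * indicator {a<..b} t) = c * max 0 (b - a)" for a b c :: real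
    by (simp add: measure_lborel_Ioc')
  have "(\<Sum>\<alpha>\<in>A. \<eta> * \<mu> \<alpha> * max 0 (p \<alpha> g - 0)) \<le> (\<Sum>\<alpha>\<in>A. \<Sum>\<beta>\<in>?B \<alpha>. \<mu> \<alpha> * max 0 (p \<beta> g - p \<alpha> g))"
    if "g \<in> G" for g
  proof -
    have "(LINT t|lborel. ?l g t) \<le> (LINT t|lborel. ?r g t)"
      by (rule integral_mono) (auto intro!: Bochner_Integration.integrable_sum int le that)
    then show ?thesis
      by (simp only: Bochner_Integration.integral_sum Bochner_Integration.integrable_sum int val)
  qed
  then have "(\<Sum>g\<in>G. \<Sum>\<alpha>\<in>A. \<eta> * \<mu> \<alpha> * max 0 (p \<alpha> g - 0)) \<le>
      (\<Sum>g\<in>G. \<Sum>\<alpha>\<in>A. \<Sum>\<beta>\<in>?B \<alpha>. \<mu> \<alpha> * max 0 (p \<beta> g - p \<alpha> g))"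
    by (rule sum_mono)
  moreover have "(\<Sum>g\<in>G. \<Sum>\<alpha>\<in>A. \<eta> * \<mu> \<alpha> * max 0 (p \<alpha> g - 0)) = \<eta> * sum \<mu> A"
  proof -
    have "(\<Sum>g\<in>G. \<Sum>\<alpha>\<in>A. \<eta> * \<mu> \<alpha> * max 0 (p \<alpha> g - 0)) = (\<Sum>\<alpha>\<in>A. \<eta> * \<mu> \<alpha> * (\<Sum>g\<in>G. p \<alpha> g))"
      unfolding sum_distrib_left using p(1) by (subst sum.swap) (simp add: max_def)
    then show ?thesis by (simp add: p(2) sum_distrib_left)
  qed
  moreover have "(\<Sum>g\<in>G. \<Sum>\<alpha>\<in>A. \<Sum>\<beta>\<in>?B \<alpha>. \<mu> \<alpha> * max 0 (p \<beta> g - p \<alpha> g)) \<le> real N * \<delta> * sum \<mu> A"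
  proof -
    have "(\<Sum>g\<in>G. \<Sum>\<alpha>\<in>A. \<Sum>\<beta>\<in>?B \<alpha>. \<mu> \<alpha> * max 0 (p \<beta> g - p \<alpha> g)) =
        (\<Sum>\<alpha>\<in>A. \<mu> \<alpha> * (\<Sum>\<beta>\<in>?B \<alpha>. \<Sum>g\<in>G. max 0 (p \<beta> g - p \<alpha> g)))"
      unfolding sum_distrib_left
      by (subst sum.swap) (intro sum.cong refl sum.swap)
    also have "\<dots> \<le> (\<Sum>\<alpha>\<in>A. \<mu> \<alpha> * (real N * \<delta>))"
    proof (intro sum_mono mult_left_mono \<mu>)
      fix \<alpha> assume \<alpha>: "\<alpha> \<in> A"
      have "(\<Sum>\<beta>\<in>?B \<alpha>. \<Sum>g\<in>G. max 0 (p \<beta> g - p \<alpha> g)) \<le> (\<Sum>\<beta>\<in>?B \<alpha>. \<delta>)"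
      proof (rule sum_mono)
        fix \<beta> assume "\<beta> \<in> ?B \<alpha>"
        then have "(\<Sum>g\<in>G. \<bar>p \<beta> g - p \<alpha> g\<bar>) \<le> \<delta>" by (intro \<delta> \<alpha>) auto
        moreover have "(\<Sum>g\<in>G. max 0 (p \<beta> g - p \<alpha> g)) \<le> (\<Sum>g\<in>G. \<bar>p \<beta> g - p \<alpha> g\<bar>)"
          by (rule sum_mono) auto
        ultimately show "(\<Sum>g\<in>G. max 0 (p \<beta> g - p \<alpha> g)) \<le> \<delta>" by linarith
      qed
      also have "\<dots> \<le> real N * \<delta>"
        using N[OF \<alpha>] \<open>0 \<le> \<delta>\<close> by (simp add: mult_right_mono)
      finally show "(\<Sum>\<beta>\<in>?B \<alpha>. \<Sum>g\<in>G. max 0 (p \<beta> g - p \<alpha> g)) \<le> real N * \<delta>" .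
    qed
    also have "\<dots> = real N * \<delta> * sum \<mu> A"
      unfolding sum_distrib_right[symmetric] by (rule mult.commute)
    finally show ?thesis .
  qed
  ultimately have "\<eta> * sum \<mu> A \<le> real N * \<delta> * sum \<mu> A" by linarith
  with \<mu>(2) \<open>real N * \<delta> < \<eta>\<close> show False by simp
qed

text \<open>Each step keeps a superlevel set U and discards its boundary D, the points outside U
  near to U. The mass of D is charged to U, so the total loss is at most \<eta> times the total mass
  kept. What remains is far from U and inherits all hypotheses. Positivity of p(-, g) on W for one g
  records that W is bounded.\<close>

lemma exists_sparse_family:
  fixes \<mu> :: "'a \<Rightarrow> real" and p :: "'a \<Rightarrow> 'b \<Rightarrow> real"
  assumes fin: "finite A" "finite G"
    and \<mu>: "\<And>\<alpha>. \<alpha> \<in> A \<Longrightarrow> 0 \<le> \<mu> \<alpha>"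
    and p: "\<And>\<alpha> g. 0 \<le> p \<alpha> g" "\<And>\<alpha>. \<alpha> \<in> A \<Longrightarrow> (\<Sum>g\<in>G. p \<alpha> g) = 1"
    and N: "\<And>\<alpha>. \<alpha> \<in> A \<Longrightarrow> card {\<beta>\<in>A. near \<alpha> \<beta>} \<le> N"
    and \<delta>: "\<And>\<alpha> \<beta>. \<alpha> \<in> A \<Longrightarrow> \<beta> \<in> A \<Longrightarrow> near \<alpha> \<beta> \<Longrightarrow> (\<Sum>g\<in>G. \<bar>p \<beta> g - p \<alpha> g\<bar>) \<le> \<delta>"
    and "0 \<le> \<delta>" "real N * \<delta> < \<eta>"
    and near: "\<And>\<alpha>. near \<alpha> \<alpha>" "\<And>\<alpha> \<beta>. near \<alpha> \<beta> \<Longrightarrow> near \<beta> \<alpha>"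
  shows "\<exists>\<W>. finite \<W> \<and> (\<forall>W\<in>\<W>. W \<subseteq> A \<and> (\<exists>g\<in>G. \<forall>\<alpha>\<in>W. 0 < p \<alpha> g)) \<and>
    (\<forall>V\<in>\<W>. \<forall>W\<in>\<W>. V \<noteq> W \<longrightarrow> (\<forall>\<alpha>\<in>V. \<forall>\<beta>\<in>W. \<not> near \<alpha> \<beta>)) \<and>
    sum \<mu> (A - \<Union>\<W>) \<le> \<eta> * sum \<mu> (\<Union>\<W>)"
  using fin(1) \<mu> p(2) N \<delta>
proof (induction A rule: finite_psubset_induct)
  case (psubset A)
  show ?case
  proof (cases "0 < sum \<mu> A")
    case False
    with psubset.prems(1) have "sum \<mu> A = 0" by (meson sum_nonneg order.antisym not_less)
    then show ?thesis by (intro exI[of _ "{}"]) auto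
  next
    case True
    then obtain g t where gt: "g \<in> G" "0 < t"
      "sum \<mu> {\<alpha>\<in>A. p \<alpha> g < t \<and> (\<exists>\<beta>\<in>A. t \<le> p \<beta> g \<and> near \<alpha> \<beta>)} <
        \<eta> * sum \<mu> {\<alpha>\<in>A. t \<le> p \<alpha> g}"
      using exists_superlevel_set_small_boundary[of A G \<mu> p near N \<delta> \<eta>] psubset fin(2) p(1)
        \<open>0 \<le> \<delta>\<close> \<open>real N * \<delta> < \<eta>\<close> by blast
    define U where "U = {\<alpha>\<in>A. t \<le> p \<alpha> g}"
    define D where "D = {\<alpha>\<in>A. p \<alpha> g < t \<and> (\<exists>\<beta>\<in>A. t \<le> p \<beta> g \<and> near \<alpha> \<beta>)}"
    define A' where "A' = A - U - D"
    have DU: "sum \<mu> D < \<eta> * sum \<mu> U" using gt(3) by (simp add: U_def D_def)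
    \<comment> \<open>The strict inequality of the coarea estimate excludes an empty superlevel set,
      so the remaining set is strictly smaller.\<close>
    have "U \<noteq> {}"
    proof
      assume "U = {}"
      moreover have "0 \<le> sum \<mu> D" using psubset.prems(1) by (intro sum_nonneg) (auto simp: D_def)
      ultimately show False using DU by simp
    qed
    then have "A' \<subset> A" by (auto simp: A'_def U_def)
    have "\<exists>\<W>. finite \<W> \<and> (\<forall>W\<in>\<W>. W \<subseteq> A' \<and> (\<exists>g\<in>G. \<forall>\<alpha>\<in>W. 0 < p \<alpha> g)) \<and>
      (\<forall>V\<in>\<W>. \<forall>W\<in>\<W>. V \<noteq> W \<longrightarrow> (\<forall>\<alpha>\<in>V. \<forall>\<beta>\<in>W. \<not> near \<alpha> \<beta>)) \<and>
      sum \<mu> (A' - \<Union>\<W>) \<le> \<eta> * sum \<mu> (\<Union>\<W>)"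
    proof (rule psubset.IH[OF \<open>A' \<subset> A\<close>])
      show "card {\<beta>\<in>A'. near \<alpha> \<beta>} \<le> N" if "\<alpha> \<in> A'" for \<alpha>
        using psubset.prems(3)[of \<alpha>] that \<open>A' \<subset> A\<close> \<open>finite A\<close>
        by (intro order_trans[OF card_mono psubset.prems(3)[of \<alpha>]]) auto
      show "(\<Sum>g\<in>G. \<bar>p \<beta> g - p \<alpha> g\<bar>) \<le> \<delta>" if "\<alpha> \<in> A'" "\<beta> \<in> A'" "near \<alpha> \<beta>" for \<alpha> \<beta>
        using psubset.prems(4) that \<open>A' \<subset> A\<close> by blast
    qed (use \<open>A' \<subset> A\<close> psubset.prems(1,2) in auto)
    then obtain \<W> where W: "finite \<W>" "\<And>W. W \<in> \<W> \<Longrightarrow> W \<subseteq> A'" "\<And>W. W \<in> \<W> \<Longrightarrow> \<exists>g\<in>G. \<forall>\<alpha>\<in>W. 0 < p \<alpha> g"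
      "\<forall>V\<in>\<W>. \<forall>W\<in>\<W>. V \<noteq> W \<longrightarrow> (\<forall>\<alpha>\<in>V. \<forall>\<beta>\<in>W. \<not> near \<alpha> \<beta>)"
      "sum \<mu> (A' - \<Union>\<W>) \<le> \<eta> * sum \<mu> (\<Union>\<W>)"
      by (elim exE conjE) simp
    \<comment> \<open>A point of A near to U lies in U or in D, and both have been removed.\<close>
    have far: "\<not> near \<alpha> \<beta>" if "\<alpha> \<in> A'" "\<beta> \<in> U" for \<alpha> \<beta>
      using that by (auto simp: A'_def U_def D_def not_le)
    have WA: "\<Union>\<W> \<subseteq> A'" using W(2) by blast
    have finW: "finite (\<Union>\<W>)" using WA \<open>finite A\<close> \<open>A' \<subset> A\<close> by (meson finite_subset psubset_imp_subset)
    have finU: "finite U" "finite D" using \<open>finite A\<close> by (auto simp: U_def D_def)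
    have eq: "A - \<Union>(insert U \<W>) = D \<union> (A' - \<Union>\<W>)"
      using WA by (auto simp: A'_def D_def U_def)
    have "sum \<mu> (A - \<Union>(insert U \<W>)) = sum \<mu> D + sum \<mu> (A' - \<Union>\<W>)"
      unfolding eq using \<open>finite A\<close> finU by (intro sum.union_disjoint) (auto simp: A'_def)
    moreover have "sum \<mu> (\<Union>(insert U \<W>)) = sum \<mu> U + sum \<mu> (\<Union>\<W>)"
      unfolding Union_insert using WA finW finU by (intro sum.union_disjoint) (auto simp: A'_def)
    ultimately have "sum \<mu> (A - \<Union>(insert U \<W>)) \<le> \<eta> * sum \<mu> (\<Union>(insert U \<W>))"
      using DU W(5) by (simp add: distrib_left)
    moreover have "\<forall>W\<in>insert U \<W>. W \<subseteq> A \<and> (\<exists>g\<in>G. \<forall>\<alpha>\<in>W. 0 < p \<alpha> g)"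
    proof
      fix W assume "W \<in> insert U \<W>"
      then consider "W = U" | "W \<in> \<W>" by auto
      then show "W \<subseteq> A \<and> (\<exists>g\<in>G. \<forall>\<alpha>\<in>W. 0 < p \<alpha> g)"
      proof cases
        case 1
        have "0 < p \<alpha> g" if "\<alpha> \<in> U" for \<alpha> using that gt(2) by (simp add: U_def)
        then show ?thesis using 1 gt(1) by (auto simp: U_def)
      next
        case 2
        then show ?thesis using W(2)[OF 2] W(3)[OF 2] \<open>A' \<subset> A\<close> by simp
      qed
    qed
    moreover have "\<forall>V\<in>insert U \<W>. \<forall>W\<in>insert U \<W>. V \<noteq> W \<longrightarrow> (\<forall>\<alpha>\<in>V. \<forall>\<beta>\<in>W. \<not> near \<alpha> \<beta>)"
    proof (intro ballI impI)
      fix V W \<alpha> \<beta>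
      assume *: "V \<in> insert U \<W>" "W \<in> insert U \<W>" "V \<noteq> W" "\<alpha> \<in> V" "\<beta> \<in> W"
      then consider "V \<in> \<W>" "W \<in> \<W>" | "V \<in> \<W>" "W = U" | "V = U" "W \<in> \<W>" by auto
      then show "\<not> near \<alpha> \<beta>"
      proof cases
        case 1
        then show ?thesis using W(4) * by simp
      next
        case 2
        then show ?thesis using W(2)[of V] far[of \<alpha> \<beta>] * by auto
      next
        case 3
        then show ?thesis using W(2)[of W] far[of \<beta> \<alpha>] near(2)[of \<alpha> \<beta>] * by auto
      qed
    qed
    ultimately show ?thesis using W(1) by (intro exI[of _ "insert U \<W>"]) auto
  qed
qed

section \<open>Block estimates for finite matrices: Schur multipliers, bipartitions, sparse
  families\<close>

section \<open>Sesquilinear forms of matrices\<close>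

text \<open>The block V \<times> W of t is a plain function on indices, so Schur products can be
  formed entrywise before an operator is attached to them.\<close>

definition sesq :: "('i \<Rightarrow> 'i \<Rightarrow> complex) \<Rightarrow> 'i set \<Rightarrow> 'i set \<Rightarrow> ('i \<Rightarrow> complex) \<Rightarrow> ('i \<Rightarrow> complex) \<Rightarrow> complex"
  where "sesq t V W u v = (\<Sum>\<alpha>\<in>V. \<Sum>\<beta>\<in>W. cnj (u \<alpha>) * t \<alpha> \<beta> * v \<beta>)"

abbreviation nrm2 :: "('i \<Rightarrow> complex) \<Rightarrow> 'i set \<Rightarrow> real" where
  "nrm2 u V \<equiv> L2_set (\<lambda>i. cmod (u i)) V"

lemma nrm2_sq: "(nrm2 u V)\<^sup>2 = (\<Sum>i\<in>V. (cmod (u i))\<^sup>2)"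
  by (simp add: L2_set_def sum_nonneg)

lemma nrm2_subset: "finite W \<Longrightarrow> V \<subseteq> W \<Longrightarrow> nrm2 u V \<le> nrm2 u W"
  by (auto simp: L2_set_def intro!: sum_mono2)

lemma sum_norm_le_card_nrm2:
  assumes "finite W"
  shows "(\<Sum>i\<in>W. cmod (u i)) \<le> sqrt (card W) * nrm2 u W"
  using L2_set_mult_ineq[of "\<lambda>_. 1" "\<lambda>i. cmod (u i)" W] by (simp add: L2_set_constant)

text \<open>The Gram form of the kernel splits the form into the sum over g of the forms of t at the
  vectors h_g u and h_g v. Cauchy-Schwarz over g and sum_g h_g^2 = 1 restore the original norms; the
  size of G does not enter.\<close>

lemma norm_sesq_schur_le:
  assumes le: "\<And>u v. cmod (sesq t V W u v) \<le> c * nrm2 u V * nrm2 v W"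
    and "0 \<le> c" and fin: "finite G" "finite V" "finite W"
    and h: "\<And>\<alpha>. \<alpha> \<in> V \<union> W \<Longrightarrow> (\<Sum>g\<in>G. (h g \<alpha>)\<^sup>2) = (1::real)"
  shows "cmod (sesq (\<lambda>\<alpha> \<beta>. of_real (\<Sum>g\<in>G. h g \<alpha> * h g \<beta>) * t \<alpha> \<beta>) V W u v) \<le> c * nrm2 u V * nrm2 v W"
proof -
  let ?m = "\<lambda>u g i. complex_of_real (h g i) * u i"
  have L2: "L2_set (\<lambda>g. nrm2 (?m w g) U) G = nrm2 w U" if "U \<subseteq> V \<union> W" "finite U" for w U
  proof -
    have "(\<Sum>g\<in>G. (nrm2 (?m w g) U)\<^sup>2) = (\<Sum>i\<in>U. (\<Sum>g\<in>G. (h g i)\<^sup>2) * (cmod (w i))\<^sup>2)"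
      unfolding nrm2_sq sum_distrib_right by (subst sum.swap) (simp add: norm_mult power_mult_distrib)
    also have "\<dots> = (\<Sum>i\<in>U. (cmod (w i))\<^sup>2)"
      using that h by (intro sum.cong) (auto simp: subset_iff)
    finally show ?thesis by (simp add: L2_set_def)
  qed
  have "sesq (\<lambda>\<alpha> \<beta>. of_real (\<Sum>g\<in>G. h g \<alpha> * h g \<beta>) * t \<alpha> \<beta>) V W u v =
      (\<Sum>\<alpha>\<in>V. \<Sum>\<beta>\<in>W. \<Sum>g\<in>G. cnj (?m u g \<alpha>) * t \<alpha> \<beta> * ?m v g \<beta>)"
    unfolding sesq_def of_real_sum sum_distrib_left sum_distrib_right
    by (intro sum.cong refl) (simp add: mult_ac)
  also have "\<dots> = (\<Sum>g\<in>G. sesq t V W (?m u g) (?m v g))"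
    unfolding sesq_def by (subst sum.swap[of _ _ G]) (intro sum.cong refl sum.swap)
  also have "cmod \<dots> \<le> (\<Sum>g\<in>G. c * (nrm2 (?m u g) V * nrm2 (?m v g) W))"
    by (intro order_trans[OF norm_sum sum_mono]) (use le in \<open>simp add: mult.assoc\<close>)
  also have "\<dots> \<le> c * (L2_set (\<lambda>g. nrm2 (?m u g) V) G * L2_set (\<lambda>g. nrm2 (?m v g) W) G)"
    unfolding sum_distrib_left[symmetric]
    using L2_set_mult_ineq[of "\<lambda>g. nrm2 (?m u g) V" "\<lambda>g. nrm2 (?m v g) W" G] \<open>0 \<le> c\<close>
    by (intro mult_left_mono) auto
  also have "\<dots> = c * nrm2 u V * nrm2 v W"
    using L2 fin by simp
  finally show ?thesis .
qed

text \<open>Average over all bipartitions \<open>J\<close>, \<open>I - J\<close>: an ordered pair of distinct indices is separated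
  by a quarter of them.\<close>

lemma norm_sum_off_diagonal_le:
  fixes a :: "'i \<Rightarrow> 'i \<Rightarrow> complex"
  assumes fin: "finite I" and le: "\<And>J. J \<subseteq> I \<Longrightarrow> cmod (\<Sum>i\<in>J. \<Sum>j\<in>I - J. a i j) \<le> c"
  shows "cmod (\<Sum>i\<in>I. \<Sum>j\<in>I - {i}. a i j) \<le> 4 * c"
proof -
  \<comment> \<open>Such J arise by adding i to an arbitrary subset of I - {i, j}.\<close>
  have card: "4 * card {J\<in>Pow I. i \<in> J \<and> j \<notin> J} = 2 ^ card I" if "i \<in> I" "j \<in> I" "i \<noteq> j" for i j
  proof -
    have "{J\<in>Pow I. i \<in> J \<and> j \<notin> J} = insert i ` Pow (I - {i, j})"
    proof safe
      fix J assume "J \<subseteq> I" "i \<in> J" "j \<notin> J"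
      then show "J \<in> insert i ` Pow (I - {i, j})" by (intro image_eqI[of _ _ "J - {i}"]) auto
    qed (use that in auto)
    moreover have "inj_on (insert i) (Pow (I - {i, j}))" by (auto simp: inj_on_def)
    ultimately have "card {J\<in>Pow I. i \<in> J \<and> j \<notin> J} = 2 ^ card (I - {i, j})"
      by (simp add: card_image card_Pow fin)
    moreover have "card I = card (I - {i, j}) + 2"
      using card_Diff_subset[of "{i,j}" I] card_mono[of I "{i,j}"] that fin by simp
    ultimately show ?thesis by (simp add: power_add)
  qed
  \<comment> \<open>Double counting: in the sum over all bipartitions each off-diagonal term occurs
    equally often.\<close>
  have "(\<Sum>J\<in>Pow I. \<Sum>i\<in>J. \<Sum>j\<in>I - J. a i j) =
      (\<Sum>J\<in>Pow I. \<Sum>i\<in>I. \<Sum>j\<in>I - {i}. if i \<in> J \<and> j \<notin> J then a i j else 0)"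
  proof (rule sum.cong[OF refl])
    fix J assume J: "J \<in> Pow I"
    have "(\<Sum>i\<in>J. \<Sum>j\<in>I - J. a i j) = (\<Sum>i\<in>J. \<Sum>j\<in>I - {i}. if i \<in> J \<and> j \<notin> J then a i j else 0)"
      using fin by (intro sum.cong[OF refl] sum.mono_neutral_cong_left) auto
    also have "\<dots> = (\<Sum>i\<in>I. \<Sum>j\<in>I - {i}. if i \<in> J \<and> j \<notin> J then a i j else 0)"
      using J fin by (intro sum.mono_neutral_left) (auto intro!: sum.neutral)
    finally show "(\<Sum>i\<in>J. \<Sum>j\<in>I - J. a i j) =
      (\<Sum>i\<in>I. \<Sum>j\<in>I - {i}. if i \<in> J \<and> j \<notin> J then a i j else 0)" .
  qed
  also have "\<dots> = (\<Sum>i\<in>I. \<Sum>j\<in>I - {i}. \<Sum>J\<in>Pow I. if i \<in> J \<and> j \<notin> J then a i j else 0)"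
    by (subst sum.swap) (intro sum.cong refl sum.swap)
  also have "\<dots> = (\<Sum>i\<in>I. \<Sum>j\<in>I - {i}. of_nat (card {J\<in>Pow I. i \<in> J \<and> j \<notin> J}) * a i j)"
    using fin by (intro sum.cong refl) (simp add: sum.inter_filter[symmetric])
  finally have "4 * (\<Sum>J\<in>Pow I. \<Sum>i\<in>J. \<Sum>j\<in>I - J. a i j) =
      (\<Sum>i\<in>I. \<Sum>j\<in>I - {i}. of_nat (4 * card {J\<in>Pow I. i \<in> J \<and> j \<notin> J}) * a i j)"
    by (simp add: sum_distrib_left mult.assoc)
  also have "\<dots> = 2 ^ card I * (\<Sum>i\<in>I. \<Sum>j\<in>I - {i}. a i j)"
    unfolding sum_distrib_left by (intro sum.cong refl) (subst card, auto)
  finally have "cmod (4 * (\<Sum>J\<in>Pow I. \<Sum>i\<in>J. \<Sum>j\<in>I - J. a i j)) =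
      cmod (2 ^ card I * (\<Sum>i\<in>I. \<Sum>j\<in>I - {i}. a i j))"
    by (rule arg_cong)
  then have "2 ^ card I * cmod (\<Sum>i\<in>I. \<Sum>j\<in>I - {i}. a i j) =
      4 * cmod (\<Sum>J\<in>Pow I. \<Sum>i\<in>J. \<Sum>j\<in>I - J. a i j)"
    by (simp only: norm_mult norm_numeral norm_power)
  also have "\<dots> \<le> 4 * (\<Sum>J\<in>Pow I. c)"
    by (intro mult_left_mono order_trans[OF norm_sum sum_mono] le) auto
  also have "\<dots> = 2 ^ card I * (4 * c)" by (simp add: card_Pow fin)
  finally show ?thesis by simp
qed

lemma sesq_union_left:
  "finite V \<Longrightarrow> finite V' \<Longrightarrow> V \<inter> V' = {} \<Longrightarrow> sesq t (V \<union> V') W u v = sesq t V W u v + sesq t V' W u v"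
  by (simp add: sesq_def sum.union_disjoint)

lemma sesq_union_right:
  "finite W \<Longrightarrow> finite W' \<Longrightarrow> W \<inter> W' = {} \<Longrightarrow> sesq t V (W \<union> W') u v = sesq t V W u v + sesq t V W' u v"
  by (simp add: sesq_def sum.union_disjoint sum.distrib)

lemma sesq_Union:
  assumes "finite \<V>" "finite \<W>" "\<And>W. W \<in> \<V> \<union> \<W> \<Longrightarrow> finite W"
    and "\<And>V W. V \<in> \<V> \<Longrightarrow> W \<in> \<V> \<Longrightarrow> V \<noteq> W \<Longrightarrow> V \<inter> W = {}"
    and "\<And>V W. V \<in> \<W> \<Longrightarrow> W \<in> \<W> \<Longrightarrow> V \<noteq> W \<Longrightarrow> V \<inter> W = {}"
  shows "sesq t (\<Union>\<V>) (\<Union>\<W>) u v = (\<Sum>V\<in>\<V>. \<Sum>W\<in>\<W>. sesq t V W u v)"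
proof -
  have W: "(\<Sum>\<beta>\<in>\<Union>\<W>. f \<beta>) = (\<Sum>W\<in>\<W>. \<Sum>\<beta>\<in>W. f \<beta>)" for f :: "_ \<Rightarrow> complex"
    using assms by (subst sum.Union_disjoint) auto
  have V: "(\<Sum>\<beta>\<in>\<Union>\<V>. f \<beta>) = (\<Sum>W\<in>\<V>. \<Sum>\<beta>\<in>W. f \<beta>)" for f :: "_ \<Rightarrow> complex"
    using assms by (subst sum.Union_disjoint) auto
  show ?thesis
    unfolding sesq_def W V by (intro sum.cong refl sum.swap)
qed

text \<open>The three terms of the bound have three sources: \<kappa> * N from the diagonal blocks,
  whose entries are at most \<kappa> on sets of at most N points; 4 * \<epsilon> from the blocks
  between different sets; and the last term from the rows and columns outside the family, which
  carry little mass.\<close>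

lemma norm_sesq_le_local:
  assumes fin: "finite A" "finite \<W>"
    and bound: "\<And>V W. V \<subseteq> A \<Longrightarrow> W \<subseteq> A \<Longrightarrow> cmod (sesq t V W u v) \<le> C * nrm2 u V * nrm2 v W"
    and ql: "\<And>V W. V \<subseteq> A \<Longrightarrow> W \<subseteq> A \<Longrightarrow> (\<forall>\<alpha>\<in>V. \<forall>\<beta>\<in>W. \<not> near \<alpha> \<beta>) \<Longrightarrow>
      cmod (sesq t V W u v) \<le> \<epsilon> * nrm2 u V * nrm2 v W"
    and near: "\<And>\<alpha>. near \<alpha> \<alpha>"
    and W: "\<And>W. W \<in> \<W> \<Longrightarrow> W \<subseteq> A" "\<And>W. W \<in> \<W> \<Longrightarrow> card W \<le> N"
      "\<And>V W \<alpha> \<beta>. V \<in> \<W> \<Longrightarrow> W \<in> \<W> \<Longrightarrow> V \<noteq> W \<Longrightarrow> \<alpha> \<in> V \<Longrightarrow> \<beta> \<in> W \<Longrightarrow> \<not> near \<alpha> \<beta>"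
      "\<And>W \<alpha> \<beta>. W \<in> \<W> \<Longrightarrow> \<alpha> \<in> W \<Longrightarrow> \<beta> \<in> W \<Longrightarrow> cmod (t \<alpha> \<beta>) \<le> \<kappa>"
    and \<eta>: "(\<Sum>\<alpha>\<in>A - \<Union>\<W>. (cmod (u \<alpha>))\<^sup>2 + (cmod (v \<alpha>))\<^sup>2) \<le> \<eta> * (\<Sum>\<alpha>\<in>\<Union>\<W>. (cmod (u \<alpha>))\<^sup>2 + (cmod (v \<alpha>))\<^sup>2)"
    and nonneg: "0 \<le> C" "0 \<le> \<epsilon>" "0 \<le> \<eta>" "0 \<le> \<kappa>"
    and uv: "nrm2 u A \<le> 1" "nrm2 v A \<le> 1"
  shows "cmod (sesq t A A u v) \<le> \<kappa> * N + 4 * \<epsilon> + 2 * C * sqrt (2 * \<eta>)"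
proof -
  define \<Omega> where "\<Omega> = \<Union>\<W>"
  have \<Omega>: "\<Omega> \<subseteq> A" "finite \<Omega>" using W(1) fin by (auto simp: \<Omega>_def intro: finite_subset)
  have finW: "finite W" if "W \<in> \<W>" for W using W(1)[OF that] fin(1) by (rule finite_subset)
  have disj: "V \<inter> W = {}" if "V \<in> \<W>" "W \<in> \<W>" "V \<noteq> W" for V W
    using W(3)[OF that] near by blast
  have le1: "nrm2 u V \<le> 1" "nrm2 v V \<le> 1" if "V \<subseteq> A" for V
    using nrm2_subset[OF fin(1) that] uv by (meson order_trans)+
  have AO: "A = \<Omega> \<union> (A - \<Omega>)" using \<Omega> by auto
  have "sesq t A A u v = sesq t \<Omega> A u v + sesq t (A - \<Omega>) A u v"
    by (subst (1) AO, subst sesq_union_left) (use \<Omega> fin in auto)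
  also have "sesq t \<Omega> A u v = sesq t \<Omega> \<Omega> u v + sesq t \<Omega> (A - \<Omega>) u v"
    by (subst (1) AO, subst sesq_union_right) (use \<Omega> fin in auto)
  finally have split: "sesq t A A u v = sesq t \<Omega> \<Omega> u v + sesq t \<Omega> (A - \<Omega>) u v + sesq t (A - \<Omega>) A u v" .
  \<comment> \<open>The factor 2 is a bound for the total mass of u and v, each of norm at most
    1.\<close>
  have rest: "(nrm2 u (A - \<Omega>))\<^sup>2 + (nrm2 v (A - \<Omega>))\<^sup>2 \<le> 2 * \<eta>"
  proof -
    have "(nrm2 u (A - \<Omega>))\<^sup>2 + (nrm2 v (A - \<Omega>))\<^sup>2 \<le> \<eta> * ((nrm2 u \<Omega>)\<^sup>2 + (nrm2 v \<Omega>)\<^sup>2)"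
      using \<eta> by (simp add: nrm2_sq sum.distrib \<Omega>_def)
    also have "\<dots> \<le> \<eta> * (1 + 1)"
      using le1[OF \<Omega>(1)] nonneg by (intro mult_left_mono add_mono) (auto intro!: power_le_one)
    finally show ?thesis by simp
  qed
  have rest': "nrm2 u (A - \<Omega>) \<le> sqrt (2 * \<eta>)" "nrm2 v (A - \<Omega>) \<le> sqrt (2 * \<eta>)"
    using rest by (auto intro!: real_le_rsqrt simp: sum_power2_ge_zero)
      (smt (verit) zero_le_power2)+
  have "cmod (sesq t \<Omega> (A - \<Omega>) u v) \<le> C * 1 * sqrt (2 * \<eta>)"
    by (rule order_trans[OF bound mult_mono[OF mult_left_mono]])
      (use \<Omega> rest' le1 nonneg in auto)
  moreover have "cmod (sesq t (A - \<Omega>) A u v) \<le> C * sqrt (2 * \<eta>) * 1"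
    by (rule order_trans[OF bound mult_mono[OF mult_left_mono]])
      (use \<Omega> rest' le1 nonneg in auto)
  moreover have "cmod (sesq t \<Omega> \<Omega> u v) \<le> \<kappa> * N + 4 * \<epsilon>"
  proof -
    have "sesq t \<Omega> \<Omega> u v = (\<Sum>V\<in>\<W>. \<Sum>W\<in>\<W>. sesq t V W u v)"
      unfolding \<Omega>_def by (rule sesq_Union) (use fin finW disj in auto)
    also have "\<dots> = (\<Sum>V\<in>\<W>. sesq t V V u v) + (\<Sum>V\<in>\<W>. \<Sum>W\<in>\<W> - {V}. sesq t V W u v)"
      unfolding sum.distrib[symmetric] using fin(2) by (intro sum.cong refl sum.remove)
    also have "cmod \<dots> \<le> \<kappa> * N + 4 * \<epsilon>"
    proof (rule norm_triangle_mono)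
      show "cmod (\<Sum>V\<in>\<W>. \<Sum>W\<in>\<W> - {V}. sesq t V W u v) \<le> 4 * \<epsilon>"
      proof (rule norm_sum_off_diagonal_le[OF fin(2)])
        fix J assume J: "J \<subseteq> \<W>"
        \<comment> \<open>The unions over both halves of the family are still far apart, so
          \<open>ql\<close> bounds their whole block at once, independently of the number of
          sets.\<close>
        have sub: "\<Union>J \<subseteq> A" "\<Union>(\<W> - J) \<subseteq> A" using J W(1) by blast+
        have "(\<Sum>V\<in>J. \<Sum>W\<in>\<W> - J. sesq t V W u v) = sesq t (\<Union>J) (\<Union>(\<W> - J)) u v"
          by (rule sesq_Union[symmetric]) (use J fin(2) finW in \<open>auto intro: finite_subset dest: disj\<close>)
        also have "cmod \<dots> \<le> \<epsilon> * nrm2 u (\<Union>J) * nrm2 v (\<Union>(\<W> - J))"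
          by (rule ql[OF sub]) (use J W(3) in blast)
        also have "\<dots> \<le> \<epsilon> * 1 * 1"
          using le1 sub nonneg by (intro mult_mono) auto
        finally show "cmod (\<Sum>V\<in>J. \<Sum>W\<in>\<W> - J. sesq t V W u v) \<le> \<epsilon>" by simp
      qed
      have local: "cmod (sesq t V V u v) \<le> \<kappa> * N * (nrm2 u V * nrm2 v V)" if V: "V \<in> \<W>" for V
      proof -
        have "cmod (sesq t V V u v) \<le> (\<Sum>\<alpha>\<in>V. \<Sum>\<beta>\<in>V. \<kappa> * (cmod (u \<alpha>) * cmod (v \<beta>)))"
          unfolding sesq_def
        proof (intro order_trans[OF norm_sum sum_mono] order_trans[OF norm_sum sum_mono])
          fix \<alpha> \<beta> assume "\<alpha> \<in> V" "\<beta> \<in> V"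
          then have "cmod (t \<alpha> \<beta>) * (cmod (u \<alpha>) * cmod (v \<beta>)) \<le> \<kappa> * (cmod (u \<alpha>) * cmod (v \<beta>))"
            using W(4)[OF V] by (intro mult_right_mono) auto
          then show "cmod (cnj (u \<alpha>) * t \<alpha> \<beta> * v \<beta>) \<le> \<kappa> * (cmod (u \<alpha>) * cmod (v \<beta>))"
            by (simp add: norm_mult mult_ac)
        qed
        also have "\<dots> = \<kappa> * ((\<Sum>\<alpha>\<in>V. cmod (u \<alpha>)) * (\<Sum>\<beta>\<in>V. cmod (v \<beta>)))"
          unfolding sum_product by (simp only: sum_distrib_left)
        \<comment> \<open>Passing from the l1 norm to the l2 norm costs sqrt N on each side; this is
          where the size of the sets enters.\<close>
        also have "\<dots> \<le> \<kappa> * ((sqrt N * nrm2 u V) * (sqrt N * nrm2 v V))"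
          using nonneg W(2)[OF V] sum_norm_le_card_nrm2[OF finW[OF V]]
          by (intro mult_left_mono mult_mono order_trans[OF sum_norm_le_card_nrm2[OF finW[OF V]]] mult_right_mono)
            (auto intro!: sum_nonneg)
        also have "\<dots> = \<kappa> * (sqrt N * sqrt N) * (nrm2 u V * nrm2 v V)" by (simp only: mult_ac)
        finally show ?thesis by simp
      qed
      have "cmod (\<Sum>V\<in>\<W>. sesq t V V u v) \<le> (\<Sum>V\<in>\<W>. \<kappa> * N * (nrm2 u V * nrm2 v V))"
        by (intro order_trans[OF norm_sum sum_mono] local)
      also have "\<dots> \<le> \<kappa> * N * (L2_set (nrm2 u) \<W> * L2_set (nrm2 v) \<W>)"
        unfolding sum_distrib_left[symmetric]
        using L2_set_mult_ineq[of "nrm2 u" "nrm2 v" \<W>] nonneg by (intro mult_left_mono) auto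
      also have "\<dots> \<le> \<kappa> * N * (1 * 1)"
      proof -
        have "L2_set (nrm2 w) \<W> = nrm2 w \<Omega>" for w
          unfolding L2_set_def \<Omega>_def using finW disj
          by (subst sum.Union_disjoint) (auto simp: sum_nonneg)
        then show ?thesis using le1[OF \<Omega>(1)] nonneg by (intro mult_left_mono mult_mono) auto
      qed
      finally show "cmod (\<Sum>V\<in>\<W>. sesq t V V u v) \<le> \<kappa> * N" by simp
    qed
    finally show ?thesis .
  qed
  ultimately show ?thesis
    unfolding split
    using norm_triangle_ineq[of "sesq t \<Omega> \<Omega> u v + sesq t \<Omega> (A - \<Omega>) u v" "sesq t (A - \<Omega>) A u v"]
      norm_triangle_ineq[of "sesq t \<Omega> \<Omega> u v" "sesq t \<Omega> (A - \<Omega>) u v"]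
    by linarith
qed

section \<open>Quasi-locality through projections, its permanence properties, and weak
  continuity\<close>

section \<open>Quasi-local families\<close>

definition proj_op :: "'i set \<Rightarrow> 'i op" where
  "proj_op A = mult_op (\<lambda>i. if i \<in> A then 1 else 0)"

lemma ell2_coeff_proj_op [simp]: "ell2_coeff (proj_op A \<xi>) i = (if i \<in> A then ell2_coeff \<xi> i else 0)"
proof -
  have "bounded (range (\<lambda>i. if i \<in> A then 1 else 0 :: complex))"
    by (rule finite_imp_bounded, rule finite_subset[of _ "{0, 1}"]) auto
  then show ?thesis by (simp add: proj_op_def ell2_coeff_mult_op)
qed

lemma clinear_op_proj_op: "clinear_op (proj_op A)"
  by (simp add: proj_op_def clinear_op_mult_op)

lemma norm_proj_op_le: "norm (proj_op A) \<le> 1"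
  unfolding proj_op_def by (rule norm_mult_op_le) simp

lemma cinner_proj_op: "cinner (proj_op A \<xi>) \<eta> = cinner \<xi> (proj_op A \<eta>)"
  unfolding cinner_def by (intro infsum_cong) simp

lemma proj_op_compl: "\<xi> = proj_op A \<xi> + proj_op (- A) \<xi>"
  by (rule ell2_eqI) simp

lemma norm_compose3_le:
  assumes "norm S \<le> a" "norm T \<le> b" "norm U \<le> c" "0 \<le> a" "0 \<le> b"
  shows "norm (S o\<^sub>L T o\<^sub>L U) \<le> a * b * c"
  using assms by (intro order_trans[OF norm_blinfun_compose] mult_mono) auto

text \<open>A version with indicator functions only: it avoids sup norms and infinite distances, and
  the non-strict bound has no special case for zero functions.\<close>

definition quasi_local :: "('g::group_add \<Rightarrow> real) \<Rightarrow> ('x \<Rightarrow> 'g op) \<Rightarrow> bool" where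
  "quasi_local len T \<longleftrightarrow> (\<forall>\<epsilon>>0. \<exists>R. \<forall>x A B. (\<forall>\<alpha>\<in>A. \<forall>\<beta>\<in>B. R < len (\<alpha> - \<beta>)) \<longrightarrow>
     norm (proj_op A o\<^sub>L T x o\<^sub>L proj_op B) \<le> \<epsilon>)"

lemma quasi_localE:
  assumes "quasi_local len T" "0 < \<epsilon>"
  obtains R where "\<And>x A B. (\<And>\<alpha> \<beta>. \<alpha> \<in> A \<Longrightarrow> \<beta> \<in> B \<Longrightarrow> R < len (\<alpha> - \<beta>)) \<Longrightarrow>
    norm (proj_op A o\<^sub>L T x o\<^sub>L proj_op B) \<le> \<epsilon>"
  using assms unfolding quasi_local_def by meson

lemma uniformly_quasi_local_iff:
  fixes len :: "'g::group_add \<Rightarrow> real"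
  shows "uniformly_quasi_local len T \<longleftrightarrow> quasi_local len T"
proof
  assume ql: "uniformly_quasi_local len T"
  show "quasi_local len T"
    unfolding quasi_local_def
  proof (intro allI impI)
    fix \<epsilon> :: real assume "0 < \<epsilon>"
    with ql obtain R where R: "\<And>x f g. bounded (range f) \<Longrightarrow> bounded (range g) \<Longrightarrow>
        length_setdist len (support f) (support g) > ereal R \<Longrightarrow>
        norm (mult_op f o\<^sub>L T x o\<^sub>L mult_op g) \<le> \<epsilon> * sup_norm f * sup_norm g"
      unfolding uniformly_quasi_local_def Let_def by (meson less_imp_le)
    show "\<exists>R. \<forall>x A B. (\<forall>\<alpha>\<in>A. \<forall>\<beta>\<in>B. R < len (\<alpha> - \<beta>)) \<longrightarrow> norm (proj_op A o\<^sub>L T x o\<^sub>L proj_op B) \<le> \<epsilon>"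
    \<comment> \<open>Strict pointwise bounds give only a non-strict bound for the infimum defining
      the set distance; the added 1 restores strictness.\<close>
    proof (intro exI[of _ "R + 1"] allI impI)
      fix x A B assume far: "\<forall>\<alpha>\<in>A. \<forall>\<beta>\<in>B. R + 1 < len (\<alpha> - \<beta>)"
      let ?c = "\<lambda>A i. if i \<in> A then 1 else 0 :: complex"
      have b: "bounded (range (?c A))" for A :: "'g set"
        by (rule finite_imp_bounded, rule finite_subset[of _ "{0, 1}"]) auto
      have s: "0 \<le> sup_norm (?c A) \<and> sup_norm (?c A) \<le> 1" for A :: "'g set"
      proof
        show "sup_norm (?c A) \<le> 1" unfolding sup_norm_def by (rule cSUP_least) auto
        show "0 \<le> sup_norm (?c A)"
          unfolding sup_norm_def
          by (rule order_trans[OF norm_ge_zero, of "?c A undefined"], rule cSUP_upper)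
            (auto intro!: bdd_aboveI[of _ 1])
      qed
      have "ereal R < ereal (R + 1)" by simp
      also have "\<dots> \<le> length_setdist len (support (?c A)) (support (?c B))"
        unfolding length_setdist_def using far by (auto intro!: INF_greatest simp: support_def less_imp_le split: if_splits)
      finally have "norm (proj_op A o\<^sub>L T x o\<^sub>L proj_op B) \<le> \<epsilon> * sup_norm (?c A) * sup_norm (?c B)"
        unfolding proj_op_def by (intro R b)
      also have "\<dots> \<le> \<epsilon> * 1 * 1"
        using s[of A] s[of B] \<open>0 < \<epsilon>\<close> by (intro mult_mono) auto
      finally show "norm (proj_op A o\<^sub>L T x o\<^sub>L proj_op B) \<le> \<epsilon>" by simp
    qed
  qed
next
  assume ql: "quasi_local len T"
  show "uniformly_quasi_local len T"
    unfolding uniformly_quasi_local_def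
  proof (intro allI impI)
    fix \<epsilon> :: real assume "0 < \<epsilon>"
    then obtain R where R: "\<And>x A B. (\<And>\<alpha> \<beta>. \<alpha> \<in> A \<Longrightarrow> \<beta> \<in> B \<Longrightarrow> R < len (\<alpha> - \<beta>)) \<Longrightarrow>
        norm (proj_op A o\<^sub>L T x o\<^sub>L proj_op B) \<le> \<epsilon> / 2"
      \<comment> \<open>Half of \<epsilon> leaves room for the strict inequality required when f and
        g are both nonzero.\<close>
      using quasi_localE[OF ql, of "\<epsilon> / 2"] by (metis half_gt_zero)
    show "\<exists>R>0. \<forall>x f g.
        bounded (range f) \<and> bounded (range g) \<and>
        length_setdist len (support f) (support g) > ereal R \<longrightarrow>
        (let a = norm (mult_op f o\<^sub>L T x o\<^sub>L mult_op g); b = \<epsilon> * sup_norm f * sup_norm g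
         in if f = (\<lambda>_. 0) \<or> g = (\<lambda>_. 0) then a \<le> b else a < b)"
    proof (intro exI[of _ "max R 1"] conjI allI impI)
      fix x f g
      assume *: "bounded (range f) \<and> bounded (range g) \<and>
        length_setdist len (support f) (support g) > ereal (max R 1)"
      then have b: "bounded (range f)" "bounded (range g)" by auto
      have far: "R < len (\<alpha> - \<beta>)" if "\<alpha> \<in> support f" "\<beta> \<in> support g" for \<alpha> \<beta>
      proof -
        have "length_setdist len (support f) (support g) \<le> ereal (len (\<alpha> - \<beta>))"
          unfolding length_setdist_def using that by (meson INF_lower2 order_refl)
        then have "ereal (max R 1) < ereal (len (\<alpha> - \<beta>))" using * by (meson order_less_le_trans)
        then show ?thesis by simp
      qed
      have sup: "cmod (h i) \<le> sup_norm h" if "bounded (range h)" for h :: "'g \<Rightarrow> complex" and i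
        unfolding sup_norm_def using that
        by (intro cSUP_upper) (auto simp: bounded_iff bdd_above_def)
      \<comment> \<open>Multiplication by a function factors through the projection onto its
        support, and contributes at most its sup norm.\<close>
      have eq: "mult_op f o\<^sub>L T x o\<^sub>L mult_op g =
          mult_op f o\<^sub>L (proj_op (support f) o\<^sub>L T x o\<^sub>L proj_op (support g)) o\<^sub>L mult_op g"
      proof (intro blinfun_eqI ell2_eqI)
        fix \<xi> i
        have g: "proj_op (support g) (mult_op g \<xi>) = mult_op g \<xi>"
          by (rule ell2_eqI) (simp add: ell2_coeff_mult_op b support_def)
        show "ell2_coeff ((mult_op f o\<^sub>L T x o\<^sub>L mult_op g) \<xi>) i = ell2_coeff ((mult_op f o\<^sub>L
            (proj_op (support f) o\<^sub>L T x o\<^sub>L proj_op (support g)) o\<^sub>L mult_op g) \<xi>) i"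
          by (simp add: ell2_coeff_mult_op b g) (simp add: support_def)
      qed
      have nn: "0 \<le> sup_norm h" if "bounded (range h)" for h :: "'g \<Rightarrow> complex"
        using sup[OF that] norm_ge_zero order_trans by blast
      have le: "norm (mult_op f o\<^sub>L T x o\<^sub>L mult_op g) \<le> sup_norm f * (\<epsilon> / 2) * sup_norm g"
        unfolding eq using \<open>0 < \<epsilon>\<close> nn b
        by (intro norm_compose3_le R far norm_mult_op_le sup) auto
      show "let a = norm (mult_op f o\<^sub>L T x o\<^sub>L mult_op g); b = \<epsilon> * sup_norm f * sup_norm g
         in if f = (\<lambda>_. 0) \<or> g = (\<lambda>_. 0) then a \<le> b else a < b"
      proof (cases "f = (\<lambda>_. 0) \<or> g = (\<lambda>_. 0)")
        case True
        have "sup_norm f * (\<epsilon> / 2) * sup_norm g \<le> \<epsilon> * sup_norm f * sup_norm g"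
          using \<open>0 < \<epsilon>\<close> nn b by (simp add: mult_ac)
        with le show ?thesis unfolding Let_def if_P[OF True] by (rule order_trans)
      next
        case False
        then obtain i j where "f i \<noteq> 0" "g j \<noteq> 0" by (metis ext)
        then have "0 < sup_norm f" "0 < sup_norm g"
          using sup[OF b(1), of i] sup[OF b(2), of j] by (auto intro: order_less_le_trans[rotated])
        then have "sup_norm f * (\<epsilon> / 2) * sup_norm g < \<epsilon> * sup_norm f * sup_norm g"
          using \<open>0 < \<epsilon>\<close> by (simp add: mult_ac)
        with le show ?thesis unfolding Let_def if_not_P[OF False] by (rule order_le_less_trans)
      qed
    qed simp
  qed
qed

lemma quasi_local_add:
  assumes "quasi_local len S" "quasi_local len T"
  shows "quasi_local len (\<lambda>x. S x + T x)"
  unfolding quasi_local_def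
proof (intro allI impI)
  fix \<epsilon> :: real assume "0 < \<epsilon>"
  then have e: "0 < \<epsilon> / 2" by simp
  from quasi_localE[OF assms(1) e] obtain R1 where R1:
    "\<And>x A B. (\<And>\<alpha> \<beta>. \<alpha> \<in> A \<Longrightarrow> \<beta> \<in> B \<Longrightarrow> R1 < len (\<alpha> - \<beta>)) \<Longrightarrow>
      norm (proj_op A o\<^sub>L S x o\<^sub>L proj_op B) \<le> \<epsilon> / 2" by metis
  from quasi_localE[OF assms(2) e] obtain R2 where R2:
    "\<And>x A B. (\<And>\<alpha> \<beta>. \<alpha> \<in> A \<Longrightarrow> \<beta> \<in> B \<Longrightarrow> R2 < len (\<alpha> - \<beta>)) \<Longrightarrow>
      norm (proj_op A o\<^sub>L T x o\<^sub>L proj_op B) \<le> \<epsilon> / 2" by metis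
  show "\<exists>R. \<forall>x A B. (\<forall>\<alpha>\<in>A. \<forall>\<beta>\<in>B. R < len (\<alpha> - \<beta>)) \<longrightarrow>
      norm (proj_op A o\<^sub>L (S x + T x) o\<^sub>L proj_op B) \<le> \<epsilon>"
  proof (intro exI[of _ "max R1 R2"] allI impI)
    fix x A B assume *: "\<forall>\<alpha>\<in>A. \<forall>\<beta>\<in>B. max R1 R2 < len (\<alpha> - \<beta>)"
    have "proj_op A o\<^sub>L (S x + T x) o\<^sub>L proj_op B =
        (proj_op A o\<^sub>L S x o\<^sub>L proj_op B) + (proj_op A o\<^sub>L T x o\<^sub>L proj_op B)"
      by (intro blinfun_eqI) (simp add: blinfun.add_left blinfun.add_right)
    moreover have "norm (proj_op A o\<^sub>L S x o\<^sub>L proj_op B) \<le> \<epsilon> / 2" by (rule R1) (use * in auto)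
    moreover have "norm (proj_op A o\<^sub>L T x o\<^sub>L proj_op B) \<le> \<epsilon> / 2" by (rule R2) (use * in auto)
    ultimately show "norm (proj_op A o\<^sub>L (S x + T x) o\<^sub>L proj_op B) \<le> \<epsilon>"
      by (simp add: norm_triangle_le)
  qed
qed

lemma quasi_local_scale:
  assumes "quasi_local len T" shows "quasi_local len (\<lambda>x. mult_op (\<lambda>_. c) o\<^sub>L T x)"
  unfolding quasi_local_def
proof (intro allI impI)
  fix \<epsilon> :: real assume "0 < \<epsilon>"
  then have e: "0 < \<epsilon> / (cmod c + 1)" by (simp add: add_nonneg_pos)
  from quasi_localE[OF assms e] obtain R where R:
    "\<And>x A B. (\<And>\<alpha> \<beta>. \<alpha> \<in> A \<Longrightarrow> \<beta> \<in> B \<Longrightarrow> R < len (\<alpha> - \<beta>)) \<Longrightarrow>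
      norm (proj_op A o\<^sub>L T x o\<^sub>L proj_op B) \<le> \<epsilon> / (cmod c + 1)" by metis
  show "\<exists>R. \<forall>x A B. (\<forall>\<alpha>\<in>A. \<forall>\<beta>\<in>B. R < len (\<alpha> - \<beta>)) \<longrightarrow>
      norm (proj_op A o\<^sub>L (mult_op (\<lambda>_. c) o\<^sub>L T x) o\<^sub>L proj_op B) \<le> \<epsilon>"
  proof (intro exI[of _ R] allI impI)
    fix x A B assume *: "\<forall>\<alpha>\<in>A. \<forall>\<beta>\<in>B. R < len (\<alpha> - \<beta>)"
    have "proj_op A o\<^sub>L (mult_op (\<lambda>_. c) o\<^sub>L T x) o\<^sub>L proj_op B =
        mult_op (\<lambda>_. c) o\<^sub>L (proj_op A o\<^sub>L T x o\<^sub>L proj_op B)"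
      by (intro blinfun_eqI) (simp add: clinear_op_scaleC clinear_op_proj_op)
    then have "norm (proj_op A o\<^sub>L (mult_op (\<lambda>_. c) o\<^sub>L T x) o\<^sub>L proj_op B) \<le> cmod c * (\<epsilon> / (cmod c + 1))"
      using mult_left_mono[OF R[of A B x] norm_ge_zero[of c]] * by simp
    also have "\<dots> \<le> (cmod c + 1) * (\<epsilon> / (cmod c + 1))"
      using e by (intro mult_right_mono) auto
    also have "\<dots> = \<epsilon>" using norm_ge_zero[of c] by (simp add: add_nonneg_eq_0_iff)
    finally show "norm (proj_op A o\<^sub>L (mult_op (\<lambda>_. c) o\<^sub>L T x) o\<^sub>L proj_op B) \<le> \<epsilon>" .
  qed
qed

text \<open>The intermediate space is split at the R1-neighbourhood M of A. By the triangle
  inequality M is still at distance more than R2 from B, so T contributes little there; on the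
  complement of M, S contributes little.\<close>

lemma quasi_local_compose:
  assumes "quasi_local len S" "quasi_local len T"
    and C: "\<And>x. norm (S x) \<le> C" "\<And>x. norm (T x) \<le> C"
    and tri: "\<And>\<alpha> \<beta>. len (\<alpha> + \<beta>) \<le> len \<alpha> + len \<beta>"
  shows "quasi_local len (\<lambda>x. S x o\<^sub>L T x)"
  unfolding quasi_local_def
proof (intro allI impI)
  fix \<epsilon> :: real assume "0 < \<epsilon>"
  have "0 \<le> C" using C(1) norm_ge_zero order_trans by blast
  define e where "e = \<epsilon> / (2 * (C + 1))"
  have e: "0 < e" using \<open>0 < \<epsilon>\<close> \<open>0 \<le> C\<close> by (simp add: e_def)
  from quasi_localE[OF assms(1) e] obtain R1 where R1:
    "\<And>x A B. (\<And>\<alpha> \<beta>. \<alpha> \<in> A \<Longrightarrow> \<beta> \<in> B \<Longrightarrow> R1 < len (\<alpha> - \<beta>)) \<Longrightarrow>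
      norm (proj_op A o\<^sub>L S x o\<^sub>L proj_op B) \<le> e" by metis
  from quasi_localE[OF assms(2) e] obtain R2 where R2:
    "\<And>x A B. (\<And>\<alpha> \<beta>. \<alpha> \<in> A \<Longrightarrow> \<beta> \<in> B \<Longrightarrow> R2 < len (\<alpha> - \<beta>)) \<Longrightarrow>
      norm (proj_op A o\<^sub>L T x o\<^sub>L proj_op B) \<le> e" by metis
  show "\<exists>R. \<forall>x A B. (\<forall>\<alpha>\<in>A. \<forall>\<beta>\<in>B. R < len (\<alpha> - \<beta>)) \<longrightarrow>
      norm (proj_op A o\<^sub>L (S x o\<^sub>L T x) o\<^sub>L proj_op B) \<le> \<epsilon>"
  proof (intro exI[of _ "R1 + R2"] allI impI)
    fix x A B assume *: "\<forall>\<alpha>\<in>A. \<forall>\<beta>\<in>B. R1 + R2 < len (\<alpha> - \<beta>)"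
    define M where "M = {\<gamma>. \<exists>\<alpha>\<in>A. len (\<alpha> - \<gamma>) \<le> R1}"
    have split: "proj_op A o\<^sub>L (S x o\<^sub>L T x) o\<^sub>L proj_op B =
        ((proj_op A o\<^sub>L S x) o\<^sub>L (proj_op M o\<^sub>L T x o\<^sub>L proj_op B)) +
        ((proj_op A o\<^sub>L S x o\<^sub>L proj_op (- M)) o\<^sub>L (T x o\<^sub>L proj_op B))"
      by (intro blinfun_eqI)
        (simp add: blinfun.add_left blinfun.add_right[symmetric] proj_op_compl[symmetric])
    have 1: "norm (proj_op M o\<^sub>L T x o\<^sub>L proj_op B) \<le> e"
    proof (rule R2)
      fix \<gamma> \<beta> assume "\<gamma> \<in> M" "\<beta> \<in> B"
      then obtain \<alpha> where "\<alpha> \<in> A" "len (\<alpha> - \<gamma>) \<le> R1" by (auto simp: M_def)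
      moreover have "len (\<alpha> - \<beta>) \<le> len (\<alpha> - \<gamma>) + len (\<gamma> - \<beta>)"
        using tri[of "\<alpha> - \<gamma>" "\<gamma> - \<beta>"] by (simp add: algebra_simps)
      ultimately show "R2 < len (\<gamma> - \<beta>)" using * \<open>\<beta> \<in> B\<close> by fastforce
    qed
    have 2: "norm (proj_op A o\<^sub>L S x o\<^sub>L proj_op (- M)) \<le> e"
      by (rule R1) (auto simp: M_def not_le)
    have "norm ((proj_op A o\<^sub>L S x) o\<^sub>L (proj_op M o\<^sub>L T x o\<^sub>L proj_op B)) \<le> (1 * C) * e"
      by (rule order_trans[OF norm_blinfun_compose], intro mult_mono 1
          order_trans[OF norm_blinfun_compose] C norm_proj_op_le) (use \<open>0 \<le> C\<close> in auto)
    moreover have "norm ((proj_op A o\<^sub>L S x o\<^sub>L proj_op (- M)) o\<^sub>L (T x o\<^sub>L proj_op B)) \<le> e * (C * 1)"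
      by (rule order_trans[OF norm_blinfun_compose], intro mult_mono 2
          order_trans[OF norm_blinfun_compose[of "T x"]] C norm_proj_op_le) (use \<open>0 \<le> C\<close> e in auto)
    ultimately have "norm (proj_op A o\<^sub>L (S x o\<^sub>L T x) o\<^sub>L proj_op B) \<le> (1 * C) * e + e * (C * 1)"
      unfolding split by (rule norm_triangle_mono)
    also have "\<dots> \<le> 2 * (C + 1) * e" using e by (simp add: algebra_simps)
    also have "\<dots> = \<epsilon>" using \<open>0 \<le> C\<close> by (simp add: e_def)
    finally show "norm (proj_op A o\<^sub>L (S x o\<^sub>L T x) o\<^sub>L proj_op B) \<le> \<epsilon>" .
  qed
qed

lemma quasi_local_adjoint:
  assumes "quasi_local len T" and lin: "\<And>x. clinear_op (T x)" and len: "\<And>\<gamma>. len (- \<gamma>) = len \<gamma>"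
  shows "quasi_local len (\<lambda>x. adjoint_op (T x))"
  unfolding quasi_local_def
proof (intro allI impI)
  fix \<epsilon> :: real assume "0 < \<epsilon>"
  from quasi_localE[OF assms(1) this] obtain R where R:
    "\<And>x A B. (\<And>\<alpha> \<beta>. \<alpha> \<in> A \<Longrightarrow> \<beta> \<in> B \<Longrightarrow> R < len (\<alpha> - \<beta>)) \<Longrightarrow>
      norm (proj_op A o\<^sub>L T x o\<^sub>L proj_op B) \<le> \<epsilon>" by metis
  show "\<exists>R. \<forall>x A B. (\<forall>\<alpha>\<in>A. \<forall>\<beta>\<in>B. R < len (\<alpha> - \<beta>)) \<longrightarrow>
      norm (proj_op A o\<^sub>L adjoint_op (T x) o\<^sub>L proj_op B) \<le> \<epsilon>"
  proof (intro exI[of _ R] allI impI)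
    fix x A B assume *: "\<forall>\<alpha>\<in>A. \<forall>\<beta>\<in>B. R < len (\<alpha> - \<beta>)"
    have "adjoint_op (proj_op B o\<^sub>L T x o\<^sub>L proj_op A) = proj_op A o\<^sub>L adjoint_op (T x) o\<^sub>L proj_op B"
      by (rule adjoint_op_eqI)
        (auto simp: cinner_proj_op cinner_adjoint_left lin intro!: clinear_op_compose clinear_op_proj_op clinear_op_adjoint)
    then have "norm (proj_op A o\<^sub>L adjoint_op (T x) o\<^sub>L proj_op B) \<le> norm (proj_op B o\<^sub>L T x o\<^sub>L proj_op A)"
      using norm_adjoint_le[of "proj_op B o\<^sub>L T x o\<^sub>L proj_op A"]
      by (auto intro!: clinear_op_compose clinear_op_proj_op lin)
    also have "\<dots> \<le> \<epsilon>"
    proof (rule R)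
      show "R < len (\<alpha> - \<beta>)" if "\<alpha> \<in> B" "\<beta> \<in> A" for \<alpha> \<beta>
        using * that len[of "\<beta> - \<alpha>"] by auto
    qed
    finally show "norm (proj_op A o\<^sub>L adjoint_op (T x) o\<^sub>L proj_op B) \<le> \<epsilon>" .
  qed
qed

lemma quasi_local_limit:
  assumes "\<And>\<epsilon>. 0 < \<epsilon> \<Longrightarrow> \<exists>S. quasi_local len S \<and> (\<forall>x. norm (S x - T x) \<le> \<epsilon>)"
  shows "quasi_local len T"
  unfolding quasi_local_def
proof (intro allI impI)
  fix \<epsilon> :: real assume "0 < \<epsilon>"
  then have e: "0 < \<epsilon> / 2" by simp
  from assms[OF e] obtain S where S: "quasi_local len S" "\<And>x. norm (S x - T x) \<le> \<epsilon> / 2" by auto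
  from quasi_localE[OF S(1) e] obtain R where R:
    "\<And>x A B. (\<And>\<alpha> \<beta>. \<alpha> \<in> A \<Longrightarrow> \<beta> \<in> B \<Longrightarrow> R < len (\<alpha> - \<beta>)) \<Longrightarrow>
      norm (proj_op A o\<^sub>L S x o\<^sub>L proj_op B) \<le> \<epsilon> / 2" by metis
  show "\<exists>R. \<forall>x A B. (\<forall>\<alpha>\<in>A. \<forall>\<beta>\<in>B. R < len (\<alpha> - \<beta>)) \<longrightarrow>
      norm (proj_op A o\<^sub>L T x o\<^sub>L proj_op B) \<le> \<epsilon>"
  proof (intro exI[of _ R] allI impI)
    fix x A B assume *: "\<forall>\<alpha>\<in>A. \<forall>\<beta>\<in>B. R < len (\<alpha> - \<beta>)"
    have "proj_op A o\<^sub>L T x o\<^sub>L proj_op B =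
        (proj_op A o\<^sub>L S x o\<^sub>L proj_op B) - (proj_op A o\<^sub>L (S x - T x) o\<^sub>L proj_op B)"
      by (intro blinfun_eqI) (simp add: blinfun.diff_left blinfun.diff_right)
    moreover have "norm (proj_op A o\<^sub>L S x o\<^sub>L proj_op B) \<le> \<epsilon> / 2" by (rule R) (use * in auto)
    moreover have "norm (proj_op A o\<^sub>L (S x - T x) o\<^sub>L proj_op B) \<le> 1 * (\<epsilon> / 2) * 1"
      using e by (intro norm_compose3_le norm_proj_op_le S) auto
    ultimately show "norm (proj_op A o\<^sub>L T x o\<^sub>L proj_op B) \<le> \<epsilon>"
      using norm_triangle_ineq4[of "proj_op A o\<^sub>L S x o\<^sub>L proj_op B" "proj_op A o\<^sub>L (S x - T x) o\<^sub>L proj_op B"] by simp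
  qed
qed

subsection \<open>Continuity in the weak operator topology\<close>

lemma continuous_on_uniform_approx:
  fixes f :: "'x::topological_space \<Rightarrow> 'b::metric_space"
  assumes "\<And>\<epsilon>. 0 < \<epsilon> \<Longrightarrow> \<exists>g. continuous_on UNIV g \<and> (\<forall>x. dist (g x) (f x) < \<epsilon>)"
  shows "continuous_on UNIV f"
proof -
  have "\<forall>n. \<exists>g. continuous_on UNIV g \<and> (\<forall>x. dist (g x) (f x) < inverse (real (Suc n)))"
    using assms by simp
  then obtain g where g: "\<And>n. continuous_on UNIV (g n)"
    "\<And>n x. dist (g n x) (f x) < inverse (real (Suc n))" by metis
  have "uniform_limit UNIV g f sequentially"
    unfolding uniform_limit_iff
  proof (intro allI impI)
    fix e :: real assume "0 < e"
    then obtain N where "inverse (real (Suc N)) < e" using reals_Archimedean by blast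
    then show "\<forall>\<^sub>F n in sequentially. \<forall>x\<in>UNIV. dist (g n x) (f x) < e"
      unfolding eventually_sequentially
      by (intro exI[of _ N]) (smt (verit, best) g(2) le_imp_inverse_le of_nat_0_less_iff of_nat_mono Suc_le_mono zero_less_Suc)
  qed
  then show ?thesis
    by (rule uniform_limit_theorem[rotated]) (use g in auto)
qed

lemma exists_fin_vec_near:
  assumes "0 < \<epsilon>"
  shows "\<exists>A. finite A \<and> norm (fin_vec A (ell2_coeff \<xi>) - \<xi>) < \<epsilon> \<and> norm (fin_vec A (ell2_coeff \<eta>) - \<eta>) < \<epsilon>"
proof -
  have fin: "\<forall>\<^sub>F A in finite_subsets_at_top UNIV. finite (A :: 'a set)"
    by (simp add: eventually_finite_subsets_at_top_weakI)
  have "\<forall>\<^sub>F A in finite_subsets_at_top UNIV. finite A \<and> norm (fin_vec A (ell2_coeff \<xi>) - \<xi>) < \<epsilon> \<and>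
      norm (fin_vec A (ell2_coeff \<eta>) - \<eta>) < \<epsilon>"
    using fin tendstoD[OF tendsto_fin_vec assms, of \<xi>] tendstoD[OF tendsto_fin_vec assms, of \<eta>]
    by eventually_elim (auto simp: dist_norm)
  then show ?thesis
    by (rule eventually_happens'[rotated]) simp
qed

text \<open>Because the family is norm bounded, arbitrary vectors can be replaced by finite ones
  with an error uniform in x. Continuity then only concerns finite sums of matrix
  coefficients.\<close>

lemma continuous_map_wot_iff:
  fixes T :: "'x::topological_space \<Rightarrow> 'i op"
  assumes lin: "\<And>x. clinear_op (T x)" and C: "\<And>x. norm (T x) \<le> C"
  shows "continuous_map euclidean weak_operator_topology T \<longleftrightarrow>
    (\<forall>\<alpha> \<beta>. continuous_on UNIV (\<lambda>x. matrix_coeff (T x) \<alpha> \<beta>))"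
proof
  assume "continuous_map euclidean weak_operator_topology T"
  then show "\<forall>\<alpha> \<beta>. continuous_on UNIV (\<lambda>x. matrix_coeff (T x) \<alpha> \<beta>)"
    unfolding continuous_map_weak_operator_topology_iff matrix_coeff_def
    by (simp add: continuous_map_iff_continuous2 del: cinner_delta_left)
next
  assume cont: "\<forall>\<alpha> \<beta>. continuous_on UNIV (\<lambda>x. matrix_coeff (T x) \<alpha> \<beta>)"
  have "0 \<le> C" using C norm_ge_zero order_trans by blast
  have "continuous_on UNIV (\<lambda>x. cinner \<xi> (T x \<eta>))" for \<xi> \<eta>
  proof (rule continuous_on_uniform_approx)
    fix \<epsilon> :: real assume "0 < \<epsilon>"
    \<comment> \<open>Approximating within d changes the form by at most d * C * (norm \<xi> + norm
      \<eta>); the added ones keep the denominator positive and the estimate strict.\<close>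
    define d where "d = \<epsilon> / ((C + 1) * (norm \<xi> + norm \<eta> + 1))"
    have pos: "0 < (C + 1) * (norm \<xi> + norm \<eta> + 1)"
      using \<open>0 \<le> C\<close> by (intro mult_pos_pos) (auto simp: add_nonneg_pos)
    then have "0 < d" using \<open>0 < \<epsilon>\<close> by (simp add: d_def)
    then obtain A where A: "finite A" "norm (fin_vec A (ell2_coeff \<xi>) - \<xi>) < d" "norm (fin_vec A (ell2_coeff \<eta>) - \<eta>) < d"
      using exists_fin_vec_near by blast
    let ?\<xi> = "fin_vec A (ell2_coeff \<xi>)" and ?\<eta> = "fin_vec A (ell2_coeff \<eta>)"
    have "continuous_on UNIV (\<lambda>x. cinner ?\<xi> (T x ?\<eta>))"
      unfolding cinner_op_fin_vec[OF lin A(1) A(1)] using cont by (intro continuous_intros) auto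
    moreover have "dist (cinner ?\<xi> (T x ?\<eta>)) (cinner \<xi> (T x \<eta>)) < \<epsilon>" for x
    proof -
      have T: "norm (T x \<zeta>) \<le> C * norm \<zeta>" for \<zeta>
        by (rule order_trans[OF norm_blinfun mult_right_mono[OF C]]) simp
      have "cinner ?\<xi> (T x ?\<eta>) - cinner \<xi> (T x \<eta>) = cinner (?\<xi> - \<xi>) (T x ?\<eta>) + cinner \<xi> (T x (?\<eta> - \<eta>))"
        by (simp add: cinner.diff_left cinner.diff_right blinfun.diff_right)
      also have "cmod \<dots> \<le> d * (C * norm \<eta>) + norm \<xi> * (C * d)"
      proof (rule norm_triangle_mono)
        have "norm (T x ?\<eta>) \<le> C * norm \<eta>"
          by (rule order_trans[OF T mult_left_mono[OF norm_fin_vec_coeff_le \<open>0 \<le> C\<close>]])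
        then show "cmod (cinner (?\<xi> - \<xi>) (T x ?\<eta>)) \<le> d * (C * norm \<eta>)"
          using A \<open>0 < d\<close> by (intro order_trans[OF norm_cinner_le] mult_mono) auto
        have "norm (T x (?\<eta> - \<eta>)) \<le> C * d"
          using A by (intro order_trans[OF T mult_left_mono[OF _ \<open>0 \<le> C\<close>]]) auto
        then show "cmod (cinner \<xi> (T x (?\<eta> - \<eta>))) \<le> norm \<xi> * (C * d)"
          by (intro order_trans[OF norm_cinner_le] mult_left_mono) auto
      qed
      also have "\<dots> < d * ((C + 1) * (norm \<xi> + norm \<eta> + 1))"
      proof -
        have "0 < d * (C + 1 + norm \<xi> + norm \<eta>)"
          using \<open>0 < d\<close> \<open>0 \<le> C\<close> by (intro mult_pos_pos) (auto simp: add_pos_nonneg)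
        then show ?thesis by (simp add: algebra_simps)
      qed
      also have "\<dots> = \<epsilon>" using pos unfolding d_def by (metis nonzero_eq_divide_eq less_irrefl)
      finally show ?thesis by (simp add: dist_norm)
    qed
    ultimately show "\<exists>g. continuous_on UNIV g \<and> (\<forall>x. dist (g x) (cinner \<xi> (T x \<eta>)) < \<epsilon>)" by blast
  qed
  then show "continuous_map euclidean weak_operator_topology T"
    unfolding continuous_map_weak_operator_topology_iff by (simp add: continuous_map_iff_continuous2)
qed

text \<open>The product is not jointly continuous for the weak operator topology, but for a quasi-local
  family the columns \<open>T x (delta \<beta>)\<close> have uniformly small tails.\<close>

lemma continuous_matrix_coeff_compose:
  fixes S T :: "'x::topological_space \<Rightarrow> 'g::group_add op"
  assumes lin: "\<And>x. clinear_op (S x)" and C: "\<And>x. norm (S x) \<le> C"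
    and ql: "quasi_local len T" and proper: "\<And>r. finite {\<gamma>. len \<gamma> \<le> r}"
    and cont: "\<And>\<alpha> \<beta>. continuous_on UNIV (\<lambda>x. matrix_coeff (S x) \<alpha> \<beta>)"
      "\<And>\<alpha> \<beta>. continuous_on UNIV (\<lambda>x. matrix_coeff (T x) \<alpha> \<beta>)"
  shows "continuous_on UNIV (\<lambda>x. matrix_coeff (S x o\<^sub>L T x) \<alpha> \<beta>)"
proof (rule continuous_on_uniform_approx)
  fix \<epsilon> :: real assume "0 < \<epsilon>"
  have "0 \<le> C" using C norm_ge_zero order_trans by blast
  then have e: "0 < \<epsilon> / (C + 1)" using \<open>0 < \<epsilon>\<close> by simp
  from quasi_localE[OF ql e] obtain R where R:
    "\<And>x A B. (\<And>\<alpha> \<beta>. \<alpha> \<in> A \<Longrightarrow> \<beta> \<in> B \<Longrightarrow> R < len (\<alpha> - \<beta>)) \<Longrightarrow>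
      norm (proj_op A o\<^sub>L T x o\<^sub>L proj_op B) \<le> \<epsilon> / (C + 1)" by metis
  \<comment> \<open>A ball around \<beta>, finite as a right translate of a ball around the unit.
    Quasi-locality between {\<beta>} and the complement of F bounds the tail of the column uniformly
    in x, so the matrix product is a uniform limit of finite sums.\<close>
  define F where "F = {\<gamma>. len (\<gamma> - \<beta>) \<le> R}"
  have "F = (\<lambda>\<gamma>. \<gamma> + \<beta>) ` {\<gamma>. len \<gamma> \<le> R}"
    by (auto simp: F_def image_iff) (metis diff_add_cancel)
  then have F: "finite F" using proper by simp
  let ?g = "\<lambda>x. \<Sum>\<gamma>\<in>F. matrix_coeff (S x) \<alpha> \<gamma> * matrix_coeff (T x) \<gamma> \<beta>"
  have "dist (?g x) (matrix_coeff (S x o\<^sub>L T x) \<alpha> \<beta>) < \<epsilon>" for x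
  proof -
    have tail: "norm (proj_op (- F) (T x (delta \<beta>))) \<le> \<epsilon> / (C + 1)"
    proof -
      have "norm (proj_op (- F) o\<^sub>L T x o\<^sub>L proj_op {\<beta>}) \<le> \<epsilon> / (C + 1)"
        by (rule R) (auto simp: F_def not_le)
      moreover have "proj_op {\<beta>} (delta \<beta>) = delta \<beta>"
        by (rule ell2_eqI) (simp add: ell2_coeff_delta del: ell2_coeff_op_delta)
      ultimately show ?thesis
        using norm_blinfun[of "proj_op (- F) o\<^sub>L T x o\<^sub>L proj_op {\<beta>}" "delta \<beta>"] by simp
    qed
    have "proj_op F (T x (delta \<beta>)) = fin_vec F (\<lambda>\<gamma>. matrix_coeff (T x) \<gamma> \<beta>)"
      by (rule ell2_eqI) (simp add: ell2_coeff_fin_vec F)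
    then have "?g x = cinner (delta \<alpha>) (S x (proj_op F (T x (delta \<beta>))))"
      by (simp add: op_fin_vec lin mult.commute)
    moreover have "T x (delta \<beta>) - proj_op F (T x (delta \<beta>)) = proj_op (- F) (T x (delta \<beta>))"
      using proj_op_compl[of "T x (delta \<beta>)" F] by (simp only: diff_eq_eq add.commute)
    ultimately have "matrix_coeff (S x o\<^sub>L T x) \<alpha> \<beta> - ?g x = cinner (delta \<alpha>) (S x (proj_op (- F) (T x (delta \<beta>))))"
      unfolding matrix_coeff_def[of "S x o\<^sub>L T x"]
      by (simp only: blinfun_apply_blinfun_compose blinfun.diff_right[symmetric] cinner.diff_right[symmetric])
    also have "cmod \<dots> \<le> norm (delta \<alpha>) * (C * (\<epsilon> / (C + 1)))"
      using tail \<open>0 \<le> C\<close>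
      by (intro order_trans[OF norm_cinner_le] mult_left_mono order_trans[OF norm_blinfun[of "S x"]] mult_mono C) auto
    also have "\<dots> < \<epsilon>" using \<open>0 \<le> C\<close> \<open>0 < \<epsilon>\<close> by (simp add: field_simps)
    finally show ?thesis by (simp add: dist_norm norm_minus_commute)
  qed
  moreover have "continuous_on UNIV ?g" by (intro continuous_intros cont)
  ultimately show "\<exists>g. continuous_on UNIV g \<and> (\<forall>x. dist (g x) (matrix_coeff (S x o\<^sub>L T x) \<alpha> \<beta>) < \<epsilon>)"
    by blast
qed

section \<open>Closure of the target algebra under the operations and under norm limits\<close>

subsection \<open>The algebra of equivariant quasi-local families\<close>

lemma matrix_coeff_add: "matrix_coeff (S + T) \<alpha> \<beta> = matrix_coeff S \<alpha> \<beta> + matrix_coeff T \<alpha> \<beta>"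
  by (simp add: matrix_coeff_def[of "S + T"] blinfun.add_left)

lemma matrix_coeff_diff: "matrix_coeff (S - T) \<alpha> \<beta> = matrix_coeff S \<alpha> \<beta> - matrix_coeff T \<alpha> \<beta>"
  by (simp add: matrix_coeff_def[of "S - T"] blinfun.diff_left)

lemma matrix_coeff_scale: "matrix_coeff (mult_op (\<lambda>_. c) o\<^sub>L T) \<alpha> \<beta> = c * matrix_coeff T \<alpha> \<beta>"
  by (simp add: matrix_coeff_def[of "mult_op (\<lambda>_. c) o\<^sub>L T"])

lemma equivariant_quasi_local_families_iff:
  "T \<in> equivariant_quasi_local_families act len \<longleftrightarrow>
    (\<forall>x. clinear_op (T x)) \<and> (\<exists>C. \<forall>x. norm (T x) \<le> C) \<and> quasi_local len T \<and>
    (\<forall>x \<alpha> \<beta> \<gamma>. matrix_coeff (T (act \<gamma> x)) \<alpha> \<beta> = matrix_coeff (T x) (\<alpha> + \<gamma>) (\<beta> + \<gamma>)) \<and>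
    (\<forall>\<alpha> \<beta>. continuous_on UNIV (\<lambda>x. matrix_coeff (T x) \<alpha> \<beta>))"
proof -
  have bdd: "bdd_above (range (\<lambda>x. norm (T x))) \<longleftrightarrow> (\<exists>C. \<forall>x. norm (T x) \<le> C)"
    by (auto simp: bdd_above_def)
  have cont: "continuous_map euclidean weak_operator_topology T \<longleftrightarrow>
      (\<forall>\<alpha> \<beta>. continuous_on UNIV (\<lambda>x. matrix_coeff (T x) \<alpha> \<beta>))"
    if "\<forall>x. clinear_op (T x)" "\<exists>C. \<forall>x. norm (T x) \<le> C"
    using that continuous_map_wot_iff[of T] by blast
  show ?thesis
    unfolding equivariant_quasi_local_families_def product_algebra_def bounded_ops_def
    by (simp add: bdd uniformly_quasi_local_iff) (use cont in blast)
qed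

text \<open>Every condition passes to uniform limits over x. The formulation without sequences
  serves both norm closures: that of the algebra of families and that in the crossed
  product.\<close>

lemma equivariant_quasi_local_families_limit:
  assumes lin: "\<And>x. clinear_op (T x)"
    and lim: "\<And>\<epsilon>. 0 < \<epsilon> \<Longrightarrow> \<exists>S\<in>equivariant_quasi_local_families act len. \<forall>x. norm (S x - T x) \<le> \<epsilon>"
  shows "T \<in> equivariant_quasi_local_families act len"
  unfolding equivariant_quasi_local_families_iff
proof (intro conjI allI)
  note E = equivariant_quasi_local_families_iff
  obtain S where S: "S \<in> equivariant_quasi_local_families act len" "\<And>x. norm (S x - T x) \<le> 1"
    using lim[of 1] by auto
  then obtain C where "\<And>x. norm (S x) \<le> C" by (auto simp: E)
  have "norm (T x) \<le> C + 1" for x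
    using norm_triangle_ineq4[of "S x" "S x - T x"] S(2)[of x] \<open>norm (S x) \<le> C\<close> by simp
  then show "\<exists>C. \<forall>x. norm (T x) \<le> C" by blast
  show "quasi_local len T"
    by (rule quasi_local_limit) (use lim E in blast)
  have close: "dist (matrix_coeff (S x) \<alpha> \<beta>) (matrix_coeff (T x) \<alpha> \<beta>) \<le> norm (S x - T x)" for S x \<alpha> \<beta>
    using norm_matrix_coeff_le[of "S x - T x" \<alpha> \<beta>] by (simp add: dist_norm matrix_coeff_diff)
  show "matrix_coeff (T (act \<gamma> x)) \<alpha> \<beta> = matrix_coeff (T x) (\<alpha> + \<gamma>) (\<beta> + \<gamma>)" for x \<alpha> \<beta> \<gamma>
  proof (rule ccontr)
    let ?d = "dist (matrix_coeff (T (act \<gamma> x)) \<alpha> \<beta>) (matrix_coeff (T x) (\<alpha> + \<gamma>) (\<beta> + \<gamma>))"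
    assume "matrix_coeff (T (act \<gamma> x)) \<alpha> \<beta> \<noteq> matrix_coeff (T x) (\<alpha> + \<gamma>) (\<beta> + \<gamma>)"
    then have "0 < ?d / 3" by simp
    from lim[OF this] obtain S where S: "S \<in> equivariant_quasi_local_families act len" "\<And>x. norm (S x - T x) \<le> ?d / 3"
      by blast
    have "matrix_coeff (S (act \<gamma> x)) \<alpha> \<beta> = matrix_coeff (S x) (\<alpha> + \<gamma>) (\<beta> + \<gamma>)"
      using S(1) by (simp add: E)
    then have "dist (matrix_coeff (S x) (\<alpha> + \<gamma>) (\<beta> + \<gamma>)) (matrix_coeff (T (act \<gamma> x)) \<alpha> \<beta>) \<le> ?d / 3"
      using close[of S "act \<gamma> x" \<alpha> \<beta>] S(2)[of "act \<gamma> x"] by simp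
    then have "?d \<le> ?d / 3 + ?d / 3"
      using close[of S x "\<alpha> + \<gamma>" "\<beta> + \<gamma>"] S(2)[of x]
        dist_triangle3[of "matrix_coeff (T (act \<gamma> x)) \<alpha> \<beta>" "matrix_coeff (T x) (\<alpha> + \<gamma>) (\<beta> + \<gamma>)"
          "matrix_coeff (S x) (\<alpha> + \<gamma>) (\<beta> + \<gamma>)"] by linarith
    with \<open>0 < ?d / 3\<close> show False by linarith
  qed
  show "continuous_on UNIV (\<lambda>x. matrix_coeff (T x) \<alpha> \<beta>)" for \<alpha> \<beta>
  proof (rule continuous_on_uniform_approx)
    fix \<epsilon> :: real assume "0 < \<epsilon>"
    then obtain S where S: "S \<in> equivariant_quasi_local_families act len" "\<And>x. norm (S x - T x) \<le> \<epsilon> / 2"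
      using lim[of "\<epsilon> / 2"] by auto
    have "dist (matrix_coeff (S x) \<alpha> \<beta>) (matrix_coeff (T x) \<alpha> \<beta>) < \<epsilon>" for x
      using close[of S x \<alpha> \<beta>] S(2)[of x] \<open>0 < \<epsilon>\<close> by linarith
    then show "\<exists>g. continuous_on UNIV g \<and> (\<forall>x. dist (g x) (matrix_coeff (T x) \<alpha> \<beta>) < \<epsilon>)"
      using S(1) by (intro exI[of _ "\<lambda>x. matrix_coeff (S x) \<alpha> \<beta>"]) (simp add: E)
  qed
qed (rule lin)

text \<open>Each property of the length has its place: the triangle inequality and the finiteness of
  balls give quasi-locality and weak continuity of products, and symmetry gives quasi-locality of
  adjoints.\<close>

lemma cstar_subalgebra_equivariant_quasi_local_families:
  assumes "proper_length_function len"
  shows "cstar_subalgebra (equivariant_quasi_local_families act len) (product_algebra bounded_ops)"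
proof -
  let ?E = "equivariant_quasi_local_families act len"
  note E = equivariant_quasi_local_families_iff
  have len: "\<And>\<gamma>. len (- \<gamma>) = len \<gamma>" "\<And>\<alpha> \<beta>. len (\<alpha> + \<beta>) \<le> len \<alpha> + len \<beta>"
    "\<And>r. finite {\<gamma>. len \<gamma> \<le> r}"
    using assms unfolding proper_length_function_def by auto
  have bdd: "\<exists>C. \<forall>x. norm (T x) \<le> C" if "T \<in> ?E" for T using that by (simp add: E)
  have add: "(\<lambda>x. S x + T x) \<in> ?E" if "S \<in> ?E" "T \<in> ?E" for S T
  proof -
    obtain C D where "\<And>x. norm (S x) \<le> C" "\<And>x. norm (T x) \<le> D"
      using bdd[OF \<open>S \<in> ?E\<close>] bdd[OF \<open>T \<in> ?E\<close>] by blast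
    then have "\<exists>C. \<forall>x. norm (S x + T x) \<le> C"
      by (intro exI[of _ "C + D"] allI norm_triangle_mono)
    then show ?thesis
      using that unfolding E
      by (auto simp: matrix_coeff_add intro!: clinear_op_add quasi_local_add continuous_intros)
  qed
  have scale: "(\<lambda>x. mult_op (\<lambda>_. c) o\<^sub>L T x) \<in> ?E" if "T \<in> ?E" for c T
  proof -
    obtain C where "\<And>x. norm (T x) \<le> C" using bdd[OF \<open>T \<in> ?E\<close>] by blast
    then have "\<exists>C. \<forall>x. norm (mult_op (\<lambda>_. c) o\<^sub>L T x) \<le> C"
      by (intro exI[of _ "cmod c * C"]) (simp add: mult_left_mono)
    then show ?thesis
      using that unfolding E
      by (auto simp: matrix_coeff_scale
          intro!: clinear_op_compose clinear_op_mult_op quasi_local_scale continuous_intros)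
  qed
  have compose: "(\<lambda>x. S x o\<^sub>L T x) \<in> ?E" if S: "S \<in> ?E" and T: "T \<in> ?E" for S T
  proof -
    obtain C D where CD: "\<And>x. norm (S x) \<le> C" "\<And>x. norm (T x) \<le> D"
      using bdd[OF \<open>S \<in> ?E\<close>] bdd[OF \<open>T \<in> ?E\<close>] by blast
    have lin: "\<And>x. clinear_op (S x)" "\<And>x. clinear_op (T x)" using that by (auto simp: E)
    have ql: "quasi_local len S" "quasi_local len T" using that by (auto simp: E)
    have eq: "matrix_coeff (S (act \<gamma> x)) \<alpha> \<beta> = matrix_coeff (S x) (\<alpha> + \<gamma>) (\<beta> + \<gamma>)"
      "matrix_coeff (T (act \<gamma> x)) \<alpha> \<beta> = matrix_coeff (T x) (\<alpha> + \<gamma>) (\<beta> + \<gamma>)" for x \<alpha> \<beta> \<gamma>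
      using that by (auto simp: E)
    have "norm (S x o\<^sub>L T x) \<le> C * D" for x
      by (rule order_trans[OF norm_blinfun_compose mult_mono[OF CD]])
        (use CD[of x] norm_ge_zero order_trans in blast)+
    moreover have "quasi_local len (\<lambda>x. S x o\<^sub>L T x)"
      by (rule quasi_local_compose[OF ql, of "max C D"]) (use CD len in \<open>auto simp: le_max_iff_disj\<close>)
    moreover have "continuous_on UNIV (\<lambda>x. matrix_coeff (S x o\<^sub>L T x) \<alpha> \<beta>)" for \<alpha> \<beta>
      by (rule continuous_matrix_coeff_compose[OF lin(1) CD(1) ql(2) len(3)]) (use that in \<open>auto simp: E\<close>)
    moreover have "matrix_coeff (S (act \<gamma> x) o\<^sub>L T (act \<gamma> x)) \<alpha> \<beta> = matrix_coeff (S x o\<^sub>L T x) (\<alpha> + \<gamma>) (\<beta> + \<gamma>)"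
      for x \<alpha> \<beta> \<gamma>
    proof (rule has_sum_unique[OF has_sum_matrix_coeff_compose[OF lin(1)]])
      \<comment> \<open>Right translation of the summation index carries the matrix product over act
        \<gamma> x into the one over x.\<close>
      have bij: "bij (\<lambda>\<delta>. \<delta> + \<gamma>)"
        by (rule bij_betw_byWitness[of _ "\<lambda>\<delta>. \<delta> - \<gamma>"]) auto
      show "((\<lambda>\<delta>. matrix_coeff (S (act \<gamma> x)) \<alpha> \<delta> * matrix_coeff (T (act \<gamma> x)) \<delta> \<beta>) has_sum
          matrix_coeff (S x o\<^sub>L T x) (\<alpha> + \<gamma>) (\<beta> + \<gamma>)) UNIV"
        unfolding eq has_sum_reindex_bij_betw[OF bij, of "\<lambda>\<delta>. matrix_coeff (S x) (\<alpha> + \<gamma>) \<delta> * matrix_coeff (T x) \<delta> (\<beta> + \<gamma>)"]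
        by (rule has_sum_matrix_coeff_compose[OF lin(1)])
    qed
    ultimately show ?thesis
      using lin unfolding E by (auto intro!: clinear_op_compose)
  qed
  have star: "(\<lambda>x. adjoint_op (T x)) \<in> ?E" if "T \<in> ?E" for T
  proof -
    have lin: "\<And>x. clinear_op (T x)" using that by (auto simp: E)
    obtain C where "\<And>x. norm (T x) \<le> C" using bdd[OF \<open>T \<in> ?E\<close>] by blast
    then have "\<exists>C. \<forall>x. norm (adjoint_op (T x)) \<le> C"
      by (intro exI[of _ C] allI order_trans[OF norm_adjoint_le[OF lin]])
    then show ?thesis
      using that lin unfolding E
      by (auto simp: matrix_coeff_adjoint intro!: clinear_op_adjoint quasi_local_adjoint len continuous_intros)
  qed
  have zero: "(\<lambda>x. 0) \<in> ?E"
  proof -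
    have "quasi_local len (\<lambda>_. 0)" by (auto simp: quasi_local_def)
    moreover have "matrix_coeff 0 \<alpha> \<beta> = 0" for \<alpha> \<beta> :: 'a
      by (simp add: matrix_coeff_def[of 0])
    ultimately show ?thesis by (auto simp: E clinear_op_zero intro: exI[of _ 0])
  qed
  have limit: "T \<in> ?E"
    if S: "\<And>n. S n \<in> ?E" and T: "\<And>x. clinear_op (T x)" "bdd_above (range (\<lambda>x. norm (T x)))"
      and lim: "(\<lambda>n. SUP x. norm (S n x + (mult_op (\<lambda>_. - 1) o\<^sub>L T x))) \<longlonglongrightarrow> 0" for S :: "nat \<Rightarrow> _" and T
  proof (rule equivariant_quasi_local_families_limit[OF T(1)])
    fix \<epsilon> :: real assume "0 < \<epsilon>"
    then obtain n where n: "norm (SUP x. norm (S n x + (mult_op (\<lambda>_. - 1) o\<^sub>L T x))) < \<epsilon>"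
      using LIMSEQ_D[OF lim, of \<epsilon>] by auto
    obtain C D where CD: "\<And>x. norm (S n x) \<le> C" "\<And>x. norm (T x) \<le> D"
      using bdd[OF S[of n]] T(2) unfolding bdd_above_def by blast
    have "norm (S n x - T x) \<le> \<epsilon>" for x
    proof -
      have "norm (S n x + (mult_op (\<lambda>_. - 1) o\<^sub>L T x)) \<le> (SUP x. norm (S n x + (mult_op (\<lambda>_. - 1) o\<^sub>L T x)))"
      proof (rule cSUP_upper)
        show "bdd_above (range (\<lambda>x. norm (S n x + (mult_op (\<lambda>_. - 1) o\<^sub>L T x))))"
          using CD
          by (intro bdd_aboveI[of _ "C + D"]) (auto intro: order_trans[OF norm_triangle_ineq4 add_mono])
      qed simp
      then show ?thesis using n by simp
    qed
    then show "\<exists>S\<in>?E. \<forall>x. norm (S x - T x) \<le> \<epsilon>" using S by blast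
  qed
  show ?thesis
    unfolding cstar_subalgebra_def
  proof (intro conjI ballI allI impI)
    show "?E \<subseteq> carrier (product_algebra bounded_ops)"
      by (auto simp: equivariant_quasi_local_families_def)
    show "?E \<noteq> {}" using zero by auto
  qed (use limit in \<open>auto simp: product_algebra_def bounded_ops_def intro: add compose scale star\<close>)
qed

section \<open>Direct sums over X: restriction to fibres, norms, reconstruction, and algebra
  operations\<close>

section \<open>Decomposition over the fibres\<close>

text \<open>Operators are built here from prescribed coordinates; the bound on finite square sums
  yields both square summability and the norm bound.\<close>

lemma exists_bounded_linear_coeff:
  fixes f :: "'i ell2 \<Rightarrow> 'j \<Rightarrow> complex"
  assumes "\<And>\<xi> \<eta> j. f (\<xi> + \<eta>) j = f \<xi> j + f \<eta> j" "\<And>r \<xi> j. f (r *\<^sub>R \<xi>) j = r *\<^sub>R f \<xi> j" "0 \<le> C"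
    and "\<And>\<xi> F. finite F \<Longrightarrow> (\<Sum>j\<in>F. (cmod (f \<xi> j))\<^sup>2) \<le> (C * norm \<xi>)\<^sup>2"
  shows "\<exists>T :: 'i ell2 \<Rightarrow>\<^sub>L 'j ell2.
    (\<forall>\<xi> j. ell2_coeff (blinfun_apply T \<xi>) j = f \<xi> j) \<and> norm T \<le> C"
proof -
  define g where "g \<xi> = Abs_ell2 (f \<xi>)" for \<xi>
  have g: "ell2_coeff (g \<xi>) j = f \<xi> j" for \<xi> j
    unfolding g_def by (subst Abs_ell2_inverse) (auto intro: square_summableI[OF assms(4)])
  have bound: "norm (g \<xi>) \<le> C * norm \<xi>" for \<xi>
    by (rule norm_ell2_le) (auto simp: g assms)
  have "bounded_linear g"
    by (rule bounded_linear_intro[where K = C])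
      (auto intro!: ell2_eqI simp: g assms(1,2) bound mult.commute[of _ C])
  then have "blinfun_apply (Blinfun g) = g" by (rule bounded_linear_Blinfun_apply)
  then show ?thesis
    using g bound \<open>0 \<le> C\<close> by (intro exI[of _ "Blinfun g"]) (auto intro: norm_blinfun_bound)
qed

text \<open>The coordinates determine the operator, so the choice is harmless. The adjoint of this
  restriction is \<open>embed_op\<close>.\<close>

definition slice_op :: "'x \<Rightarrow> ('g \<times> 'x) ell2 \<Rightarrow>\<^sub>L 'g ell2" where
  "slice_op x = (SOME T. (\<forall>\<xi> \<gamma>. ell2_coeff (blinfun_apply T \<xi>) \<gamma> = ell2_coeff \<xi> (\<gamma>, x)) \<and> norm T \<le> 1)"

definition embed_op :: "'x \<Rightarrow> 'g ell2 \<Rightarrow>\<^sub>L ('g \<times> 'x) ell2" where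
  "embed_op x = (SOME T. (\<forall>\<xi> i. ell2_coeff (blinfun_apply T \<xi>) i = (if snd i = x then ell2_coeff \<xi> (fst i) else 0)) \<and> norm T \<le> 1)"

lemma
  fixes \<xi> :: "('g \<times> 'x) ell2"
  shows ell2_coeff_slice_op [simp]: "ell2_coeff (slice_op x \<xi>) \<gamma> = ell2_coeff \<xi> (\<gamma>, x)"
    and norm_slice_op_le: "norm (slice_op x :: ('g \<times> 'x) ell2 \<Rightarrow>\<^sub>L 'g ell2) \<le> 1"
proof -
  have "\<exists>T :: ('g \<times> 'x) ell2 \<Rightarrow>\<^sub>L 'g ell2. (\<forall>\<xi> \<gamma>. ell2_coeff (blinfun_apply T \<xi>) \<gamma> = ell2_coeff \<xi> (\<gamma>, x)) \<and> norm T \<le> 1"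
  proof (rule exists_bounded_linear_coeff)
    fix \<xi> :: "('g \<times> 'x) ell2" and F :: "'g set" assume "finite F"
    have "(\<Sum>\<gamma>\<in>F. (cmod (ell2_coeff \<xi> (\<gamma>, x)))\<^sup>2) = (\<Sum>i\<in>(\<lambda>\<gamma>. (\<gamma>, x)) ` F. (cmod (ell2_coeff \<xi> i))\<^sup>2)"
      by (subst sum.reindex) (auto simp: inj_on_def)
    also have "\<dots> \<le> (1 * norm \<xi>)\<^sup>2" by (simp add: sum_ell2_coeff_le \<open>finite F\<close>)
    finally show "(\<Sum>\<gamma>\<in>F. (cmod (ell2_coeff \<xi> (\<gamma>, x)))\<^sup>2) \<le> (1 * norm \<xi>)\<^sup>2" .
  qed auto
  from someI_ex[OF this, folded slice_op_def]
  show "ell2_coeff (slice_op x \<xi>) \<gamma> = ell2_coeff \<xi> (\<gamma>, x)"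
    "norm (slice_op x :: ('g \<times> 'x) ell2 \<Rightarrow>\<^sub>L 'g ell2) \<le> 1" by auto
qed

lemma
  fixes \<xi> :: "'g ell2"
  shows ell2_coeff_embed_op [simp]: "ell2_coeff (embed_op x \<xi>) (\<gamma>, y) = (if y = x then ell2_coeff \<xi> \<gamma> else 0)"
    and norm_embed_op_le: "norm (embed_op x :: 'g ell2 \<Rightarrow>\<^sub>L ('g \<times> 'x) ell2) \<le> 1"
proof -
  have "\<exists>T :: 'g ell2 \<Rightarrow>\<^sub>L ('g \<times> 'x) ell2.
      (\<forall>\<xi> i. ell2_coeff (blinfun_apply T \<xi>) i = (if snd i = x then ell2_coeff \<xi> (fst i) else 0)) \<and> norm T \<le> 1" for x
  proof (rule exists_bounded_linear_coeff)
    fix \<xi> :: "'g ell2" and F :: "('g \<times> 'x) set" assume "finite F"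
    have "(\<Sum>i\<in>F. (cmod (if snd i = x then ell2_coeff \<xi> (fst i) else 0))\<^sup>2) =
        (\<Sum>i\<in>{i\<in>F. snd i = x}. (cmod (ell2_coeff \<xi> (fst i)))\<^sup>2)"
      using \<open>finite F\<close> by (intro sum.mono_neutral_cong_right) auto
    also have "\<dots> = (\<Sum>\<gamma>\<in>fst ` {i\<in>F. snd i = x}. (cmod (ell2_coeff \<xi> \<gamma>))\<^sup>2)"
      by (subst sum.reindex) (auto simp: inj_on_def)
    also have "\<dots> \<le> (1 * norm \<xi>)\<^sup>2" by (simp add: sum_ell2_coeff_le \<open>finite F\<close>)
    finally show "(\<Sum>i\<in>F. (cmod (if snd i = x then ell2_coeff \<xi> (fst i) else 0))\<^sup>2) \<le> (1 * norm \<xi>)\<^sup>2" .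
  qed auto
  from someI_ex[OF this, folded embed_op_def]
  show "ell2_coeff (embed_op x \<xi>) (\<gamma>, y) = (if y = x then ell2_coeff \<xi> \<gamma> else 0)"
    "norm (embed_op x :: 'g ell2 \<Rightarrow>\<^sub>L ('g \<times> 'x) ell2) \<le> 1" by auto
qed

lemma slice_op_embed_op [simp]: "slice_op x (embed_op x \<xi>) = \<xi>"
  by (rule ell2_eqI) simp

lemma slice_op_scaleC: "slice_op x (scaleC_ell2 c \<xi>) = scaleC_ell2 c (slice_op x \<xi>)"
  by (rule ell2_eqI) simp

lemma embed_op_scaleC: "embed_op x (scaleC_ell2 c \<xi>) = scaleC_ell2 c (embed_op x \<xi>)"
  by (rule ell2_eqI) (auto simp: split_paired_all)

lemma cinner_slice_op: "cinner (slice_op x \<xi>) \<eta> = cinner \<xi> (embed_op x \<eta>)"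
proof -
  have "cinner (slice_op x \<xi>) \<eta> = infsum ((\<lambda>i. cnj (ell2_coeff \<xi> i) * ell2_coeff (embed_op x \<eta>) i) \<circ> (\<lambda>\<gamma>. (\<gamma>, x))) UNIV"
    unfolding cinner_def by (intro infsum_cong) simp
  also have "\<dots> = infsum (\<lambda>i. cnj (ell2_coeff \<xi> i) * ell2_coeff (embed_op x \<eta>) i) (range (\<lambda>\<gamma>. (\<gamma>, x)))"
    by (rule infsum_reindex[symmetric]) (auto simp: inj_on_def)
  also have "\<dots> = cinner \<xi> (embed_op x \<eta>)"
    unfolding cinner_def by (rule infsum_cong_neutral) (auto simp: image_iff)
  finally show ?thesis .
qed

lemma sum_norm_slice_op_le:
  fixes \<xi> :: "('g \<times> 'x) ell2"
  assumes "finite X"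
  shows "(\<Sum>x\<in>X. (norm (slice_op x \<xi>))\<^sup>2) \<le> (norm \<xi>)\<^sup>2"
proof -
  let ?f = "\<lambda>i. (cmod (ell2_coeff \<xi> i))\<^sup>2"
  have inj: "inj_on prod.swap (X \<times> (UNIV :: 'g set))" by (auto simp: inj_on_def)
  have "(?f \<circ> prod.swap) summable_on (X \<times> UNIV)"
    using summable_on_reindex[OF inj, of ?f] summable_ell2_coeff by blast
  from infsum_Sigma_banach[OF this]
  have "(\<Sum>x\<in>X. (norm (slice_op x \<xi>))\<^sup>2) = infsum (?f \<circ> prod.swap) (X \<times> UNIV)"
    using assms by (simp add: norm_ell2_sq)
  also have "\<dots> = infsum ?f (prod.swap ` (X \<times> UNIV))"
    by (rule infsum_reindex[OF inj, symmetric])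
  also have "\<dots> \<le> infsum ?f UNIV"
    by (rule infsum_mono2) (auto intro: summable_ell2_coeff)
  finally show ?thesis by (simp add: norm_ell2_sq)
qed

text \<open>Distinct fibres are orthogonal, so a bound uniform over the fibres is a bound for the
  whole vector. It gives the norm of a direct sum as well as its existence.\<close>

lemma sum_fibrewise_le:
  fixes \<xi> :: "('g \<times> 'x) ell2" and \<eta> :: "'x \<Rightarrow> 'g ell2"
  assumes "finite G" "0 \<le> C" and le: "\<And>x. norm (\<eta> x) \<le> C * norm (slice_op x \<xi>)"
  shows "(\<Sum>i\<in>G. (cmod (ell2_coeff (\<eta> (snd i)) (fst i)))\<^sup>2) \<le> (C * norm \<xi>)\<^sup>2"
proof -
  have "(\<Sum>i\<in>G. (cmod (ell2_coeff (\<eta> (snd i)) (fst i)))\<^sup>2) \<le>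
      (\<Sum>i\<in>fst ` G \<times> snd ` G. (cmod (ell2_coeff (\<eta> (snd i)) (fst i)))\<^sup>2)"
    using \<open>finite G\<close> by (intro sum_mono2) (auto simp: rev_image_eqI)
  also have "\<dots> = (\<Sum>x\<in>snd ` G. \<Sum>\<gamma>\<in>fst ` G. (cmod (ell2_coeff (\<eta> x) \<gamma>))\<^sup>2)"
    by (subst sum.swap) (simp add: sum.cartesian_product case_prod_unfold)
  also have "\<dots> \<le> (\<Sum>x\<in>snd ` G. C\<^sup>2 * (norm (slice_op x \<xi>))\<^sup>2)"
  proof (rule sum_mono)
    fix x
    have "(\<Sum>\<gamma>\<in>fst ` G. (cmod (ell2_coeff (\<eta> x) \<gamma>))\<^sup>2) \<le> (norm (\<eta> x))\<^sup>2"
      using \<open>finite G\<close> by (intro sum_ell2_coeff_le) auto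
    also have "\<dots> \<le> (C * norm (slice_op x \<xi>))\<^sup>2" by (rule power_mono[OF le]) simp
    finally show "(\<Sum>\<gamma>\<in>fst ` G. (cmod (ell2_coeff (\<eta> x) \<gamma>))\<^sup>2) \<le> C\<^sup>2 * (norm (slice_op x \<xi>))\<^sup>2"
      by (simp add: power_mult_distrib)
  qed
  also have "\<dots> \<le> C\<^sup>2 * (norm \<xi>)\<^sup>2"
    unfolding sum_distrib_left[symmetric] using \<open>finite G\<close>
    by (intro mult_left_mono sum_norm_slice_op_le) auto
  finally show ?thesis by (simp add: power_mult_distrib)
qed

definition fibre :: "('g \<times> 'x) op \<Rightarrow> 'x \<Rightarrow> 'g op" where
  "fibre a x = slice_op x o\<^sub>L a o\<^sub>L embed_op x"

text \<open>The fibre over x of the image depends only on the fibre over x of the vector: a is the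
  direct sum of its compressions \<open>fibre a x\<close>.\<close>

definition decomposable :: "('g \<times> 'x) op \<Rightarrow> bool" where
  "decomposable a \<longleftrightarrow> (\<forall>x \<xi>. slice_op x (a \<xi>) = fibre a x (slice_op x \<xi>))"

lemma fibre_apply [simp]: "fibre a x \<xi> = slice_op x (a (embed_op x \<xi>))"
  by (simp add: fibre_def)

lemma decomposableD: "decomposable a \<Longrightarrow> slice_op x (a (embed_op x (slice_op x \<xi>))) = slice_op x (a \<xi>)"
  by (simp add: decomposable_def)

lemma fibre_diff: "fibre (a - b) x = fibre a x - fibre b x"
  by (rule blinfun_eqI) (simp add: blinfun.diff_left blinfun.diff_right)

lemma norm_fibre_le: "norm (fibre a x) \<le> norm a"
  unfolding fibre_def
  by (rule order_trans[OF norm_compose3_le[OF norm_slice_op_le order_refl norm_embed_op_le]]) auto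

lemma clinear_op_fibre: "clinear_op a \<Longrightarrow> clinear_op (fibre a x)"
  by (simp add: clinear_op_def slice_op_scaleC embed_op_scaleC)

lemma decomposable_diff: "decomposable a \<Longrightarrow> decomposable b \<Longrightarrow> decomposable (a - b)"
  by (simp add: decomposable_def blinfun.diff_left blinfun.diff_right)

text \<open>With this, closeness of fibres uniformly over X is closeness in norm, and a decomposable
  operator is determined by its fibres.\<close>

lemma norm_decomposable_le:
  assumes "decomposable a" "0 \<le> C" "\<And>x. norm (fibre a x) \<le> C"
  shows "norm a \<le> C"
proof (rule norm_blinfun_bound[OF assms(2)], rule norm_ell2_le)
  fix \<xi> F assume "finite (F :: ('a \<times> 'b) set)"
  have "norm (slice_op x (a \<xi>)) \<le> C * norm (slice_op x \<xi>)" for x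
  proof -
    have "norm (fibre a x (slice_op x \<xi>)) \<le> C * norm (slice_op x \<xi>)"
      by (rule order_trans[OF norm_blinfun mult_right_mono[OF assms(3)]]) simp
    then show ?thesis using decomposableD[OF assms(1)] by simp
  qed
  from sum_fibrewise_le[OF \<open>finite F\<close> assms(2) this]
  show "(\<Sum>i\<in>F. (cmod (ell2_coeff (a \<xi>) i))\<^sup>2) \<le> (C * norm \<xi>)\<^sup>2" by simp
qed (use assms(2) in simp)

lemma decomposable_eqI:
  assumes "decomposable a" "decomposable b" "\<And>x. fibre a x = fibre b x"
  shows "a = b"
  using norm_decomposable_le[OF decomposable_diff[OF assms(1,2)], of 0] assms(3)
  by (simp add: fibre_diff)

lemma exists_decomposable:
  fixes T :: "'x \<Rightarrow> 'g op"
  assumes "\<And>x. norm (T x) \<le> C"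
  shows "\<exists>a. decomposable a \<and> (\<forall>x. fibre a x = T x)"
proof -
  have "0 \<le> C" using assms norm_ge_zero order_trans by blast
  have "\<exists>a :: ('g \<times> 'x) op. (\<forall>\<xi> i. ell2_coeff (blinfun_apply a \<xi>) i = ell2_coeff (T (snd i) (slice_op (snd i) \<xi>)) (fst i)) \<and> norm a \<le> C"
  proof (rule exists_bounded_linear_coeff)
    show "(\<Sum>i\<in>F. (cmod (ell2_coeff (T (snd i) (slice_op (snd i) \<xi>)) (fst i)))\<^sup>2) \<le> (C * norm \<xi>)\<^sup>2"
      if "finite F" for F \<xi>
      by (rule sum_fibrewise_le[OF that \<open>0 \<le> C\<close>])
        (rule order_trans[OF norm_blinfun mult_right_mono[OF assms]], simp)
  qed (auto simp: blinfun.add_right blinfun.scaleR_right \<open>0 \<le> C\<close>)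
  then obtain a where a: "\<And>\<xi> \<gamma> x. ell2_coeff (blinfun_apply a \<xi>) (\<gamma>, x) = ell2_coeff (T x (slice_op x \<xi>)) \<gamma>"
    by auto
  have s: "slice_op x (a \<xi>) = T x (slice_op x \<xi>)" for x \<xi>
    by (rule ell2_eqI) (simp add: a)
  show ?thesis
    by (intro exI[of _ a]) (auto simp: decomposable_def s intro: blinfun_eqI)
qed

lemma fibre_compose: "decomposable a \<Longrightarrow> fibre (a o\<^sub>L b) x = fibre a x o\<^sub>L fibre b x"
  by (rule blinfun_eqI) (simp add: decomposableD)

lemma fibre_adjoint:
  assumes "clinear_op a" shows "fibre (adjoint_op a) x = adjoint_op (fibre a x)"
proof (rule adjoint_op_eqI[symmetric])
  show "clinear_op (fibre (adjoint_op a) x)"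
    by (intro clinear_op_fibre clinear_op_adjoint assms)
  show "cinner (fibre (adjoint_op a) x \<xi>) \<eta> = cinner \<xi> (fibre a x \<eta>)" for \<xi> \<eta>
    by (simp add: cinner_slice_op cinner_adjoint_left[OF assms]) (metis cinner_slice_op cnj_cinner)
qed

section \<open>Almost invariant maps with a common finite support\<close>

section \<open>Amenable actions\<close>

lemma sum_pmf_le_1: "finite K \<Longrightarrow> (\<Sum>g\<in>K. pmf p g) \<le> 1"
  by (metis measure_measure_pmf_finite measure_pmf.prob_le_1)

lemma exists_finite_pmf_mass:
  assumes "0 < \<epsilon>"
  shows "\<exists>K. finite K \<and> 1 - \<epsilon> < (\<Sum>g\<in>K. pmf p g)"
proof -
  have "(pmf p has_sum 1) UNIV"
  proof -
    have "(\<lambda>g. norm (pmf p g)) summable_on UNIV"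
      using pmf_abs_summable[of p UNIV] abs_summable_equivalent by blast
    then have "pmf p summable_on UNIV" by simp
    moreover have "infsum (pmf p) UNIV = 1"
      using infsetsum_pmf_eq_1[of p UNIV] infsetsum_infsum[OF pmf_abs_summable[of p UNIV]] by simp
    ultimately show ?thesis by (metis has_sum_infsum)
  qed
  then obtain K where "finite K" "dist (\<Sum>g\<in>K. pmf p g) 1 < \<epsilon>"
    using has_sum_finite_approximation[of "pmf p" UNIV 1 "\<epsilon> / 2"] assms by fastforce
  then show ?thesis by (auto simp: dist_real_def)
qed

text \<open>The bound by 2 makes the suprema in \<open>amenable_action\<close> suprema of bounded
  sets, so that they dominate every single point of X.\<close>

lemma l1_dist_ge_sum:
  assumes "finite G" shows "(\<Sum>\<alpha>\<in>G. \<bar>pmf \<mu> \<alpha> - pmf \<nu> \<alpha>\<bar>) \<le> l1_dist \<mu> \<nu>"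
    and "l1_dist \<mu> \<nu> \<le> 2"
proof -
  have fin: "(\<Sum>\<alpha>\<in>F. \<bar>pmf \<mu> \<alpha> - pmf \<nu> \<alpha>\<bar>) \<le> 2" if "finite F" for F
  proof -
    have "(\<Sum>\<alpha>\<in>F. \<bar>pmf \<mu> \<alpha> - pmf \<nu> \<alpha>\<bar>) \<le> (\<Sum>\<alpha>\<in>F. pmf \<mu> \<alpha> + pmf \<nu> \<alpha>)"
      by (intro sum_mono) (simp add: abs_le_iff)
    then show ?thesis
      using sum_pmf_le_1[OF that, of \<mu>] sum_pmf_le_1[OF that, of \<nu>] by (simp add: sum.distrib)
  qed
  then have s: "(\<lambda>\<alpha>. \<bar>pmf \<mu> \<alpha> - pmf \<nu> \<alpha>\<bar>) summable_on UNIV"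
    by (intro nonneg_bdd_above_summable_on) (auto intro!: bdd_aboveI[of _ 2])
  show "(\<Sum>\<alpha>\<in>G. \<bar>pmf \<mu> \<alpha> - pmf \<nu> \<alpha>\<bar>) \<le> l1_dist \<mu> \<nu>"
    unfolding l1_dist_def by (rule finite_sum_le_infsum[OF s assms]) auto
  show "l1_dist \<mu> \<nu> \<le> 2"
    unfolding l1_dist_def by (rule infsum_le_finite_sums[OF s]) (auto intro: fin)
qed

text \<open>Carrying more than 1 - \<epsilon> of the mass on a fixed finite set is an open condition
  on x, so compactness leaves finitely many such sets, whose union works everywhere.\<close>

lemma exists_uniform_finite_mass:
  fixes m :: "'x::topological_space \<Rightarrow> 'g pmf"
  assumes "compact (UNIV :: 'x set)" "\<And>g. continuous_on UNIV (\<lambda>x. pmf (m x) g)" "0 < \<epsilon>"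
  shows "\<exists>K. finite K \<and> (\<forall>x. 1 - \<epsilon> < (\<Sum>g\<in>K. pmf (m x) g))"
proof -
  have "\<forall>x. \<exists>K. finite K \<and> 1 - \<epsilon> < (\<Sum>g\<in>K. pmf (m x) g)"
    using exists_finite_pmf_mass[OF assms(3)] by blast
  then obtain K where K: "\<And>x. finite (K x)" "\<And>x. 1 - \<epsilon> < (\<Sum>g\<in>K x. pmf (m x) g)" by metis
  define U where "U x = {y. 1 - \<epsilon> < (\<Sum>g\<in>K x. pmf (m y) g)}" for x
  have "open (U x)" for x
    unfolding U_def by (intro open_Collect_less continuous_intros assms)
  moreover have "UNIV \<subseteq> (\<Union>x\<in>UNIV. U x)" using K(2) by (auto simp: U_def)
  ultimately obtain X where X: "finite X" "UNIV \<subseteq> (\<Union>x\<in>X. U x)"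
    using compactE_image[OF assms(1), of UNIV U] by metis
  show ?thesis
  proof (intro exI[of _ "\<Union>x\<in>X. K x"] conjI allI)
    show fin: "finite (\<Union>x\<in>X. K x)" using X K by auto
    fix y
    obtain x where "x \<in> X" "y \<in> U x" using X(2) by auto
    then have "1 - \<epsilon> < (\<Sum>g\<in>K x. pmf (m y) g)" by (simp add: U_def)
    also have "\<dots> \<le> (\<Sum>g\<in>(\<Union>x\<in>X. K x). pmf (m y) g)"
      using \<open>x \<in> X\<close> fin by (intro sum_mono2) auto
    finally show "1 - \<epsilon> < (\<Sum>g\<in>(\<Union>x\<in>X. K x). pmf (m y) g)" .
  qed
qed

lemma amenable_action_finite_support:
  fixes act :: "'g::group_add \<Rightarrow> 'x::topological_space \<Rightarrow> 'x"
  assumes "compact (UNIV :: 'x set)" "amenable_action act" "0 < \<epsilon>" "finite F"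
  obtains K and q :: "'x \<Rightarrow> 'g \<Rightarrow> real" where
    "finite K" "\<And>x g. 0 \<le> q x g" "\<And>x g. g \<notin> K \<Longrightarrow> q x g = 0" "\<And>x. (\<Sum>g\<in>K. q x g) = 1"
    "\<And>g. continuous_on UNIV (\<lambda>x. q x g)"
    "\<And>\<gamma> x G. \<gamma> \<in> F \<Longrightarrow> finite G \<Longrightarrow> (\<Sum>g\<in>G. \<bar>q (act \<gamma> x) (\<gamma> + g) - q x g\<bar>) \<le> \<epsilon>"
proof -
  \<comment> \<open>Five parts: 2 * e for truncating at act \<gamma> x, e for the almost invariance
    of m, and 2 * e for truncating at x. The bound 1 / 2 keeps the truncated mass positive.\<close>
  define e where "e = min (\<epsilon> / 5) (1 / 2)"
  have e: "0 < e" "5 * e \<le> \<epsilon>" "e < 1" using assms(3) by (auto simp: e_def min_def)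
  from assms(2) e(1) \<open>finite F\<close> obtain m :: "'x \<Rightarrow> 'g pmf" where
    m: "\<And>\<alpha>. continuous_on UNIV (\<lambda>x. pmf (m x) \<alpha>)"
      "\<And>\<gamma>. \<gamma> \<in> F \<Longrightarrow> (SUP x. l1_dist (m (act \<gamma> x)) (map_pmf ((+) \<gamma>) (m x))) < e"
    unfolding amenable_action_def by metis
  obtain K where K: "finite K" "\<And>x. 1 - e < (\<Sum>g\<in>K. pmf (m x) g)"
    using exists_uniform_finite_mass[OF assms(1) m(1) e(1)] by blast
  define Z where "Z x = (\<Sum>g\<in>K. pmf (m x) g)" for x
  have Z: "1 - e < Z x" "0 < Z x" "Z x \<le> 1" for x
    using K(2)[of x] e sum_pmf_le_1[OF K(1), of "m x"] by (auto simp: Z_def)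
  define q where "q x g = (if g \<in> K then pmf (m x) g / Z x else 0)" for x g
  \<comment> \<open>Rescaling on K adds 1 - Z x, and the mass cut off outside K is at most 1 - Z
    x.\<close>
  have close: "(\<Sum>g\<in>G. \<bar>q x g - pmf (m x) g\<bar>) \<le> 2 * e" if "finite G" for G x
  proof -
    have "(\<Sum>g\<in>G. \<bar>q x g - pmf (m x) g\<bar>) \<le> (\<Sum>g\<in>G \<union> K. \<bar>q x g - pmf (m x) g\<bar>)"
      using that K(1) by (intro sum_mono2) auto
    also have "\<dots> = (\<Sum>g\<in>K. \<bar>q x g - pmf (m x) g\<bar>) + (\<Sum>g\<in>G - K. \<bar>q x g - pmf (m x) g\<bar>)"
      using sum.union_disjoint[of K "G - K" "\<lambda>g. \<bar>q x g - pmf (m x) g\<bar>"] that K(1)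
      by (simp add: Un_commute)
    also have "(\<Sum>g\<in>K. \<bar>q x g - pmf (m x) g\<bar>) = (\<Sum>g\<in>K. pmf (m x) g * (1 / Z x - 1))"
    proof (rule sum.cong[OF refl])
      fix g assume "g \<in> K"
      have "pmf (m x) g \<le> pmf (m x) g / Z x"
        using Z[of x] by (simp add: le_divide_eq_1 pos_le_divide_eq mult_left_le)
      then show "\<bar>q x g - pmf (m x) g\<bar> = pmf (m x) g * (1 / Z x - 1)"
        using \<open>g \<in> K\<close> by (simp add: q_def algebra_simps)
    qed
    also have "\<dots> = 1 - Z x"
      unfolding sum_distrib_right[symmetric] Z_def[symmetric] using Z(2)[of x] by (simp add: field_simps)
    also have "(\<Sum>g\<in>G - K. \<bar>q x g - pmf (m x) g\<bar>) = (\<Sum>g\<in>G - K. pmf (m x) g)"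
      by (intro sum.cong) (auto simp: q_def)
    also have "\<dots> = (\<Sum>g\<in>G \<union> K. pmf (m x) g) - Z x"
      using sum.union_disjoint[of K "G - K" "pmf (m x)"] that K(1)
      by (simp add: Un_commute Z_def)
    also have "(\<Sum>g\<in>G \<union> K. pmf (m x) g) \<le> 1"
      using that K(1) by (intro sum_pmf_le_1) auto
    finally show ?thesis using Z(1)[of x] by linarith
  qed
  have almost_invariant: "(\<Sum>g\<in>G. \<bar>q (act \<gamma> x) (\<gamma> + g) - q x g\<bar>) \<le> \<epsilon>" if \<gamma>: "\<gamma> \<in> F" and G: "finite G" for \<gamma> x G
  proof -
    have inj: "inj ((+) \<gamma>)" by (simp add: inj_on_def)
    let ?G = "(+) \<gamma> ` G"
    have "(\<Sum>g\<in>G. \<bar>q (act \<gamma> x) (\<gamma> + g) - pmf (m (act \<gamma> x)) (\<gamma> + g)\<bar>) =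
        (\<Sum>h\<in>?G. \<bar>q (act \<gamma> x) h - pmf (m (act \<gamma> x)) h\<bar>)"
      by (subst sum.reindex) (auto intro: inj_on_subset[OF inj])
    also have "\<dots> \<le> 2 * e" using G by (intro close) auto
    finally have 1: "(\<Sum>g\<in>G. \<bar>q (act \<gamma> x) (\<gamma> + g) - pmf (m (act \<gamma> x)) (\<gamma> + g)\<bar>) \<le> 2 * e" .
    have "(\<Sum>g\<in>G. \<bar>pmf (m (act \<gamma> x)) (\<gamma> + g) - pmf (m x) g\<bar>) =
        (\<Sum>h\<in>?G. \<bar>pmf (m (act \<gamma> x)) h - pmf (map_pmf ((+) \<gamma>) (m x)) h\<bar>)"
      by (subst sum.reindex) (auto intro: inj_on_subset[OF inj] simp: pmf_map_inj'[OF inj])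
    also have "\<dots> \<le> l1_dist (m (act \<gamma> x)) (map_pmf ((+) \<gamma>) (m x))"
      using G by (intro l1_dist_ge_sum(1)) auto
    also have "\<dots> \<le> (SUP x. l1_dist (m (act \<gamma> x)) (map_pmf ((+) \<gamma>) (m x)))"
      by (rule cSUP_upper) (auto intro!: bdd_aboveI[of _ 2] l1_dist_ge_sum(2)[OF finite.emptyI])
    also have "\<dots> < e" by (rule m(2)[OF \<gamma>])
    finally have 2: "(\<Sum>g\<in>G. \<bar>pmf (m (act \<gamma> x)) (\<gamma> + g) - pmf (m x) g\<bar>) < e" .
    have "(\<Sum>g\<in>G. \<bar>q (act \<gamma> x) (\<gamma> + g) - q x g\<bar>) \<le>
        (\<Sum>g\<in>G. \<bar>q (act \<gamma> x) (\<gamma> + g) - pmf (m (act \<gamma> x)) (\<gamma> + g)\<bar> +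
          \<bar>pmf (m (act \<gamma> x)) (\<gamma> + g) - pmf (m x) g\<bar> + \<bar>q x g - pmf (m x) g\<bar>)"
      by (rule sum_mono) linarith
    also have "\<dots> \<le> 2 * e + e + 2 * e"
      unfolding sum.distrib using 1 2 close[OF G, of x] by linarith
    finally show ?thesis using e by linarith
  qed
  show thesis
  proof (rule that[OF K(1) _ _ _ _ almost_invariant])
    show "0 \<le> q x g" for x g using Z(2)[of x] by (simp add: q_def less_imp_le)
    show "q x g = 0" if "g \<notin> K" for x g using that by (simp add: q_def)
    show "(\<Sum>g\<in>K. q x g) = 1" for x
    proof -
      have "(\<Sum>g\<in>K. q x g) = (\<Sum>g\<in>K. pmf (m x) g) / Z x"
        unfolding sum_divide_distrib by (simp add: q_def)
      then show ?thesis using Z(2)[of x] by (simp add: Z_def)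
    qed
    have "continuous_on UNIV Z" unfolding Z_def by (intro continuous_intros m)
    then show "continuous_on UNIV (\<lambda>x. q x g)" for g
      unfolding q_def using Z(2) by (cases "g \<in> K") (auto intro!: continuous_intros m simp: less_imp_neq[symmetric] order_less_imp_not_eq2)
  qed
qed

section \<open>Fibres of finite sums: matrix entries, equivariance, finite propagation\<close>

section \<open>The algebraic crossed product\<close>

lemma action_by_homeosD:
  assumes "action_by_homeos act"
  shows "act 0 x = x" "act \<gamma> (act \<gamma>' x) = act (\<gamma> + \<gamma>') x" "continuous_on UNIV (act \<gamma>)"
  using assms by (auto simp: action_by_homeos_def homeomorphism_def)

lemma clinear_op_left_translation: "clinear_op (left_translation s)"
  by (auto simp: clinear_op_def left_translation.rep_eq translate_ell2.rep_eq intro!: ell2_eqI)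

text \<open>Compactness bounds the functions f s, so \<open>mult_op\<close> is a genuine
  multiplication here and not its dummy value.\<close>

lemma ell2_coeff_algebraic:
  fixes act :: "'g::group_add \<Rightarrow> 'x::topological_space \<Rightarrow> 'x"
  assumes "compact (UNIV :: 'x set)" "\<And>s. continuous_on UNIV (f s)"
  shows "ell2_coeff ((\<Sum>s\<in>F. fun_rep act (f s) o\<^sub>L left_translation s) \<xi>) (\<gamma>, x) =
    (\<Sum>s\<in>F. f s (act \<gamma> x) * ell2_coeff \<xi> (- s + \<gamma>, x))"
proof -
  have "bounded (range (\<lambda>(\<gamma>, x). f s (act \<gamma> x)))" for s
    by (rule bounded_subset[OF compact_imp_bounded[OF compact_continuous_image[OF assms(2,1)]]]) auto
  then show ?thesis
    by (simp add: blinfun.sum_left fun_rep_def ell2_coeff_mult_op left_translation.rep_eq translate_ell2.rep_eq)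
qed

lemma algebraic_crossed_productE:
  assumes "a \<in> algebraic_crossed_product act"
  obtains F f where "finite F" "\<And>s. continuous_on UNIV (f s)"
    "a = (\<Sum>s\<in>F. fun_rep act (f s) o\<^sub>L left_translation s)"
  using assms unfolding algebraic_crossed_product_def by blast

lemma clinear_op_algebraic:
  assumes "a \<in> algebraic_crossed_product act" shows "clinear_op a"
  using assms
  by (auto elim!: algebraic_crossed_productE simp: fun_rep_def
      intro!: clinear_op_sum clinear_op_compose clinear_op_mult_op clinear_op_left_translation)

lemma decomposable_algebraic:
  fixes act :: "'g::group_add \<Rightarrow> 'x::topological_space \<Rightarrow> 'x"
  assumes "compact (UNIV :: 'x set)" "a \<in> algebraic_crossed_product act"
  shows "decomposable a"
  using assms(2)
proof (rule algebraic_crossed_productE)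
  fix F f assume "\<And>s. continuous_on UNIV (f s :: 'x \<Rightarrow> complex)"
    "a = (\<Sum>s\<in>F. fun_rep act (f s) o\<^sub>L left_translation s)"
  then show ?thesis
    by (auto simp: decomposable_def ell2_coeff_algebraic[OF assms(1)] intro!: ell2_eqI)
qed

lemma ell2_coeff_fibre_algebraic:
  fixes act :: "'g::group_add \<Rightarrow> 'x::topological_space \<Rightarrow> 'x"
  assumes "compact (UNIV :: 'x set)" "\<And>s. continuous_on UNIV (f s)"
  shows "ell2_coeff (fibre (\<Sum>s\<in>F. fun_rep act (f s) o\<^sub>L left_translation s) x \<xi>) \<gamma> =
    (\<Sum>s\<in>F. f s (act \<gamma> x) * ell2_coeff \<xi> (- s + \<gamma>))"
  by (simp add: ell2_coeff_algebraic[OF assms])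

lemma matrix_coeff_fibre_algebraic:
  fixes act :: "'g::group_add \<Rightarrow> 'x::topological_space \<Rightarrow> 'x"
  assumes "compact (UNIV :: 'x set)" "\<And>s. continuous_on UNIV (f s)"
  shows "matrix_coeff (fibre (\<Sum>s\<in>F. fun_rep act (f s) o\<^sub>L left_translation s) x) \<alpha> \<beta> =
    (\<Sum>s\<in>F. if - s + \<alpha> = \<beta> then f s (act \<alpha> x) else 0)"
  unfolding ell2_coeff_op_delta[symmetric] ell2_coeff_fibre_algebraic[OF assms] ell2_coeff_delta
  by (intro sum.cong) auto

lemma fibre_algebraic_equivariant_quasi_local:
  fixes act :: "'g::group_add \<Rightarrow> 'x::topological_space \<Rightarrow> 'x"
  assumes X: "compact (UNIV :: 'x set)" and act: "action_by_homeos act"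
    and a: "a \<in> algebraic_crossed_product act"
  shows "fibre a \<in> equivariant_quasi_local_families act len"
  unfolding equivariant_quasi_local_families_iff
proof (intro conjI allI)
  obtain F f where Ff: "finite F" "\<And>s. continuous_on UNIV (f s)"
    and a_eq: "a = (\<Sum>s\<in>F. fun_rep act (f s) o\<^sub>L left_translation s)"
    using a by (rule algebraic_crossed_productE) blast
  have coeff: "matrix_coeff (fibre a x) \<alpha> \<beta> = (\<Sum>s\<in>F. if - s + \<alpha> = \<beta> then f s (act \<alpha> x) else 0)" for x \<alpha> \<beta>
    unfolding a_eq by (rule matrix_coeff_fibre_algebraic[OF X Ff(2)])
  show "clinear_op (fibre a x)" for x by (intro clinear_op_fibre clinear_op_algebraic[OF a])
  show "\<exists>C. \<forall>x. norm (fibre a x) \<le> C" using norm_fibre_le[of a] by blast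
  show "matrix_coeff (fibre a (act \<gamma> x)) \<alpha> \<beta> = matrix_coeff (fibre a x) (\<alpha> + \<gamma>) (\<beta> + \<gamma>)" for x \<alpha> \<beta> \<gamma>
    unfolding coeff by (simp add: action_by_homeosD(2)[OF act] add.assoc[symmetric] cong: if_cong)
  show "continuous_on UNIV (\<lambda>x. matrix_coeff (fibre a x) \<alpha> \<beta>)" for \<alpha> \<beta>
    unfolding coeff
  proof (rule continuous_on_sum)
    fix s
    have "continuous_on UNIV (\<lambda>x. f s (act \<alpha> x))"
      by (rule continuous_on_compose2[OF Ff(2) action_by_homeosD(3)[OF act]]) simp
    then show "continuous_on UNIV (\<lambda>x. if - s + \<alpha> = \<beta> then f s (act \<alpha> x) else 0)"
      by (cases "- s + \<alpha> = \<beta>") simp_all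
  qed
  show "quasi_local len (fibre a)"
    unfolding quasi_local_def
  proof (intro allI impI exI)
    fix \<epsilon> :: real and x A B
    \<comment> \<open>One radius, the propagation, works for every \<epsilon>: beyond it the block
      vanishes. Inserting 0 keeps the maximum defined when F is empty.\<close>
    assume "0 < \<epsilon>" and far: "\<forall>\<alpha>\<in>A. \<forall>\<beta>\<in>B. Max (len ` insert 0 F) < len (\<alpha> - \<beta>)"
    have "proj_op A o\<^sub>L fibre a x o\<^sub>L proj_op B = 0"
    proof (intro blinfun_eqI ell2_eqI)
      fix \<xi> \<gamma>
      have "- s + \<gamma> \<notin> B" if "s \<in> F" "\<gamma> \<in> A" for s
      proof
        assume "- s + \<gamma> \<in> B"
        then have "Max (len ` insert 0 F) < len (\<gamma> - (- s + \<gamma>))" using far that by blast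
        moreover have "\<gamma> - (- s + \<gamma>) = s"
          by (simp only: diff_conv_add_uminus minus_add minus_minus add_minus_cancel)
        moreover have "len s \<le> Max (len ` insert 0 F)" using Ff(1) that by (intro Max_ge) auto
        ultimately show False by simp
      qed
      then have "\<gamma> \<in> A \<Longrightarrow> ell2_coeff (fibre a x (proj_op B \<xi>)) \<gamma> = 0"
        unfolding a_eq ell2_coeff_fibre_algebraic[OF X Ff(2)] by (intro sum.neutral) auto
      then show "ell2_coeff ((proj_op A o\<^sub>L fibre a x o\<^sub>L proj_op B) \<xi>) \<gamma> = ell2_coeff ((0 :: 'g op) \<xi>) \<gamma>"
        by (simp del: fibre_apply)
    qed
    then show "norm (proj_op A o\<^sub>L fibre a x o\<^sub>L proj_op B) \<le> \<epsilon>" using \<open>0 < \<epsilon>\<close> by simp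
  qed
qed

section \<open>Kernels along orbits and uniform approximation by Schur multiples\<close>

section \<open>Approximation of equivariant quasi-local families\<close>

lemma cinner_fin_vec_eq_sesq:
  "clinear_op T \<Longrightarrow> finite V \<Longrightarrow> finite W \<Longrightarrow>
    cinner (fin_vec V u) (T (fin_vec W v)) = sesq (matrix_coeff T) V W u v"
  by (simp add: cinner_op_fin_vec sesq_def)

lemma norm_sesq_matrix_coeff_le:
  assumes "clinear_op T" "finite V" "finite W" "norm (proj_op V o\<^sub>L T o\<^sub>L proj_op W) \<le> c"
  shows "cmod (sesq (matrix_coeff T) V W u v) \<le> c * nrm2 u V * nrm2 v W"
proof -
  have proj: "proj_op V (fin_vec V u) = fin_vec V u" if "finite V" for V and u :: "'a \<Rightarrow> complex"
    by (rule ell2_eqI) (simp add: ell2_coeff_fin_vec that)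
  have "sesq (matrix_coeff T) V W u v = cinner (proj_op V (fin_vec V u)) (T (proj_op W (fin_vec W v)))"
    by (simp add: proj cinner_fin_vec_eq_sesq assms)
  also have "\<dots> = cinner (fin_vec V u) ((proj_op V o\<^sub>L T o\<^sub>L proj_op W) (fin_vec W v))"
    by (simp add: cinner_proj_op)
  also have "cmod \<dots> \<le> nrm2 u V * (c * nrm2 v W)"
    unfolding norm_fin_vec[OF assms(2), symmetric] norm_fin_vec[OF assms(3), symmetric]
    by (intro order_trans[OF norm_cinner_le] mult_left_mono order_trans[OF norm_blinfun]
        mult_right_mono assms(4)) auto
  finally show ?thesis by (simp add: mult_ac)
qed

text \<open>It lets one finite set G, containing all the translates needed, serve as common index
  set for the translated functions of many \<alpha>.\<close>

lemma sum_translate: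
  fixes r :: "'g::group_add \<Rightarrow> real"
  assumes "finite G" "(\<lambda>k. - \<alpha> + k) ` K \<subseteq> G" "\<And>g. g \<notin> K \<Longrightarrow> r g = 0"
  shows "(\<Sum>g\<in>G. r (\<alpha> + g)) = (\<Sum>k\<in>K. r k)"
proof -
  have "(\<Sum>k\<in>K. r k) = (\<Sum>g\<in>(\<lambda>k. - \<alpha> + k) ` K. r (\<alpha> + g))"
    by (subst sum.reindex) (auto simp: inj_on_def add.assoc[symmetric])
  also have "\<dots> = (\<Sum>g\<in>G. r (\<alpha> + g))"
  proof (rule sum.mono_neutral_left[OF assms(1,2)])
    show "\<forall>g\<in>G - (\<lambda>k. - \<alpha> + k) ` K. r (\<alpha> + g) = 0"
    proof
      fix g assume g: "g \<in> G - (\<lambda>k. - \<alpha> + k) ` K"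
      have "\<alpha> + g \<notin> K"
      proof
        assume "\<alpha> + g \<in> K"
        then have "- \<alpha> + (\<alpha> + g) \<in> (\<lambda>k. - \<alpha> + k) ` K" by (rule imageI)
        with g show False by (simp add: add.assoc[symmetric])
      qed
      then show "r (\<alpha> + g) = 0" by (rule assms(3))
    qed
  qed
  finally show ?thesis by simp
qed

text \<open>With y = act \<alpha> x and h = \<alpha> + g this is almost invariance at y under
  \<beta> - \<alpha>, since the group element \<beta> - \<alpha> takes the pair (y, h) to (act
  \<beta> x, \<beta> + g).\<close>

lemma orbit_almost_invariant:
  fixes act :: "'g::group_add \<Rightarrow> 'x::topological_space \<Rightarrow> 'x"
  assumes act: "action_by_homeos act"
    and q: "\<And>\<gamma> x G. \<gamma> \<in> F \<Longrightarrow> finite G \<Longrightarrow> (\<Sum>g\<in>G. \<bar>q (act \<gamma> x) (\<gamma> + g) - q x g\<bar>) \<le> (\<epsilon>::real)"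
    and "\<beta> - \<alpha> \<in> F" "finite G"
  shows "(\<Sum>g\<in>G. \<bar>q (act \<beta> x) (\<beta> + g) - q (act \<alpha> x) (\<alpha> + g)\<bar>) \<le> \<epsilon>"
proof -
  have "(\<Sum>g\<in>G. \<bar>q (act \<beta> x) (\<beta> + g) - q (act \<alpha> x) (\<alpha> + g)\<bar>) =
      (\<Sum>h\<in>(+) \<alpha> ` G. \<bar>q (act (\<beta> - \<alpha>) (act \<alpha> x)) (\<beta> - \<alpha> + h) - q (act \<alpha> x) h\<bar>)"
    by (subst sum.reindex) (auto simp: inj_on_def action_by_homeosD[OF act] add.assoc[symmetric])
  also have "\<dots> \<le> \<epsilon>" using assms by (intro q) auto
  finally show ?thesis .
qed

lemma sqrt_diff_sq_le: "0 \<le> a \<Longrightarrow> 0 \<le> b \<Longrightarrow> (sqrt a - sqrt b)\<^sup>2 \<le> \<bar>a - b\<bar>"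
proof (induction a b rule: linorder_wlog)
  case (le a b)
  have "(sqrt b - sqrt a) * (sqrt b - sqrt a) \<le> (sqrt b - sqrt a) * (sqrt b + sqrt a)"
    using le by (intro mult_left_mono) auto
  also have "\<dots> = b - a" using le by (simp add: algebra_simps)
  finally show ?case using le by (simp add: power2_eq_square algebra_simps)
qed (simp add: power2_commute abs_minus_commute)

text \<open>For probability vectors, twice the defect of the inner product of their square roots is
  the squared distance of these roots, which is at most the l1 distance of the vectors.\<close>

lemma one_minus_kernel_le:
  fixes p p' :: "'g \<Rightarrow> real"
  assumes "\<And>g. 0 \<le> p g" "\<And>g. 0 \<le> p' g" "(\<Sum>g\<in>G. p g) = 1" "(\<Sum>g\<in>G. p' g) = 1"
    and "(\<Sum>g\<in>G. \<bar>p g - p' g\<bar>) \<le> \<delta>"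
  shows "\<bar>1 - (\<Sum>g\<in>G. sqrt (p g) * sqrt (p' g))\<bar> \<le> \<delta>"
proof -
  have "2 * (1 - (\<Sum>g\<in>G. sqrt (p g) * sqrt (p' g))) = (\<Sum>g\<in>G. (sqrt (p g) - sqrt (p' g))\<^sup>2)"
    using assms by (simp add: power2_diff sum.distrib sum_subtractf sum_distrib_left mult.assoc)
  moreover have "0 \<le> (\<Sum>g\<in>G. (sqrt (p g) - sqrt (p' g))\<^sup>2)" by (simp add: sum_nonneg)
  moreover have "(\<Sum>g\<in>G. (sqrt (p g) - sqrt (p' g))\<^sup>2) \<le> \<delta>"
    by (rule order_trans[OF sum_mono assms(5)]) (intro sqrt_diff_sq_le assms)
  moreover have "\<bar>1 - z\<bar> \<le> \<delta>" if "2 * (1 - z) = S" "0 \<le> S" "S \<le> \<delta>" for z S :: real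
  proof -
    have "1 - z = S / 2" using that by simp
    then show ?thesis using that by simp
  qed
  ultimately show ?thesis by blast
qed

text \<open>The approximant is the Schur product of \<open>T x\<close> with the kernel
  \<open>(\<alpha>, \<beta>) \<mapsto> \<Sum>g. sqrt (p \<alpha> g) * sqrt (p \<beta> g)\<close> where \<open>p \<alpha> g = q (act \<alpha> x) (\<alpha> + g)\<close>.\<close>

lemma exists_algebraic_schur_multiple:
  fixes act :: "'g::group_add \<Rightarrow> 'x::topological_space \<Rightarrow> 'x" and q :: "'x \<Rightarrow> 'g \<Rightarrow> real"
  assumes X: "compact (UNIV :: 'x set)" and act: "action_by_homeos act"
    and T: "T \<in> equivariant_quasi_local_families act len"
    and K: "finite K" and q: "\<And>x g. g \<notin> K \<Longrightarrow> q x g = 0" "\<And>g. continuous_on UNIV (\<lambda>x. q x g)"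
  shows "\<exists>a\<in>algebraic_crossed_product act. \<forall>x \<alpha> \<beta> G. finite G \<longrightarrow> (\<lambda>k. - \<alpha> + k) ` K \<subseteq> G \<longrightarrow>
    matrix_coeff (fibre a x) \<alpha> \<beta> =
      of_real (\<Sum>g\<in>G. sqrt (q (act \<alpha> x) (\<alpha> + g)) * sqrt (q (act \<beta> x) (\<beta> + g))) * matrix_coeff (T x) \<alpha> \<beta>"
proof -
  have eq: "matrix_coeff (T (act \<gamma> x)) \<alpha> \<beta> = matrix_coeff (T x) (\<alpha> + \<gamma>) (\<beta> + \<gamma>)"
    and cont: "continuous_on UNIV (\<lambda>x. matrix_coeff (T x) \<alpha> \<beta>)" for x \<alpha> \<beta> \<gamma>
    using T unfolding equivariant_quasi_local_families_iff by auto
  \<comment> \<open>A nonzero kernel entry needs a g with \<alpha> + g and \<beta> + g in K, and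
    then \<alpha> - \<beta> is a difference of elements of K.\<close>
  define F where "F = (\<lambda>(k, k'). k - k') ` (K \<times> K)"
  \<comment> \<open>The entry in row 0 and column - s at y. By equivariance, evaluating f s at act
    \<alpha> x gives the entry of the Schur product over x in row \<alpha> and column - s +
    \<alpha>.\<close>
  define f where "f s y = of_real (\<Sum>g\<in>K. sqrt (q y g) * sqrt (q (act (- s) y) (- s + g))) *
    matrix_coeff (T y) 0 (- s)" for s y
  have fin: "finite F" using K by (simp add: F_def)
  have q': "continuous_on UNIV (\<lambda>x. q (act \<gamma> x) g)" for \<gamma> g
    by (rule continuous_on_compose2[OF q(2) action_by_homeosD(3)[OF act]]) simp
  have f: "continuous_on UNIV (f s)" for s
    unfolding f_def by (intro continuous_intros cont q q')
  define a where "a = (\<Sum>s\<in>F. fun_rep act (f s) o\<^sub>L left_translation s)"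
  have "a \<in> algebraic_crossed_product act"
    unfolding a_def algebraic_crossed_product_def using fin f by blast
  moreover have "matrix_coeff (fibre a x) \<alpha> \<beta> =
      of_real (\<Sum>g\<in>G. sqrt (q (act \<alpha> x) (\<alpha> + g)) * sqrt (q (act \<beta> x) (\<beta> + g))) * matrix_coeff (T x) \<alpha> \<beta>"
    if G: "finite G" "(\<lambda>k. - \<alpha> + k) ` K \<subseteq> G" for x \<alpha> \<beta> G
  proof -
    have shift: "- s + \<alpha> = \<beta> \<longleftrightarrow> s = \<alpha> - \<beta>" for s
      by (metis add.assoc add_minus_cancel diff_add_cancel minus_add_cancel minus_diff_eq)
    have "matrix_coeff (fibre a x) \<alpha> \<beta> = (\<Sum>s\<in>F. if s = \<alpha> - \<beta> then f s (act \<alpha> x) else 0)"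
      unfolding a_def matrix_coeff_fibre_algebraic[OF X f] shift ..
    also have "\<dots> = (if \<alpha> - \<beta> \<in> F then f (\<alpha> - \<beta>) (act \<alpha> x) else 0)"
      using fin by simp
    also have "\<dots> = of_real (\<Sum>g\<in>G. sqrt (q (act \<alpha> x) (\<alpha> + g)) * sqrt (q (act \<beta> x) (\<beta> + g))) * matrix_coeff (T x) \<alpha> \<beta>"
    proof (cases "\<alpha> - \<beta> \<in> F")
      case True
      have "(\<Sum>g\<in>G. sqrt (q (act \<alpha> x) (\<alpha> + g)) * sqrt (q (act \<beta> x) (\<beta> - \<alpha> + (\<alpha> + g)))) =
          (\<Sum>k\<in>K. sqrt (q (act \<alpha> x) k) * sqrt (q (act \<beta> x) (\<beta> - \<alpha> + k)))"
        by (rule sum_translate[OF G]) (simp add: q)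
      then show ?thesis
        using True by (simp add: f_def action_by_homeosD[OF act] eq add.assoc[symmetric])
    next
      case False
      have "sqrt (q (act \<alpha> x) (\<alpha> + g)) * sqrt (q (act \<beta> x) (\<beta> + g)) = 0" for g
      proof (cases "\<alpha> + g \<in> K \<and> \<beta> + g \<in> K")
        case True
        then have "(\<alpha> + g) - (\<beta> + g) \<in> F" unfolding F_def by auto
        moreover have "(\<alpha> + g) - (\<beta> + g) = \<alpha> - \<beta>"
          by (simp only: diff_conv_add_uminus minus_add add.assoc add_minus_cancel)
        ultimately show ?thesis using False by simp
      qed (auto simp: q)
      then have "(\<Sum>g\<in>G. sqrt (q (act \<alpha> x) (\<alpha> + g)) * sqrt (q (act \<beta> x) (\<beta> + g))) = 0"
        by (intro sum.neutral ballI)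
      then show ?thesis using False by (simp del: of_real_sum)
    qed
    finally show ?thesis .
  qed
  ultimately show ?thesis by blast
qed

text \<open>The order of choices matters: quasi-locality fixes R; almost invariance at scale R gives
  q and K; then q' is chosen almost invariant on all differences of elements of K, with a tolerance
  that may depend on \<open>card K\<close>.\<close>

lemma exists_algebraic_approx:
  fixes act :: "'g::group_add \<Rightarrow> 'x::topological_space \<Rightarrow> 'x"
  assumes X: "compact (UNIV :: 'x set)" and act: "action_by_homeos act"
    and amenable: "amenable_action act" and len: "proper_length_function len"
    and T: "T \<in> equivariant_quasi_local_families act len" and "0 < \<epsilon>"
  shows "\<exists>a\<in>algebraic_crossed_product act. \<forall>x. norm (fibre a x - T x) \<le> \<epsilon>"
proof -
  have len: "\<And>\<gamma>. len (- \<gamma>) = len \<gamma>" "len 0 = 0" "\<And>r. finite {\<gamma>. len \<gamma> \<le> r}"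
    using len unfolding proper_length_function_def by auto
  have lin: "\<And>x. clinear_op (T x)" and ql: "quasi_local len T"
    using T unfolding equivariant_quasi_local_families_iff by auto
  obtain C0 where C0: "\<And>x. norm (T x) \<le> C0"
    using T unfolding equivariant_quasi_local_families_iff by auto
  define C where "C = max C0 1"
  have C: "norm (T x) \<le> C" "0 < C" for x using C0[of x] by (auto simp: C_def)
  \<comment> \<open>Budget: far blocks cost 4 * (2 * \<epsilon>1) = \<epsilon> / 4, the leftover
    mass costs 4 * C * sqrt (2 * \<eta>) = \<epsilon> / 4, and the diagonal blocks at most
    \<epsilon> / 2.\<close>
  define \<epsilon>1 where "\<epsilon>1 = \<epsilon> / 32"
  have \<epsilon>1: "0 < \<epsilon>1" using \<open>0 < \<epsilon>\<close> by (simp add: \<epsilon>1_def)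
  define \<eta> where "\<eta> = (\<epsilon> / (16 * C))\<^sup>2 / 2"
  have \<eta>: "0 < \<eta>" "sqrt (2 * \<eta>) = \<epsilon> / (16 * C)"
    using \<open>0 < \<epsilon>\<close> C(2) by (auto simp: \<eta>_def)
  from quasi_localE[OF ql \<epsilon>1] obtain R0 where R0:
    "\<And>x A B. (\<And>\<alpha> \<beta>. \<alpha> \<in> A \<Longrightarrow> \<beta> \<in> B \<Longrightarrow> R0 < len (\<alpha> - \<beta>)) \<Longrightarrow>
      norm (proj_op A o\<^sub>L T x o\<^sub>L proj_op B) \<le> \<epsilon>1" by metis
  define R where "R = max R0 0"
  define near where "near \<alpha> \<beta> \<longleftrightarrow> len (\<alpha> - \<beta>) \<le> R" for \<alpha> \<beta>
  have near: "near \<alpha> \<alpha>" "near \<alpha> \<beta> \<Longrightarrow> near \<beta> \<alpha>" for \<alpha> \<beta>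
    using len(1)[of "\<alpha> - \<beta>"] len(2) by (auto simp: near_def R_def)
  define B where "B = {\<gamma>. len \<gamma> \<le> R}"
  have B: "finite B" by (simp add: B_def len)
  define \<delta>1 where "\<delta>1 = \<eta> / (real (card B) + 1)"
  have \<delta>1: "0 < \<delta>1" "real (card B) * \<delta>1 < \<eta>"
    using \<eta>(1) by (auto simp: \<delta>1_def field_simps)
  obtain K and q :: "'x \<Rightarrow> 'g \<Rightarrow> real" where
    q: "finite K" "\<And>x g. 0 \<le> q x g" "\<And>x g. g \<notin> K \<Longrightarrow> q x g = 0" "\<And>x. (\<Sum>g\<in>K. q x g) = 1"
      "\<And>\<gamma> x G. \<gamma> \<in> B \<Longrightarrow> finite G \<Longrightarrow> (\<Sum>g\<in>G. \<bar>q (act \<gamma> x) (\<gamma> + g) - q x g\<bar>) \<le> \<delta>1"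
    by (rule amenable_action_finite_support[OF X amenable \<delta>1(1) B]) blast
  define F where "F = (\<lambda>(k, k'). k - k') ` (K \<times> K)"
  define \<delta> where "\<delta> = \<epsilon> / (2 * C * (real (card K) + 1))"
  have F: "finite F" using q(1) by (simp add: F_def)
  have \<delta>: "0 < \<delta>" "\<delta> * C * card K \<le> \<epsilon> / 2"
  proof -
    have pos: "0 < 2 * C * (real (card K) + 1)" using C(2) by (simp add: add_nonneg_pos)
    then have eq: "\<delta> * (2 * C * (real (card K) + 1)) = \<epsilon>"
      unfolding \<delta>_def by (metis nonzero_eq_divide_eq less_irrefl)
    show "0 < \<delta>" unfolding \<delta>_def using \<open>0 < \<epsilon>\<close> pos by (rule divide_pos_pos)
    have "\<delta> * C * card K \<le> \<delta> * C * (real (card K) + 1)" using \<open>0 < \<delta>\<close> C(2) by simp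
    also have "\<dots> = \<epsilon> / 2" using eq by (simp add: algebra_simps)
    finally show "\<delta> * C * card K \<le> \<epsilon> / 2" .
  qed
  obtain L and q' :: "'x \<Rightarrow> 'g \<Rightarrow> real" where
    q': "finite L" "\<And>x g. 0 \<le> q' x g" "\<And>x g. g \<notin> L \<Longrightarrow> q' x g = 0" "\<And>x. (\<Sum>g\<in>L. q' x g) = 1"
      "\<And>g. continuous_on UNIV (\<lambda>x. q' x g)"
      "\<And>\<gamma> x G. \<gamma> \<in> F \<Longrightarrow> finite G \<Longrightarrow> (\<Sum>g\<in>G. \<bar>q' (act \<gamma> x) (\<gamma> + g) - q' x g\<bar>) \<le> \<delta>"
    by (rule amenable_action_finite_support[OF X amenable \<delta>(1) F]) blast
  have "\<exists>a\<in>algebraic_crossed_product act. \<forall>x \<alpha> \<beta> G. finite G \<longrightarrow> (\<lambda>k. - \<alpha> + k) ` L \<subseteq> G \<longrightarrow>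
    matrix_coeff (fibre a x) \<alpha> \<beta> =
      of_real (\<Sum>g\<in>G. sqrt (q' (act \<alpha> x) (\<alpha> + g)) * sqrt (q' (act \<beta> x) (\<beta> + g))) * matrix_coeff (T x) \<alpha> \<beta>"
    by (rule exists_algebraic_schur_multiple[OF X act T q'(1,3,5)])
  then obtain a where a: "a \<in> algebraic_crossed_product act" and coeff:
    "\<forall>x \<alpha> \<beta> G. finite G \<longrightarrow> (\<lambda>k. - \<alpha> + k) ` L \<subseteq> G \<longrightarrow> matrix_coeff (fibre a x) \<alpha> \<beta> =
      of_real (\<Sum>g\<in>G. sqrt (q' (act \<alpha> x) (\<alpha> + g)) * sqrt (q' (act \<beta> x) (\<beta> + g))) * matrix_coeff (T x) \<alpha> \<beta>"
    by (elim bexE)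
  have "norm (fibre a x - T x) \<le> \<epsilon>" for x
  proof (rule norm_clinear_op_leI)
    show "clinear_op (fibre a x - T x)"
      using clinear_op_add[OF clinear_op_fibre[OF clinear_op_algebraic[OF a]]
          clinear_op_compose[OF clinear_op_mult_op[of "\<lambda>_. -1"] lin[of x]], of x] by simp
    fix A and u v :: "'g \<Rightarrow> complex"
    assume A: "finite A" and uv: "nrm2 u A \<le> 1" "nrm2 v A \<le> 1"
    \<comment> \<open>Large enough to contain the supports of p \<alpha> and p' \<alpha> for every
      \<alpha> in A, so all of them have total mass 1 on G.\<close>
    define G where "G = (\<Union>\<alpha>\<in>A. (\<lambda>k. - \<alpha> + k) ` (K \<union> L))"
    have G: "finite G" using A q(1) q'(1) by (simp add: G_def)
    have GK: "(\<lambda>k. - \<alpha> + k) ` K \<subseteq> G" "(\<lambda>k. - \<alpha> + k) ` L \<subseteq> G" if "\<alpha> \<in> A" for \<alpha>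
      using that by (auto simp: G_def)
    define p where "p \<alpha> g = q (act \<alpha> x) (\<alpha> + g)" for \<alpha> g
    define p' where "p' \<alpha> g = q' (act \<alpha> x) (\<alpha> + g)" for \<alpha> g
    have p_sum: "(\<Sum>g\<in>G. p \<alpha> g) = 1" "(\<Sum>g\<in>G. p' \<alpha> g) = 1" if "\<alpha> \<in> A" for \<alpha>
      unfolding p_def p'_def
      using sum_translate[OF G GK(1)[OF that], of "q (act \<alpha> x)"] q(3,4)
        sum_translate[OF G GK(2)[OF that], of "q' (act \<alpha> x)"] q'(3,4) by auto
    let ?\<mu> = "\<lambda>\<alpha>. (cmod (u \<alpha>))\<^sup>2 + (cmod (v \<alpha>))\<^sup>2"
    have "\<exists>\<W>. finite \<W> \<and> (\<forall>W\<in>\<W>. W \<subseteq> A \<and> (\<exists>g\<in>G. \<forall>\<alpha>\<in>W. 0 < p \<alpha> g)) \<and>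
        (\<forall>V\<in>\<W>. \<forall>W\<in>\<W>. V \<noteq> W \<longrightarrow> (\<forall>\<alpha>\<in>V. \<forall>\<beta>\<in>W. \<not> near \<alpha> \<beta>)) \<and>
        sum ?\<mu> (A - \<Union>\<W>) \<le> \<eta> * sum ?\<mu> (\<Union>\<W>)"
    proof (rule exists_sparse_family[OF A G])
      show "0 \<le> p \<alpha> g" for \<alpha> g by (simp add: p_def q)
      show "card {\<beta>\<in>A. near \<alpha> \<beta>} \<le> card B" for \<alpha>
      proof (rule card_inj_on_le[of "\<lambda>\<beta>. \<beta> - \<alpha>"])
        show "(\<lambda>\<beta>. \<beta> - \<alpha>) ` {\<beta>\<in>A. near \<alpha> \<beta>} \<subseteq> B"
          using near(2) by (auto simp: near_def B_def)
      qed (auto simp: inj_on_def B)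
      show "(\<Sum>g\<in>G. \<bar>p \<beta> g - p \<alpha> g\<bar>) \<le> \<delta>1" if "near \<alpha> \<beta>" for \<alpha> \<beta>
        unfolding p_def
      proof (rule orbit_almost_invariant[OF act, of B q])
        show "\<beta> - \<alpha> \<in> B" using near(2)[OF that] by (simp add: near_def B_def)
      qed (use q(5) G in auto)
    qed (use p_sum \<delta>1 near in auto)
    then obtain \<W> where \<W>: "finite \<W>" "\<forall>W\<in>\<W>. W \<subseteq> A \<and> (\<exists>g\<in>G. \<forall>\<alpha>\<in>W. 0 < p \<alpha> g)"
        "\<forall>V\<in>\<W>. \<forall>W\<in>\<W>. V \<noteq> W \<longrightarrow> (\<forall>\<alpha>\<in>V. \<forall>\<beta>\<in>W. \<not> near \<alpha> \<beta>)"
        "sum ?\<mu> (A - \<Union>\<W>) \<le> \<eta> * sum ?\<mu> (\<Union>\<W>)"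
      by (elim exE conjE) simp
    have W_subset: "W \<subseteq> A" "\<exists>g. \<forall>\<alpha>\<in>W. 0 < p \<alpha> g" if "W \<in> \<W>" for W
      using bspec[OF \<W>(2) that] by auto
    define \<phi> where "\<phi> \<alpha> \<beta> = (\<Sum>g\<in>G. sqrt (p' \<alpha> g) * sqrt (p' \<beta> g))" for \<alpha> \<beta>
    define t where "t \<alpha> \<beta> = of_real (\<phi> \<alpha> \<beta>) * matrix_coeff (T x) \<alpha> \<beta> - matrix_coeff (T x) \<alpha> \<beta>" for \<alpha> \<beta>
    \<comment> \<open>One c for the Schur product, by contractivity, and one for T itself. The bound
      involves neither q' nor the size of G.\<close>
    have t_sesq: "cmod (sesq t V W u v) \<le> 2 * c * nrm2 u V * nrm2 v W"
      if VW: "V \<subseteq> A" "W \<subseteq> A" and c: "norm (proj_op V o\<^sub>L T x o\<^sub>L proj_op W) \<le> c" for V W c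
    proof -
      have fin: "finite V" "finite W" using VW A by (auto intro: finite_subset)
      have "0 \<le> c" using c norm_ge_zero order_trans by blast
      have le: "cmod (sesq (matrix_coeff (T x)) V W u v) \<le> c * nrm2 u V * nrm2 v W" for u v
        by (rule norm_sesq_matrix_coeff_le[OF lin fin c])
      have "sesq t V W u v = sesq (\<lambda>\<alpha> \<beta>. of_real (\<phi> \<alpha> \<beta>) * matrix_coeff (T x) \<alpha> \<beta>) V W u v -
          sesq (matrix_coeff (T x)) V W u v"
        by (simp add: sesq_def t_def algebra_simps sum_subtractf)
      also have "cmod \<dots> \<le> c * nrm2 u V * nrm2 v W + c * nrm2 u V * nrm2 v W"
      proof (rule order_trans[OF norm_triangle_ineq4 add_mono[OF _ le]])
        show "cmod (sesq (\<lambda>\<alpha> \<beta>. of_real (\<phi> \<alpha> \<beta>) * matrix_coeff (T x) \<alpha> \<beta>) V W u v) \<le>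
            c * nrm2 u V * nrm2 v W"
          unfolding \<phi>_def
          by (rule norm_sesq_schur_le[OF le \<open>0 \<le> c\<close> G fin, of "\<lambda>g \<alpha>. sqrt (p' \<alpha> g)"])
            (use VW p_sum(2) q'(2) in \<open>auto simp: p'_def subset_iff\<close>)
      qed
      finally show ?thesis by simp
    qed
    have "cmod (sesq t A A u v) \<le> (\<delta> * C) * card K + 4 * (2 * \<epsilon>1) + 2 * (2 * C) * sqrt (2 * \<eta>)"
    proof (rule norm_sesq_le_local[OF A \<W>(1), of t u v "2 * C" near "2 * \<epsilon>1" "card K" "\<delta> * C" \<eta>])
      show "cmod (sesq t V W u v) \<le> 2 * C * nrm2 u V * nrm2 v W" if "V \<subseteq> A" "W \<subseteq> A" for V W
      proof (rule t_sesq[OF that])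
        show "norm (proj_op V o\<^sub>L T x o\<^sub>L proj_op W) \<le> C"
          using norm_compose3_le[OF norm_proj_op_le C(1) norm_proj_op_le] C(2) by simp
      qed
      show "cmod (sesq t V W u v) \<le> 2 * \<epsilon>1 * nrm2 u V * nrm2 v W"
        if "V \<subseteq> A" "W \<subseteq> A" "\<forall>\<alpha>\<in>V. \<forall>\<beta>\<in>W. \<not> near \<alpha> \<beta>" for V W
        by (rule t_sesq[OF that(1,2) R0]) (use that(3) in \<open>fastforce simp: near_def R_def\<close>)
      show "W \<subseteq> A" if "W \<in> \<W>" for W by (rule W_subset(1)[OF that])
      show "card W \<le> card K" if W: "W \<in> \<W>" for W
      proof -
        \<comment> \<open>Positivity at a common g places the right translate W + g inside
          K.\<close>
        obtain g where g: "\<forall>\<alpha>\<in>W. 0 < p \<alpha> g" using W_subset(2)[OF W] by (elim exE)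
        show ?thesis
        proof (rule card_inj_on_le[of "\<lambda>\<alpha>. \<alpha> + g"])
          show "(\<lambda>\<alpha>. \<alpha> + g) ` W \<subseteq> K"
          proof safe
            fix \<alpha> assume "\<alpha> \<in> W"
            then show "\<alpha> + g \<in> K" using bspec[OF g, of \<alpha>] q(3)[of "\<alpha> + g" "act \<alpha> x"] by (auto simp: p_def)
          qed
        qed (auto simp: inj_on_def q)
      qed
      show "cmod (t \<alpha> \<beta>) \<le> \<delta> * C" if W: "W \<in> \<W>" and \<alpha>\<beta>: "\<alpha> \<in> W" "\<beta> \<in> W" for W \<alpha> \<beta>
      proof -
        obtain g where g: "\<forall>\<alpha>\<in>W. 0 < p \<alpha> g" using W_subset(2)[OF W] by (elim exE)
        have "\<alpha> + g \<in> K" "\<beta> + g \<in> K"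
          using bspec[OF g \<alpha>\<beta>(1)] bspec[OF g \<alpha>\<beta>(2)] q(3)[of "\<alpha> + g" "act \<alpha> x"] q(3)[of "\<beta> + g" "act \<beta> x"]
          by (auto simp: p_def)
        then have "(\<alpha> + g) - (\<beta> + g) \<in> F" unfolding F_def by auto
        moreover have "(\<alpha> + g) - (\<beta> + g) = \<alpha> - \<beta>"
          by (simp only: diff_conv_add_uminus minus_add add.assoc add_minus_cancel)
        ultimately have "\<alpha> - \<beta> \<in> F" by simp
        \<comment> \<open>Two points of the same W differ by an element of F, on which q' is almost
          invariant, so the kernel is within \<delta> of 1 on W \<times> W.\<close>
        from orbit_almost_invariant[OF act q'(6) this G, of x]
        have close: "(\<Sum>g\<in>G. \<bar>p' \<alpha> g - p' \<beta> g\<bar>) \<le> \<delta>" unfolding p'_def by simp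
        have "\<alpha> \<in> A" "\<beta> \<in> A" using W_subset(1)[OF W] \<alpha>\<beta> by auto
        then have "\<bar>1 - \<phi> \<alpha> \<beta>\<bar> \<le> \<delta>"
          unfolding \<phi>_def by (intro one_minus_kernel_le p_sum close) (auto simp: p'_def q')
        moreover have "t \<alpha> \<beta> = - of_real (1 - \<phi> \<alpha> \<beta>) * matrix_coeff (T x) \<alpha> \<beta>"
          by (simp add: t_def algebra_simps)
        then have "cmod (t \<alpha> \<beta>) = \<bar>1 - \<phi> \<alpha> \<beta>\<bar> * cmod (matrix_coeff (T x) \<alpha> \<beta>)"
          by (simp only: norm_mult norm_minus_cancel norm_of_real)
        ultimately show ?thesis
          using order_trans[OF norm_matrix_coeff_le C(1)] \<delta>(1) by (simp add: mult_mono)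
      qed
    qed (use \<W>(3,4) near uv \<delta> C(2) \<epsilon>1 \<eta>(1) in auto)
    also have "\<dots> \<le> \<epsilon>"
    proof -
      have "2 * (2 * C) * sqrt (2 * \<eta>) = \<epsilon> / 4" unfolding \<eta>(2) using C(2) by (simp add: field_simps)
      then show ?thesis using \<delta>(2) by (simp add: \<epsilon>1_def)
    qed
    also have "sesq t A A u v = (\<Sum>\<alpha>\<in>A. \<Sum>\<beta>\<in>A. cnj (u \<alpha>) * matrix_coeff (fibre a x - T x) \<alpha> \<beta> * v \<beta>)"
      unfolding sesq_def
      by (intro sum.cong refl)
        (simp add: t_def matrix_coeff_diff \<phi>_def p'_def coeff[rule_format, OF G GK(2)] del: of_real_sum)
    finally show "cmod (\<Sum>\<alpha>\<in>A. \<Sum>\<beta>\<in>A. cnj (u \<alpha>) * matrix_coeff (fibre a x - T x) \<alpha> \<beta> * v \<beta>) \<le> \<epsilon>" .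
  qed (use \<open>0 < \<epsilon>\<close> in simp)
  then show ?thesis using a by blast
qed

section \<open>Passage to the norm closure and bijectivity of the fibre map\<close>

section \<open>The isomorphism\<close>

text \<open>Both properties are families of equations between expressions continuous in a, so they
  define closed sets.\<close>

lemma closure_algebraic:
  fixes act :: "'g::group_add \<Rightarrow> 'x::topological_space \<Rightarrow> 'x"
  assumes X: "compact (UNIV :: 'x set)" and a: "a \<in> closure (algebraic_crossed_product act)"
  shows "clinear_op a" "decomposable a"
proof -
  have "closed {a :: ('g \<times> 'x) op. clinear_op a}"
    unfolding clinear_op_def mult_op_const_apply[symmetric]
    by (intro closed_Collect_all closed_Collect_eq continuous_intros)
  then have "closure (algebraic_crossed_product act) \<subseteq> {a. clinear_op a}"
    by (intro closure_minimal) (auto intro: clinear_op_algebraic)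
  then show "clinear_op a" using a by auto
  have "closed {a :: ('g \<times> 'x) op. decomposable a}"
    unfolding decomposable_def fibre_apply
    by (intro closed_Collect_all closed_Collect_eq continuous_intros)
  then have "closure (algebraic_crossed_product act) \<subseteq> {a. decomposable a}"
    by (intro closure_minimal) (auto intro: decomposable_algebraic[OF X])
  then show "decomposable a" using a by auto
qed

theorem theorem6p6:
  fixes act :: "'g::{group_add, countable} \<Rightarrow> 'x::t2_space \<Rightarrow> 'x"
    and len :: "'g \<Rightarrow> real"
  assumes "compact (UNIV :: 'x set)"
    and "action_by_homeos act"
    and "amenable_action act"
    and "proper_length_function len"
  shows "cstar_subalgebra (equivariant_quasi_local_families act len) (product_algebra bounded_ops) \<and>
    cstar_isomorphic (reduced_crossed_product act)
      ((product_algebra bounded_ops)\<lparr>carrier := equivariant_quasi_local_families act len\<rparr>)"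
proof
  show "cstar_subalgebra (equivariant_quasi_local_families act len) (product_algebra bounded_ops)"
    by (rule cstar_subalgebra_equivariant_quasi_local_families[OF assms(4)])
  let ?A = "algebraic_crossed_product act" and ?E = "equivariant_quasi_local_families act len"
  note closure = closure_algebraic[OF assms(1), of _ act]
  have "fibre a \<in> ?E" if a: "a \<in> closure ?A" for a
  proof (rule equivariant_quasi_local_families_limit)
    show "clinear_op (fibre a x)" for x by (intro clinear_op_fibre closure a)
    fix \<epsilon> :: real assume "0 < \<epsilon>"
    then obtain b where b: "b \<in> ?A" "norm (b - a) < \<epsilon>"
      using a unfolding closure_approachable dist_norm by blast
    have "norm (fibre b x - fibre a x) \<le> \<epsilon>" for x
      using norm_fibre_le[of "b - a" x] b(2) by (simp add: fibre_diff)
    then show "\<exists>S\<in>?E. \<forall>x. norm (S x - fibre a x) \<le> \<epsilon>"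
      using fibre_algebraic_equivariant_quasi_local[OF assms(1,2) b(1)] by blast
  qed
  moreover have "T \<in> fibre ` closure ?A" if T: "T \<in> ?E" for T
  proof -
    obtain C where "\<And>x. norm (T x) \<le> C"
      using T unfolding equivariant_quasi_local_families_iff by auto
    \<comment> \<open>The preimage of T is its direct sum over X; fibrewise approximation by
      algebraic elements then places it in the closure, since norms of decomposable operators are
      controlled by fibres.\<close>
    then obtain a where a: "decomposable a" "\<And>x. fibre a x = T x" using exists_decomposable by blast
    have "a \<in> closure ?A"
      unfolding closure_approachable
    proof (intro allI impI)
      fix \<epsilon> :: real assume "0 < \<epsilon>"
      then obtain b where b: "b \<in> ?A" "\<And>x. norm (fibre b x - T x) \<le> \<epsilon> / 2"
        using exists_algebraic_approx[OF assms T, of "\<epsilon> / 2"] by auto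
      have "norm (b - a) \<le> \<epsilon> / 2"
        by (rule norm_decomposable_le[OF decomposable_diff[OF decomposable_algebraic[OF assms(1) b(1)] a(1)]])
          (use b \<open>0 < \<epsilon>\<close> in \<open>auto simp: fibre_diff a(2)\<close>)
      then show "\<exists>b\<in>?A. dist b a < \<epsilon>"
        using b(1) \<open>0 < \<epsilon>\<close> by (auto simp: dist_norm intro!: bexI[of _ b])
    qed
    moreover have "fibre a = T" using a(2) by auto
    ultimately show ?thesis by blast
  qed
  moreover have "inj_on fibre (closure ?A)"
    by (rule inj_onI) (metis decomposable_eqI closure(2))
  ultimately have bij: "bij_betw fibre (closure ?A) ?E"
    unfolding bij_betw_def by blast
  have "cstar_isomorphism fibre (reduced_crossed_product act)
      ((product_algebra bounded_ops)\<lparr>carrier := ?E\<rparr>)"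
    unfolding cstar_isomorphism_def reduced_crossed_product_def product_algebra_def bounded_ops_def
  proof (simp add: bij, intro conjI ballI allI ext)
    fix a b :: "('g \<times> 'x) op" and x c assume a: "a \<in> closure ?A"
    show "fibre (a + b) x = fibre a x + fibre b x"
      by (rule blinfun_eqI) (simp add: blinfun.add_left blinfun.add_right)
    \<comment> \<open>A compression is multiplicative here because a is decomposable.\<close>
    show "fibre (a o\<^sub>L b) x = fibre a x o\<^sub>L fibre b x"
      by (rule fibre_compose[OF closure(2)[OF a]])
    show "fibre (mult_op (\<lambda>_. c) o\<^sub>L a) x = mult_op (\<lambda>_. c) o\<^sub>L fibre a x"
      by (rule blinfun_eqI) (simp add: slice_op_scaleC)
    show "fibre (adjoint_op a) x = adjoint_op (fibre a x)"
      by (rule fibre_adjoint[OF closure(1)[OF a]])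
  qed
  then show "cstar_isomorphic (reduced_crossed_product act)
      ((product_algebra bounded_ops)\<lparr>carrier := ?E\<rparr>)"
    unfolding cstar_isomorphic_def by blast
qed

end
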